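(* Let $\alpha\in(0,1)$ and let $\Omega\subset\mathbb R^d$ be a piecewise $C^{2,\alpha}$-piecewise convex domain with boundary portions $\Gamma_1,\dots,\Gamma_N$ such that, for each $n$, either $\nabla n_{\Gamma_n}(x)=0$ for all $x\in\Gamma_n$ or $\nabla n_{\Gamma_n}(x)\neq 0$ for all $x\in\Gamma_n$. Let $\{\mathscr T_h\}_h$ be a regular sequence of (possibly curved) simplicial or parallelepipedal exact meshes on $\Omega$ satisfying the mesh conditions (M1)–(M3) of the context. Let $A\in L^\infty(\Omega;\mathbb R^{d\times d})$ be uniformly elliptic and satisfy the Cordes condition with constant $\varepsilon\in(0,1]$, and let $f\in L^2(\Omega)$. Let $\kappa>1$ with $\kappa<(1-\varepsilon)^{-1}$, and let $c_{\rm stab}>0$, $c_{\mathcal H}$, $\mu_F$, $\eta_F$ be chosen such that, for some fixed constant $\sigma\ge1$, $$\mu_F=\sigma\Big(c_{\rm stab}\frac{1}{\tilde h_F}+c_{\mathcal H}\Big),\qquad \eta_F\ge\frac{\sigma}{\tilde h_F^3},$$ and such that, for all $v_h\in V_{h,p}$ and all $\theta\in(0,1]$, $$\kappa B_{h,\theta}(v_h,v_h)\ge\theta|v_h|^2_{H^2(\Omega;\mathscr T_h)}+(1-\theta)\sum_{K\in\mathscr T_h}\|\Delta v_h\|^2_{L^2(K)}+\frac12J_h(v_h,v_h)+\frac\theta2\sum_{F\in\mathscr E^b_h}\Big\|\mathcal H_F^{1/2}\frac{\partial v_h}{\partial n_F}\Big\|^2_{L^2(F)}.$$ Then, for every $v_h\in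 V_{h,p}$, $$\|v_h\|_{h,1}^2\le\frac{2\kappa}{1-\kappa(1-\varepsilon)}A_h(v_h,v_h).$$ Therefore there exists a unique $u_h\in V_{h,p}$ such that $$A_h(u_h,v_h)=\sum_{K\in\mathscr T_h}\langle\gamma f,\Delta v_h\rangle_K\qquad\forall v_h\in V_{h,p}.$$ Furthermore, $$\|u_h\|_{h,1}\le\frac{2\kappa\sqrt d\,\|\gamma\|_{L^\infty(\Omega)}}{1-\kappa^2(1-\varepsilon)}\|f\|_{L^2(\Omega)}.$$
   Context: **Coefficients.** The Cordes condition with $\varepsilon\in(0,1]$: $\dfrac{|A|^2}{(\operatorname{Tr}A)^2}\le\dfrac1{d-1+\varepsilon}$ a.e. in $\Omega$, where $|A|^2=\sum_{i,j}A_{ij}^2$. Set $\gamma:=\operatorname{Tr}A/|A|^2$. **Domains.** A domain is piecewise $C^{k,\alpha}$ if $\partial\Omega=\bigcup_{n=1}^N\overline\Gamma_n$, each $\Gamma_n$ being of zero $d$-dimensional Lebesgue measure and locally the graph of a $C^{k,\alpha}$ function. It is piecewise $C^{k,\alpha}$-piecewise convex ($k\ge2$) if it is Lipschitz continuous, $\partial\Omega=\bigcup_{n=1}^N\overline\Gamma_n$, each $\Gamma_n$ is a subset of a level set of a convex $C^{k,\alpha}$ function $\varphi_n$, and the unit outward normal to $\Gamma_n$ is $n_{\Gamma_n}=\nabla\varphi_n/|\nabla\varphi_n|$. **Meshes.** $\mathscr T_h$ is a mesh of $\Omega$ of open, possibly curved, simplices or parallelepipeds $K$, exact: $\bigcup_K\overline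 K=\overline\Omega$. "Regular sequence" means shape-regular in the usual sense. Each $K=F_K(\hat K)$ with $\hat K$ a reference element, $F_K=\tilde F_K+\Phi_K$, $\tilde F_K(\hat x)=\tilde B_K\hat x+\tilde b_K$ invertible affine, $\Phi_K\in C^1(\hat K;\mathbb R^d)$, $C_K:=\sup_{\hat x\in\hat K}\|D\Phi_K(\hat x)\tilde B_K^{-1}\|<1$. $h_K:=\operatorname{diam}\tilde B_K(\hat K)$, $h=\max_Kh_K$. $\mathscr E^i_h$, $\mathscr E^b_h$ are the sets of interior and boundary faces, $\mathscr E^{i,b}_h=\mathscr E^i_h\cup\mathscr E^b_h$; interior faces are flat. Hanging nodes are allowed. $\tilde h_F:=\min(h_K,h_{K'})$ for $F=\partial K\cap\partial K'\in\mathscr E^i_h$, $\tilde h_F:=h_K$ for $F\subset\partial K\cap\partial\Omega$ in $\mathscr E^b_h$. Mesh conditions: (M1) the number of faces $F\in\mathscr E^{i,b}_h$ with $F\subset\partial K$ is at most $c_{\mathcal F}$ for all $K$, $h$, with $c_{\mathcal F}>0$ independent of $h$; (M2) $\max(h_K,h_{K'})\le c_{\mathcal T}\min(h_K,h_{K'})$ for $K,K'$ sharing a face, with $c_{\mathcal T}\ge1$ independent of $h$; (M3) each $F\in\mathscr E^b_h$ is contained in some $\Gamma_n$. **Space.** $V_{h,p}:=\{v\in L^2(\Omega):v|_K=\rho\circ F_K^{-1},\ \rho\in\mathbb P^p(\hat K)\ \forall K\in\mathscr T_h\}$, $p\ge2$, with $\mathbb P^p$ the polynomials of total or partial degree at most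 $p$. $|v|^2_{H^2(\Omega;\mathscr T_h)}=\sum_K|v|^2_{H^2(K)}$. **Jumps, averages, tangential operators.** For $F=\overline K\cap\overline{K'}\in\mathscr E^i_h$, $n_F$ is the unit normal outward to $K$, $[\![\phi]\!]=\phi|_K-\phi|_{K'}$, $\langle\!\langle\phi\rangle\!\rangle=\frac12(\phi|_K+\phi|_{K'})$; for $F\in\mathscr E^b_h$, $n_F$ is the unit outward normal and $[\![\phi]\!]=\langle\!\langle\phi\rangle\!\rangle=\phi|_K$. $\langle\cdot,\cdot\rangle_K$, $\langle\cdot,\cdot\rangle_F$ are $L^2$ inner products of scalar, vector or matrix functions. With $\{t_i\}_{i=1}^{d-1}$ an orthonormal coordinate system on $F$, $\nabla_{\mathbf T}u=\sum_it_i\,\partial u/\partial t_i$ and $\operatorname{div}_{\mathbf T}v=\sum_i\partial v_i/\partial t_i$ for $v=\sum_iv_it_i$. For $F\in\mathscr E^b_h$ contained in $\Gamma_n$, $n_F=n_{\Gamma_n}=\nabla\varphi_n/|\nabla\varphi_n|$; $(\nabla n_F^T)_{ij}=D_i(n_F)_j$ and $\mathcal H_F=(\nabla\cdot n_F)|_F$ (mean curvature). **Forms.** $$\begin{aligned}B_{h,*}(u,v)=&\sum_K\langle D^2u,D^2v\rangle_K+\sum_{F\in\mathscr E^i_h}\big[\langle\operatorname{div}_{\mathbf T}\nabla_{\mathbf T}\langle\!\langle u\rangle\!\rangle,[\![\nabla v\cdot n_F]\!]\rangle_F+\langle\operatorname{div}_{\mathbf T}\nabla_{\mathbf T}\langle\!\langle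 v\rangle\!\rangle,[\![\nabla u\cdot n_F]\!]\rangle_F\big]\\&-\sum_{F\in\mathscr E^{i,b}_h}\big[\langle\nabla_{\mathbf T}\langle\!\langle\nabla u\cdot n_F\rangle\!\rangle,[\![\nabla_{\mathbf T}v]\!]\rangle_F+\langle\nabla_{\mathbf T}\langle\!\langle\nabla v\cdot n_F\rangle\!\rangle,[\![\nabla_{\mathbf T}u]\!]\rangle_F\big]\\&+\sum_{F\in\mathscr E^b_h}\Big[\Big\langle\mathcal H_F\frac{\partial u}{\partial n_F},\frac{\partial v}{\partial n_F}\Big\rangle_F+\langle\nabla_{\mathbf T}u,\nabla n_F^T\nabla_{\mathbf T}v\rangle_F+\Big\langle\frac{\partial u}{\partial n_F},n_F^T\nabla n_F^T\nabla_{\mathbf T}v\Big\rangle_F\Big],\end{aligned}$$ $$J_h(u,v)=\sum_{F\in\mathscr E^{i,b}_h}\big[\mu_F\langle[\![\nabla_{\mathbf T}u]\!],[\![\nabla_{\mathbf T}v]\!]\rangle_F+\eta_F\langle[\![u]\!],[\![v]\!]\rangle_F\big]+\sum_{F\in\mathscr E^i_h}\mu_F\langle[\![\nabla u\cdot n_F]\!],[\![\nabla v\cdot n_F]\!]\rangle_F,$$ $$B_{h,\theta}(u,v)=\theta B_{h,*}(u,v)+(1-\theta)\sum_K\langle\Delta u,\Delta v\rangle_K+J_h(u,v),$$ $$A_h(u,v)=\sum_K\langle\gamma A:D^2u,\Delta v\rangle_K+B_{h,1/2}(u,v)-\sum_K\langle\Delta u,\Delta v\rangle_K.$$ **Norm.**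 $\|v\|_{h,1}^2=\sum_K|v|^2_{H^2(K)}+\frac12\sum_{F\in\mathscr E^b_h}\|\mathcal H_F^{1/2}\partial v/\partial n_F\|^2_{L^2(F)}+c_*J_h(v,v)$ with $c_*:=\kappa/2$.
   Formalization: Last bound proved with denominator 1−κ(1−ε), and as printed only if κ²(1−ε)<1 (else the printed constant is negative or undefined); Φ_K is assumed C² up to the boundary rather than C¹, so that D²v_h and its traces exist; μ_F>0 is assumed so that the norm is defined. *)

theory Defs
  imports "HOL-Probability.Probability"
begin

section \<open>Derivatives and smoothness classes\<close>

definition grad :: "(real^'n \<Rightarrow> real) \<Rightarrow> real^'n \<Rightarrow> real^'n" where
  "grad w x = (\<chi> i. frechet_derivative w (at x) (axis i 1))"

text \<open>\<open>jac q x $ i $ j\<close> is the derivative \<open>D\<^sub>i q\<^sub>j\<close>, i.e. the matrix written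
  \<open>\<nabla> q\<^sup>T\<close> (the transpose of the usual Jacobian matrix).\<close>

definition jac :: "(real^'n \<Rightarrow> real^'n) \<Rightarrow> real^'n \<Rightarrow> real^'n^'n" where
  "jac q x = (\<chi> i j. grad (\<lambda>y. q y $ j) x $ i)"

definition hess :: "(real^'n \<Rightarrow> real) \<Rightarrow> real^'n \<Rightarrow> real^'n^'n" where
  "hess w x = jac (grad w) x"

definition laplacian :: "(real^'n \<Rightarrow> real) \<Rightarrow> real^'n \<Rightarrow> real" where
  "laplacian w x = trace (hess w x)"

text \<open>On a closed convex body \<open>S\<close> with nonempty interior, \<open>C2_on S\<close> is the class
  \<open>C\<^sup>2\<close> up to the boundary (derivatives are taken within \<open>S\<close>).\<close>

definition C2_derivs_on :: "'a::real_normed_vector set \<Rightarrow> ('a \<Rightarrow> 'b::real_normed_vector)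
    \<Rightarrow> ('a \<Rightarrow> 'a \<Rightarrow>\<^sub>L 'b) \<Rightarrow> ('a \<Rightarrow> 'a \<Rightarrow>\<^sub>L ('a \<Rightarrow>\<^sub>L 'b)) \<Rightarrow> bool" where
  "C2_derivs_on S f f1 f2 \<longleftrightarrow>
     (\<forall>x\<in>S. (f has_derivative blinfun_apply (f1 x)) (at x within S)) \<and>
     (\<forall>x\<in>S. (f1 has_derivative blinfun_apply (f2 x)) (at x within S)) \<and>
     continuous_on S f2"

definition C2_on :: "'a::real_normed_vector set \<Rightarrow> ('a \<Rightarrow> 'b::real_normed_vector) \<Rightarrow> bool" where
  "C2_on S f \<longleftrightarrow> (\<exists>f1 f2. C2_derivs_on S f f1 f2)"

definition C2_holder_on :: "real \<Rightarrow> 'a::real_normed_vector set \<Rightarrow> ('a \<Rightarrow> 'b::real_normed_vector) \<Rightarrow> bool" where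
  "C2_holder_on \<alpha> S f \<longleftrightarrow> (\<exists>f1 f2. C2_derivs_on S f f1 f2 \<and>
     (\<forall>C. compact C \<and> C \<subseteq> S \<longrightarrow>
        (\<exists>L. \<forall>x\<in>C. \<forall>y\<in>C. norm (f2 x - f2 y) \<le> L * dist x y powr \<alpha>)))"


section \<open>Surface measure\<close>

text \<open>The \<open>m\<close>-dimensional Hausdorff measure, normalised so that it agrees with Lebesgue
  measure on \<open>m\<close>-dimensional affine subspaces.  Empty covering sets have weight zero also for
  \<open>m = 0\<close>, where \<open>0 ^ 0 = 1\<close>.\<close>

definition hausdorff_pre :: "nat \<Rightarrow> real \<Rightarrow> 'a::metric_space set \<Rightarrow> ennreal" where
  "hausdorff_pre m \<delta> S =
     (INF U \<in> {U :: nat \<Rightarrow> 'a set. S \<subseteq> (\<Union>i. U i) \<and> (\<forall>i. bounded (U i) \<and> diameter (U i) \<le> \<delta>)}.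
        \<Sum>i. if U i = {} then 0
             else ennreal (unit_ball_vol (real m) * (diameter (U i) / 2) ^ m))"

definition hausdorff_measure :: "nat \<Rightarrow> 'a::metric_space measure" where
  "hausdorff_measure m = measure_of UNIV (sets borel) (\<lambda>S. SUP \<delta>\<in>{0<..}. hausdorff_pre m \<delta> S)"

abbreviation surf_measure :: "(real^'n) measure" where
  "surf_measure \<equiv> hausdorff_measure (CARD('n) - 1)"


section \<open>Domains\<close>

definition outward_unit_normal :: "(real^'n) set \<Rightarrow> real^'n \<Rightarrow> real^'n \<Rightarrow> bool" where
  "outward_unit_normal S x n \<longleftrightarrow> norm n = 1 \<and>
     (\<forall>e>0. \<exists>r>0. \<forall>y\<in>ball x r.
        ((y - x) \<bullet> n < - e * norm (y - x) \<longrightarrow> y \<in> S) \<and>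
        ((y - x) \<bullet> n > e * norm (y - x) \<longrightarrow> y \<notin> S))"

text \<open>Near each boundary point the domain is a strict subgraph, in some direction \<open>e\<close>, of a
  Lipschitz function of the component orthogonal to \<open>e\<close>.\<close>

definition lipschitz_domain :: "(real^'n) set \<Rightarrow> bool" where
  "lipschitz_domain \<Omega> \<longleftrightarrow> open \<Omega> \<and> connected \<Omega> \<and> bounded \<Omega> \<and> \<Omega> \<noteq> {} \<and>
     (\<forall>x\<in>frontier \<Omega>. \<exists>e r L g. norm e = 1 \<and> r > 0 \<and> L-lipschitz_on UNIV g \<and>
        (\<forall>y\<in>ball x r. y \<in> \<Omega> \<longleftrightarrow> y \<bullet> e < g (y - (y \<bullet> e) *\<^sub>R e)))"

text \<open>The portion \<open>\<Gamma>\<^sub>n\<close> (\<open>piece n\<close>) lies in a level set of the convex function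
  \<open>\<phi>\<^sub>n\<close> (\<open>level_fun n\<close>), which is defined on the open convex set \<open>level_nbhd n\<close>; taking the
  latter to be \<open>UNIV\<close> gives functions on the whole space.\<close>

record 'n::finite piecewise_domain =
  region :: "(real^'n) set"
  num_pieces :: nat
  piece :: "nat \<Rightarrow> (real^'n) set"
  level_fun :: "nat \<Rightarrow> real^'n \<Rightarrow> real"
  level_nbhd :: "nat \<Rightarrow> (real^'n) set"

definition unit_normal_field :: "(real^'n \<Rightarrow> real) \<Rightarrow> real^'n \<Rightarrow> real^'n" where
  "unit_normal_field \<phi> x = grad \<phi> x /\<^sub>R norm (grad \<phi> x)"

definition piecewise_C2_convex_domain :: "real \<Rightarrow> 'n::finite piecewise_domain \<Rightarrow> bool" where
  "piecewise_C2_convex_domain \<alpha> D \<longleftrightarrow>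
     lipschitz_domain (region D) \<and>
     frontier (region D) = (\<Union>n\<in>{1..num_pieces D}. closure (piece D n)) \<and>
     (\<forall>n\<in>{1..num_pieces D}.
        open (level_nbhd D n) \<and> closure (piece D n) \<subseteq> level_nbhd D n \<and>
        convex_on (level_nbhd D n) (level_fun D n) \<and>
        C2_holder_on \<alpha> (level_nbhd D n) (level_fun D n) \<and>
        (\<exists>c. \<forall>x\<in>piece D n. level_fun D n x = c) \<and>
        (\<forall>x\<in>piece D n. outward_unit_normal (region D) x (unit_normal_field (level_fun D n) x)))"

definition curvature_dichotomy :: "'n::finite piecewise_domain \<Rightarrow> bool" where
  "curvature_dichotomy D \<longleftrightarrow> (\<forall>n\<in>{1..num_pieces D}.
     (\<forall>x\<in>piece D n. jac (unit_normal_field (level_fun D n)) x = 0) \<or>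
     (\<forall>x\<in>piece D n. jac (unit_normal_field (level_fun D n)) x \<noteq> 0))"


section \<open>Meshes\<close>

text \<open>\<open>IFace K K'\<close> is the interior face \<open>closure K \<inter> closure K'\<close> with unit normal
  outward to \<open>K\<close>.  \<open>BFace K S\<close> is a boundary face \<open>S\<close> of \<open>K\<close>.\<close>

datatype 'n::finite face =
    IFace "(real^'n) set" "(real^'n) set"
  | BFace "(real^'n) set" "(real^'n) set"

fun face_set :: "'n::finite face \<Rightarrow> (real^'n) set" where
  "face_set (IFace K K') = closure K \<inter> closure K'"
| "face_set (BFace K S) = S"

text \<open>The element map is \<open>x \<mapsto> B\<^sub>K x + b\<^sub>K + \<Phi>\<^sub>K x\<close> on the reference element \<open>refel\<close>,
  with \<open>B\<^sub>K\<close>, \<open>b\<^sub>K\<close>, \<open>\<Phi>\<^sub>K\<close> given by \<open>aff_mat\<close>, \<open>aff_vec\<close>, \<open>pert\<close>.\<close>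

record 'n::finite mesh =
  elems :: "(real^'n) set set"
  refel :: "(real^'n) set"
  aff_mat :: "(real^'n) set \<Rightarrow> real^'n^'n"
  aff_vec :: "(real^'n) set \<Rightarrow> real^'n"
  pert :: "(real^'n) set \<Rightarrow> real^'n \<Rightarrow> real^'n"
  ifaces :: "'n face set"
  bfaces :: "'n face set"

definition faces :: "'n::finite mesh \<Rightarrow> 'n face set" where
  "faces T = ifaces T \<union> bfaces T"

definition aff_map :: "'n::finite mesh \<Rightarrow> (real^'n) set \<Rightarrow> real^'n \<Rightarrow> real^'n" where
  "aff_map T K x = aff_mat T K *v x + aff_vec T K"

definition elem_map :: "'n::finite mesh \<Rightarrow> (real^'n) set \<Rightarrow> real^'n \<Rightarrow> real^'n" where
  "elem_map T K x = aff_map T K x + pert T K x"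

definition pert_bound :: "'n::finite mesh \<Rightarrow> (real^'n) set \<Rightarrow> real" where
  "pert_bound T K = (SUP x\<in>refel T.
     onorm (\<lambda>v. frechet_derivative (pert T K) (at x) (matrix_inv (aff_mat T K) *v v)))"

definition elem_size :: "'n::finite mesh \<Rightarrow> (real^'n) set \<Rightarrow> real" where
  "elem_size T K = diameter ((\<lambda>x. aff_mat T K *v x) ` refel T)"

definition reference_simplex :: "(real^'n) set \<Rightarrow> bool" where
  "reference_simplex R \<longleftrightarrow> (\<exists>S. int CARD('n) simplex S \<and> R = interior S)"

definition reference_parallelepiped :: "(real^'n) set \<Rightarrow> bool" where
  "reference_parallelepiped R \<longleftrightarrow>
     (\<exists>B b. invertible (B :: real^'n^'n) \<and> R = (\<lambda>x. B *v x + b) ` {x. \<forall>i. 0 < x $ i \<and> x $ i < 1})"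

text \<open>\<open>S\<close> lies in a hyperplane with unit normal \<open>n\<close>, and \<open>n\<close> points out of \<open>K\<close>.\<close>

definition flat_outward_normal :: "(real^'n) set \<Rightarrow> (real^'n) set \<Rightarrow> real^'n \<Rightarrow> bool" where
  "flat_outward_normal K S n \<longleftrightarrow> norm n = 1 \<and> (\<exists>c. S \<subseteq> {x. n \<bullet> x = c}) \<and>
     (\<forall>x\<in>rel_interior S. outward_unit_normal K x n)"

definition interior_faces_of :: "'n::finite mesh \<Rightarrow> bool" where
  "interior_faces_of T \<longleftrightarrow>
     (\<forall>F\<in>ifaces T. \<exists>K\<in>elems T. \<exists>K'\<in>elems T. F = IFace K K' \<and> K \<noteq> K' \<and>
        emeasure surf_measure (closure K \<inter> closure K') > 0 \<and>
        (\<exists>n. flat_outward_normal K (closure K \<inter> closure K') n)) \<and>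
     (\<forall>K\<in>elems T. \<forall>K'\<in>elems T. K \<noteq> K' \<and> emeasure surf_measure (closure K \<inter> closure K') > 0 \<longrightarrow>
        (IFace K K' \<in> ifaces T) \<noteq> (IFace K' K \<in> ifaces T))"

text \<open>Boundary faces are closed, so that they exhaust the part of the boundary in \<open>\<partial>\<Omega>\<close> and are
  disjoint only up to null sets.  With hanging nodes a boundary face may be a proper
  part of the image of a facet of the reference element.\<close>

definition boundary_faces_of :: "(real^'n::finite) set \<Rightarrow> 'n mesh \<Rightarrow> bool" where
  "boundary_faces_of \<Omega> T \<longleftrightarrow> finite (bfaces T) \<and>
     (\<forall>F\<in>bfaces T. \<exists>K\<in>elems T. \<exists>S. F = BFace K S \<and> closed S \<and>
        S \<subseteq> frontier K \<inter> frontier \<Omega> \<and>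
        (\<exists>R. R facet_of closure (refel T) \<and> S \<subseteq> elem_map T K ` R) \<and>
        emeasure surf_measure S > 0) \<and>
     (\<forall>F\<in>bfaces T. \<forall>F'\<in>bfaces T. F \<noteq> F' \<longrightarrow>
        emeasure surf_measure (face_set F \<inter> face_set F') = 0) \<and>
     (\<forall>K\<in>elems T.
        emeasure surf_measure (frontier K \<inter> frontier \<Omega> - \<Union>{S. BFace K S \<in> bfaces T}) = 0)"

text \<open>Perturbations are \<open>C\<^sup>2\<close> up to the boundary: this is what makes the second derivatives of
  discrete functions on the elements, and their traces on the faces, meaningful.\<close>

definition exact_mesh :: "(real^'n::finite) set \<Rightarrow> 'n mesh \<Rightarrow> bool" where
  "exact_mesh \<Omega> T \<longleftrightarrow>
     (reference_simplex (refel T) \<or> reference_parallelepiped (refel T)) \<and>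
     finite (elems T) \<and> disjoint (elems T) \<and> (\<forall>K\<in>elems T. K \<subseteq> \<Omega>) \<and>
     (\<Union>K\<in>elems T. closure K) = closure \<Omega> \<and>
     (\<forall>K\<in>elems T. invertible (aff_mat T K) \<and> C2_on (closure (refel T)) (pert T K) \<and>
        pert_bound T K < 1 \<and> K = elem_map T K ` refel T) \<and>
     interior_faces_of T \<and> boundary_faces_of \<Omega> T"

definition shape_regular :: "('i \<Rightarrow> 'n::finite mesh) \<Rightarrow> bool" where
  "shape_regular T \<longleftrightarrow> (\<exists>c. \<forall>i. \<forall>K\<in>elems (T i).
     elem_size (T i) K \<le> c * Sup {2 * r |r x. 0 < r \<and> ball x r \<subseteq> aff_map (T i) K ` refel (T i)})"

definition mesh_cond_M1 :: "('i \<Rightarrow> 'n::finite mesh) \<Rightarrow> bool" where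
  "mesh_cond_M1 T \<longleftrightarrow> (\<exists>c>0. \<forall>i. \<forall>K\<in>elems (T i).
     real (card {F \<in> faces (T i). face_set F \<subseteq> frontier K}) \<le> c)"

definition mesh_cond_M2 :: "('i \<Rightarrow> 'n::finite mesh) \<Rightarrow> bool" where
  "mesh_cond_M2 T \<longleftrightarrow> (\<exists>c\<ge>1. \<forall>i K K'. IFace K K' \<in> ifaces (T i) \<longrightarrow>
     max (elem_size (T i) K) (elem_size (T i) K') \<le> c * min (elem_size (T i) K) (elem_size (T i) K'))"

definition mesh_cond_M3 :: "'n::finite piecewise_domain \<Rightarrow> ('i \<Rightarrow> 'n mesh) \<Rightarrow> bool" where
  "mesh_cond_M3 D T \<longleftrightarrow> (\<forall>i. \<forall>F\<in>bfaces (T i).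
     \<exists>n\<in>{1..num_pieces D}. face_set F \<subseteq> closure (piece D n))"

fun face_size :: "'n::finite mesh \<Rightarrow> 'n face \<Rightarrow> real" where
  "face_size T (IFace K K') = min (elem_size T K) (elem_size T K')"
| "face_size T (BFace K S) = elem_size T K"


section \<open>Discrete spaces\<close>

definition L2_fun :: "(real^'n) set \<Rightarrow> (real^'n \<Rightarrow> real) \<Rightarrow> bool" where
  "L2_fun \<Omega> f \<longleftrightarrow> f \<in> borel_measurable (lebesgue_on \<Omega>) \<and> integrable (lebesgue_on \<Omega>) (\<lambda>x. (f x)\<^sup>2)"

definition L2_norm_on :: "(real^'n) set \<Rightarrow> (real^'n \<Rightarrow> real) \<Rightarrow> real" where
  "L2_norm_on \<Omega> f = sqrt (\<integral>x. (f x)\<^sup>2 \<partial>lebesgue_on \<Omega>)"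

definition Linf_norm_on :: "(real^'n) set \<Rightarrow> (real^'n \<Rightarrow> real) \<Rightarrow> real" where
  "Linf_norm_on \<Omega> f = real_of_ereal (esssup (lebesgue_on \<Omega>) (\<lambda>x. ereal \<bar>f x\<bar>))"

datatype degree_kind = TotalDegree | PartialDegree

fun exponents :: "degree_kind \<Rightarrow> nat \<Rightarrow> ('n::finite \<Rightarrow> nat) set" where
  "exponents TotalDegree p = {m. (\<Sum>i\<in>UNIV. m i) \<le> p}"
| "exponents PartialDegree p = {m. \<forall>i. m i \<le> p}"

definition poly_space :: "degree_kind \<Rightarrow> nat \<Rightarrow> (real^'n \<Rightarrow> real) set" where
  "poly_space k p = {\<rho>. \<exists>c. \<rho> = (\<lambda>x. \<Sum>m\<in>exponents k p. c m * (\<Prod>i\<in>UNIV. x $ i ^ m i))}"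

text \<open>The elements cover \<open>\<Omega>\<close> up to a null set.  Classes of functions equal almost everywhere
  are represented by the function vanishing outside the elements, so equality in
  \<open>dg_space\<close> is equality in \<open>L\<^sup>2(\<Omega>)\<close>.\<close>

definition dg_space :: "(real^'n::finite) set \<Rightarrow> 'n mesh \<Rightarrow> degree_kind \<Rightarrow> nat \<Rightarrow> (real^'n \<Rightarrow> real) set" where
  "dg_space \<Omega> T k p = {v. L2_fun \<Omega> v \<and> (\<forall>x. x \<notin> \<Union>(elems T) \<longrightarrow> v x = 0) \<and>
     (\<forall>K\<in>elems T. \<exists>\<rho>\<in>poly_space k p. \<forall>x\<in>K. v x = \<rho> (inv_into (refel T) (elem_map T K) x))}"


section \<open>Traces, jumps and tangential operators\<close>

text \<open>One-sided traces on a face, from the element \<open>K\<close>.\<close>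

definition tr :: "(real^'n) set \<Rightarrow> (real^'n \<Rightarrow> 'b::t2_space) \<Rightarrow> real^'n \<Rightarrow> 'b" where
  "tr K w x = Lim (at x within K) w"

text \<open>For a quantity \<open>q\<close> with one-sided traces \<open>q K\<close> on a face.\<close>

fun jump :: "'n::finite face \<Rightarrow> ((real^'n) set \<Rightarrow> 'b) \<Rightarrow> 'b::real_vector" where
  "jump (IFace K K') q = q K - q K'"
| "jump (BFace K S) q = q K"

fun avg :: "'n::finite face \<Rightarrow> ((real^'n) set \<Rightarrow> 'b) \<Rightarrow> 'b::real_vector" where
  "avg (IFace K K') q = (1/2) *\<^sub>R (q K + q K')"
| "avg (BFace K S) q = q K"

text \<open>On a boundary face the normal is extended off the face by the level function, on an
  interior (flat) face by a constant.\<close>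

fun nF :: "'n::finite piecewise_domain \<Rightarrow> 'n face \<Rightarrow> real^'n \<Rightarrow> real^'n" where
  "nF D (IFace K K') = (\<lambda>_. SOME n. flat_outward_normal K (closure K \<inter> closure K') n)"
| "nF D (BFace K S) =
     unit_normal_field (level_fun D (SOME n. n \<in> {1..num_pieces D} \<and> S \<subseteq> closure (piece D n)))"

definition mean_curv :: "'n::finite piecewise_domain \<Rightarrow> 'n face \<Rightarrow> real^'n \<Rightarrow> real" where
  "mean_curv D F x = trace (jac (nF D F) x)"

text \<open>An orthonormal basis \<open>{t\<^sub>i}\<close> of the tangent space orthogonal to \<open>n\<close>.\<close>

definition tangent_basis :: "real^'n \<Rightarrow> (real^'n) set" where
  "tangent_basis n = (SOME B. pairwise orthogonal B \<and> (\<forall>t\<in>B. norm t = 1) \<and> span B = {t. n \<bullet> t = 0})"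

text \<open>\<open>tan_grad K w n x\<close> is the sum of \<open>t\<^sub>i \<partial>w/\<partial>t\<^sub>i\<close>, and \<open>tan_div_grad K w n x\<close> is the
  sum of \<open>\<partial>v\<^sub>i/\<partial>t\<^sub>i\<close> with \<open>v\<^sub>i = \<partial>w/\<partial>t\<^sub>i\<close>; the latter is used on flat faces only,
  where the \<open>t\<^sub>i\<close> are constant.\<close>

definition tan_grad :: "(real^'n) set \<Rightarrow> (real^'n \<Rightarrow> real) \<Rightarrow> real^'n \<Rightarrow> real^'n \<Rightarrow> real^'n" where
  "tan_grad K w n x = (\<Sum>t\<in>tangent_basis n. (tr K (grad w) x \<bullet> t) *\<^sub>R t)"

definition tan_div_grad :: "(real^'n) set \<Rightarrow> (real^'n \<Rightarrow> real) \<Rightarrow> real^'n \<Rightarrow> real^'n \<Rightarrow> real" where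
  "tan_div_grad K w n x = (\<Sum>t\<in>tangent_basis n. tr K (grad (\<lambda>y. grad w y \<bullet> t)) x \<bullet> t)"

text \<open>The face operators below are jumps and averages of one-sided traces; since differentiation
  is linear, \<open>\<nabla>\<^sub>T\<close> and \<open>div\<^sub>T \<nabla>\<^sub>T\<close> of an average are the averages of the
  one-sided quantities.\<close>

definition jump_val :: "'n::finite face \<Rightarrow> (real^'n \<Rightarrow> real) \<Rightarrow> real^'n \<Rightarrow> real" where
  "jump_val F u x = jump F (\<lambda>K. tr K u x)"

definition jump_nderiv :: "'n::finite piecewise_domain \<Rightarrow> 'n face \<Rightarrow> (real^'n \<Rightarrow> real) \<Rightarrow> real^'n \<Rightarrow> real" where
  "jump_nderiv D F u x = jump F (\<lambda>K. tr K (grad u) x \<bullet> nF D F x)"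

definition jump_tgrad :: "'n::finite piecewise_domain \<Rightarrow> 'n face \<Rightarrow> (real^'n \<Rightarrow> real) \<Rightarrow> real^'n \<Rightarrow> real^'n" where
  "jump_tgrad D F u x = jump F (\<lambda>K. tan_grad K u (nF D F x) x)"

definition tgrad_avg_nderiv :: "'n::finite piecewise_domain \<Rightarrow> 'n face \<Rightarrow> (real^'n \<Rightarrow> real) \<Rightarrow> real^'n \<Rightarrow> real^'n" where
  "tgrad_avg_nderiv D F u x = avg F (\<lambda>K. tan_grad K (\<lambda>y. grad u y \<bullet> nF D F y) (nF D F x) x)"

definition tdivgrad_avg :: "'n::finite piecewise_domain \<Rightarrow> 'n face \<Rightarrow> (real^'n \<Rightarrow> real) \<Rightarrow> real^'n \<Rightarrow> real" where
  "tdivgrad_avg D F u x = avg F (\<lambda>K. tan_div_grad K u (nF D F x) x)"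

text \<open>On boundary faces jumps are one-sided traces, so that \<open>jump_nderiv\<close> and \<open>jump_tgrad\<close>
  are the normal derivative and the tangential gradient there.\<close>


section \<open>Bilinear forms and norm\<close>

definition ip_elem :: "(real^'n) set \<Rightarrow> (real^'n \<Rightarrow> 'b::real_inner) \<Rightarrow> (real^'n \<Rightarrow> 'b) \<Rightarrow> real" where
  "ip_elem K f g = (\<integral>x. f x \<bullet> g x \<partial>lebesgue_on K)"

definition ip_face :: "'n::finite face \<Rightarrow> (real^'n \<Rightarrow> 'b::real_inner) \<Rightarrow> (real^'n \<Rightarrow> 'b) \<Rightarrow> real" where
  "ip_face F f g = (\<integral>x. f x \<bullet> g x \<partial>restrict_space surf_measure (face_set F))"

definition B_star :: "'n::finite piecewise_domain \<Rightarrow> 'n mesh \<Rightarrow> (real^'n \<Rightarrow> real) \<Rightarrow> (real^'n \<Rightarrow> real) \<Rightarrow> real" where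
  "B_star D T u v =
     (\<Sum>K\<in>elems T. ip_elem K (hess u) (hess v))
   + (\<Sum>F\<in>ifaces T. ip_face F (tdivgrad_avg D F u) (jump_nderiv D F v)
                    + ip_face F (tdivgrad_avg D F v) (jump_nderiv D F u))
   - (\<Sum>F\<in>faces T. ip_face F (tgrad_avg_nderiv D F u) (jump_tgrad D F v)
                   + ip_face F (tgrad_avg_nderiv D F v) (jump_tgrad D F u))
   + (\<Sum>F\<in>bfaces T.
        ip_face F (\<lambda>x. mean_curv D F x * jump_nderiv D F u x) (jump_nderiv D F v)
      + ip_face F (jump_tgrad D F u) (\<lambda>x. jac (nF D F) x *v jump_tgrad D F v x)
      + ip_face F (jump_nderiv D F u) (\<lambda>x. nF D F x \<bullet> (jac (nF D F) x *v jump_tgrad D F v x)))"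

definition J_form :: "'n::finite piecewise_domain \<Rightarrow> 'n mesh \<Rightarrow> ('n face \<Rightarrow> real) \<Rightarrow> ('n face \<Rightarrow> real)
    \<Rightarrow> (real^'n \<Rightarrow> real) \<Rightarrow> (real^'n \<Rightarrow> real) \<Rightarrow> real" where
  "J_form D T \<mu> \<eta> u v =
     (\<Sum>F\<in>faces T. \<mu> F * ip_face F (jump_tgrad D F u) (jump_tgrad D F v)
                  + \<eta> F * ip_face F (jump_val F u) (jump_val F v))
   + (\<Sum>F\<in>ifaces T. \<mu> F * ip_face F (jump_nderiv D F u) (jump_nderiv D F v))"

definition lap_form :: "'n::finite mesh \<Rightarrow> (real^'n \<Rightarrow> real) \<Rightarrow> (real^'n \<Rightarrow> real) \<Rightarrow> real" where
  "lap_form T u v = (\<Sum>K\<in>elems T. ip_elem K (laplacian u) (laplacian v))"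

definition B_theta :: "'n::finite piecewise_domain \<Rightarrow> 'n mesh \<Rightarrow> ('n face \<Rightarrow> real) \<Rightarrow> ('n face \<Rightarrow> real)
    \<Rightarrow> real \<Rightarrow> (real^'n \<Rightarrow> real) \<Rightarrow> (real^'n \<Rightarrow> real) \<Rightarrow> real" where
  "B_theta D T \<mu> \<eta> \<theta> u v =
     \<theta> * B_star D T u v + (1 - \<theta>) * lap_form T u v + J_form D T \<mu> \<eta> u v"

definition gamma_coeff :: "(real^'n \<Rightarrow> real^'n^'n) \<Rightarrow> real^'n \<Rightarrow> real" where
  "gamma_coeff A x = trace (A x) / (norm (A x))\<^sup>2"

definition A_form :: "'n::finite piecewise_domain \<Rightarrow> 'n mesh \<Rightarrow> ('n face \<Rightarrow> real) \<Rightarrow> ('n face \<Rightarrow> real)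
    \<Rightarrow> (real^'n \<Rightarrow> real^'n^'n) \<Rightarrow> (real^'n \<Rightarrow> real) \<Rightarrow> (real^'n \<Rightarrow> real) \<Rightarrow> real" where
  "A_form D T \<mu> \<eta> A u v =
     (\<Sum>K\<in>elems T. ip_elem K (\<lambda>x. gamma_coeff A x * (A x \<bullet> hess u x)) (laplacian v))
   + B_theta D T \<mu> \<eta> (1/2) u v - lap_form T u v"

definition H2_broken_sq :: "'n::finite mesh \<Rightarrow> (real^'n \<Rightarrow> real) \<Rightarrow> real" where
  "H2_broken_sq T v = (\<Sum>K\<in>elems T. ip_elem K (hess v) (hess v))"

definition curv_sq :: "'n::finite piecewise_domain \<Rightarrow> 'n mesh \<Rightarrow> (real^'n \<Rightarrow> real) \<Rightarrow> real" where
  "curv_sq D T v = (\<Sum>F\<in>bfaces T.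
     ip_face F (\<lambda>x. sqrt (mean_curv D F x) * jump_nderiv D F v x)
               (\<lambda>x. sqrt (mean_curv D F x) * jump_nderiv D F v x))"

definition norm_h1 :: "'n::finite piecewise_domain \<Rightarrow> 'n mesh \<Rightarrow> ('n face \<Rightarrow> real) \<Rightarrow> ('n face \<Rightarrow> real)
    \<Rightarrow> real \<Rightarrow> (real^'n \<Rightarrow> real) \<Rightarrow> real" where
  "norm_h1 D T \<mu> \<eta> \<kappa> v =
     sqrt (H2_broken_sq T v + (1/2) * curv_sq D T v + (\<kappa> / 2) * J_form D T \<mu> \<eta> v v)"


section \<open>Coefficients\<close>

text \<open>The norm on \<open>real^'n^'n\<close> and the inner product \<open>A \<bullet> M\<close> are the Frobenius ones.\<close>

definition Linf_matrix :: "(real^'n) set \<Rightarrow> (real^'n \<Rightarrow> real^'n^'n) \<Rightarrow> bool" where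
  "Linf_matrix \<Omega> A \<longleftrightarrow> A \<in> borel_measurable (lebesgue_on \<Omega>) \<and>
     (\<exists>C. AE x in lebesgue_on \<Omega>. norm (A x) \<le> C)"

definition uniformly_elliptic :: "(real^'n) set \<Rightarrow> (real^'n \<Rightarrow> real^'n^'n) \<Rightarrow> bool" where
  "uniformly_elliptic \<Omega> A \<longleftrightarrow> (\<exists>c C. 0 < c \<and> (AE x in lebesgue_on \<Omega>.
     \<forall>z. c * (norm z)\<^sup>2 \<le> z \<bullet> (A x *v z) \<and> z \<bullet> (A x *v z) \<le> C * (norm z)\<^sup>2))"

definition cordes :: "(real^'n) set \<Rightarrow> real \<Rightarrow> (real^'n \<Rightarrow> real^'n^'n) \<Rightarrow> bool" where
  "cordes \<Omega> \<epsilon> A \<longleftrightarrow> (AE x in lebesgue_on \<Omega>.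
     (norm (A x))\<^sup>2 / (trace (A x))\<^sup>2 \<le> 1 / (real CARD('n) - 1 + \<epsilon>))"

end

theory Submission
  imports Defs
begin

text \<open>Coercivity: by the Cordes condition \<open>(\<gamma> A : M - tr M)\<^sup>2 \<le> (1 - \<epsilon>) |M|\<^sup>2\<close> almost everywhere, so Young's
  inequality with equal weights bounds the nondivergence part of \<open>A\<^sub>h\<close> from below by the broken Laplacian
  term, which \<open>B\<^bsub>h,1/2\<^esub>\<close> compensates, and a multiple of the broken \<open>H\<^sup>2\<close> seminorm, which the stability
  estimate for \<open>\<theta> = 1\<close> absorbs.  Existence and uniqueness then follow in finite dimension once the norm is
  definite.  If it vanishes, the function is affine on each element and agrees across interior faces
  of positive measure.  Sets of \<open>(d - 1)\<close>-dimensional measure zero are avoided by almost every line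
  parallel to a coordinate axis; along such a line the function is a single affine function that vanishes at
  the two exit points from \<open>\<Omega>\<close>, so its slope is zero.\<close>

section \<open>Hausdorff measure\<close>

lemma outer_measure_space_UN_le:
  fixes f :: "'a set \<Rightarrow> ennreal" and A :: "nat \<Rightarrow> 'a set"
  assumes om: "outer_measure_space UNIV f"
  shows "f (\<Union>i. A i) \<le> (\<Sum>i. f (A i))"
proof -
  have "f (\<Union>i. A i) = f (\<Union>i. disjointed A i)" by (simp add: UN_disjointed_eq)
  also have "\<dots> \<le> (\<Sum>i. f (disjointed A i))"
    using om disjoint_family_disjointed[of A] unfolding outer_measure_space_def countably_subadditive_def by simp
  also have "\<dots> \<le> (\<Sum>i. f (A i))"
    using om disjointed_subset[of A] unfolding outer_measure_space_def increasing_def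
    by (intro suminf_le) auto
  finally show ?thesis .
qed

lemma metric_outer_measure_lambda_system:
  fixes f :: "'a::metric_space set \<Rightarrow> ennreal"
  assumes om: "outer_measure_space UNIV f"
    and add: "\<And>A B d. 0 < d \<Longrightarrow> (\<And>x y. x \<in> A \<Longrightarrow> y \<in> B \<Longrightarrow> d \<le> dist x y) \<Longrightarrow> f A + f B \<le> f (A \<union> B)"
    and C: "closed C"
  shows "C \<in> lambda_system UNIV UNIV f"
proof -
  have pos: "f {} = 0" and inc: "\<And>A B. A \<subseteq> B \<Longrightarrow> f A \<le> f B"
    using om by (auto simp: outer_measure_space_def positive_def increasing_def)
  have sub: "f (A \<union> B) \<le> f A + f B" for A B
  proof -
    have "f (\<Union>i. binaryset A B i) \<le> (\<Sum>i. f (binaryset A B i))"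
      by (rule outer_measure_space_UN_le[OF om])
    then show ?thesis using suminf_binaryset_eq[of f A B] pos by (simp add: UN_binaryset_eq)
  qed
  have main: "f (X \<inter> C) + f (X - C) \<le> f X" if CN: "C \<noteq> {}" and fin: "f X < \<infinity>" for X
  proof -
    define D where "D n = {x \<in> X. infdist x C \<ge> 1 / real (n + 1)}" for n
    define R where "R k = {x \<in> X. infdist x C \<ge> 1 / real (k + 2) \<and> infdist x C < 1 / real (k + 1)}" for k
    have DX: "f (X \<inter> C) + f (D n) \<le> f X" for n
    proof -
      have "f (X \<inter> C) + f (D n) \<le> f (X \<inter> C \<union> D n)"
      proof (rule add[of "1 / real (n + 1)"])
        fix x y assume "x \<in> X \<inter> C" "y \<in> D n"
        then show "1 / real (n + 1) \<le> dist x y"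
          using infdist_le[of x C y] by (simp add: D_def dist_commute)
      qed simp
      also have "\<dots> \<le> f X" by (rule inc) (auto simp: D_def)
      finally show ?thesis .
    qed
    have sep: "f (\<Union>k<N. R (2 * k + j)) \<ge> (\<Sum>k<N. f (R (2 * k + j)))" for N j
    proof (induction N)
      case (Suc N)
      have "(\<Sum>k<Suc N. f (R (2 * k + j))) \<le> f (\<Union>k<N. R (2 * k + j)) + f (R (2 * N + j))"
        using Suc by (simp add: add_mono)
      also have "\<dots> \<le> f ((\<Union>k<N. R (2 * k + j)) \<union> R (2 * N + j))"
      proof (cases "N = 0")
        case False
        let ?d = "1 / real (2 * N + j) - 1 / real (2 * N + j + 1)"
        show ?thesis
        proof (rule add[of ?d])
          have "1 / real (2 * N + j + 1) < 1 / real (2 * N + j)"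
            using False by (intro divide_strict_left_mono) auto
          then show "0 < ?d" by simp
          fix x y assume "x \<in> (\<Union>k<N. R (2 * k + j))" and y: "y \<in> R (2 * N + j)"
          then obtain k where k: "k < N" "x \<in> R (2 * k + j)" by auto
          have "1 / real (2 * N + j) \<le> 1 / real (2 * k + j + 2)"
            using k(1) by (intro divide_left_mono) (auto simp flip: of_nat_mult of_nat_add)
          then have "1 / real (2 * N + j) \<le> infdist x C" using k(2) by (simp add: R_def add.assoc)
          moreover have "infdist y C < 1 / real (2 * N + j + 1)" using y by (simp add: R_def)
          moreover have "infdist x C \<le> infdist y C + dist x y" by (rule infdist_triangle)
          ultimately show "?d \<le> dist x y" by linarith
        qed
      qed (simp add: pos)
      also have "(\<Union>k<N. R (2 * k + j)) \<union> R (2 * N + j) = (\<Union>k<Suc N. R (2 * k + j))"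
        by (auto simp: lessThan_Suc)
      finally show ?case .
    qed (simp add: pos)
    have sep': "(\<Sum>k<N. f (R (2 * k + j))) \<le> f X" for N j
      by (rule order_trans[OF sep inc]) (auto simp: R_def)
    have part: "(\<Sum>k<N. f (R k)) \<le> 2 * f X" for N
    proof -
      have "(\<Sum>k<N. f (R k)) \<le> (\<Sum>k<2*N. f (R k))" by (rule sum_mono2) auto
      also have "\<dots> = (\<Sum>k<N. f (R (2 * k + 0))) + (\<Sum>k<N. f (R (2 * k + 1)))"
        by (induction N) (simp_all add: ac_simps)
      also have "\<dots> \<le> f X + f X" by (intro add_mono sep')
      finally show ?thesis by (simp add: mult_2)
    qed
    define S where "S = (\<Sum>k. f (R k))"
    have "S \<le> 2 * f X" unfolding S_def by (rule suminf_le_const) (auto simp: part)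
    then have Sfin: "S < \<infinity>" using fin by (auto simp: less_top[symmetric] top_unique ennreal_mult_eq_top_iff)
    have eq: "X - C = D n \<union> (\<Union>k. R (k + n))" for n
    proof (intro set_eqI iffI)
      fix x assume x: "x \<in> X - C"
      then have d: "infdist x C > 0"
        using infdist_pos_not_in_closed[OF C CN] by auto
      show "x \<in> D n \<union> (\<Union>k. R (k + n))"
      proof (cases "infdist x C \<ge> 1 / real (n + 1)")
        case False
        obtain m where m: "1 / real (Suc m) < infdist x C" using d by (metis nat_approx_posE)
        define k where "k = (LEAST m. 1 / real (Suc m) \<le> infdist x C)"
        have k: "1 / real (Suc k) \<le> infdist x C" unfolding k_def by (rule LeastI[of _ m]) (use m in simp)
        have kn: "k > n"
        proof (rule ccontr)
          assume "\<not> k > n"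
          then have "1 / real (n + 1) \<le> 1 / real (Suc k)" by (intro divide_left_mono) auto
          with k False show False by simp
        qed
        then obtain l where l: "k = Suc (l + n)" by (metis add.commute less_imp_Suc_add)
        have "\<not> 1 / real (Suc (l + n)) \<le> infdist x C"
          by (rule not_less_Least[of "l + n" "\<lambda>m. 1 / real (Suc m) \<le> infdist x C", folded k_def]) (simp add: l)
        then have "x \<in> R (l + n)" using k x by (simp add: R_def l)
        then show ?thesis by auto
      qed (use x in \<open>simp add: D_def\<close>)
    next
      fix x assume "x \<in> D n \<union> (\<Union>k. R (k + n))"
      then have "x \<in> X" "infdist x C > 0"
        by (auto simp: D_def R_def intro: less_le_trans[rotated])
      then show "x \<in> X - C" by auto
    qed
    have le: "f (X \<inter> C) + f (X - C) + (\<Sum>k<n. f (R k)) \<le> f X + S" for n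
    proof -
      have "f (X - C) \<le> f (D n) + f (\<Union>k. R (k + n))" by (subst eq[of n]) (rule sub)
      also have "\<dots> \<le> f (D n) + (\<Sum>k. f (R (k + n)))"
        by (intro add_mono order_refl outer_measure_space_UN_le[OF om])
      finally have "f (X - C) \<le> f (D n) + (\<Sum>k. f (R (k + n)))" .
      then have "f (X \<inter> C) + f (X - C) + (\<Sum>k<n. f (R k))
          \<le> f (X \<inter> C) + (f (D n) + (\<Sum>k. f (R (k + n)))) + (\<Sum>k<n. f (R k))"
        by (intro add_mono order_refl)
      also have "\<dots> = (f (X \<inter> C) + f (D n)) + ((\<Sum>k. f (R (k + n))) + (\<Sum>k<n. f (R k)))"
        by (simp add: ac_simps)
      also have "\<dots> = (f (X \<inter> C) + f (D n)) + S"
        unfolding S_def by (subst (2) suminf_offset[of _ n]) auto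
      also have "\<dots> \<le> f X + S" by (intro add_mono order_refl DX)
      finally show ?thesis .
    qed
    have "(\<lambda>n. f (X \<inter> C) + f (X - C) + (\<Sum>k<n. f (R k))) \<longlonglongrightarrow> f (X \<inter> C) + f (X - C) + S"
      unfolding S_def by (intro tendsto_add tendsto_const summable_LIMSEQ) auto
    then have "f (X \<inter> C) + f (X - C) + S \<le> f X + S"
      by (rule LIMSEQ_le_const2) (use le in auto)
    then show ?thesis using Sfin by (auto simp: add.commute[of _ S] ennreal_add_left_cancel_le)
  qed
  have "f (C \<inter> X) + f ((UNIV - C) \<inter> X) = f X" for X
  proof (rule antisym)
    have *: "(UNIV - C) \<inter> X = X - C" "C \<inter> X = X \<inter> C" by auto
    show "f (C \<inter> X) + f ((UNIV - C) \<inter> X) \<le> f X"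
      unfolding * using main[of X] pos by (cases "C = {}"; cases "f X < \<infinity>") (auto simp: less_top[symmetric])
    show "f X \<le> f (C \<inter> X) + f ((UNIV - C) \<inter> X)"
      unfolding * using sub[of "X \<inter> C" "X - C"] by (simp add: Un_Diff_Int Int_Diff_Un)
  qed
  then show ?thesis by (simp add: lambda_system_def)
qed

definition hausdorff_weight :: "nat \<Rightarrow> 'a::metric_space set \<Rightarrow> ennreal" where
  "hausdorff_weight m U = (if U = {} then 0 else ennreal (unit_ball_vol (real m) * (diameter U / 2) ^ m))"

definition hausdorff_outer :: "nat \<Rightarrow> 'a::metric_space set \<Rightarrow> ennreal" where
  "hausdorff_outer m S = (SUP \<delta>\<in>{0<..}. hausdorff_pre m \<delta> S)"

lemma hausdorff_pre_le:
  assumes "S \<subseteq> (\<Union>i. U i)" "\<And>i. bounded (U i)" "\<And>i. diameter (U i) \<le> \<delta>"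
  shows "hausdorff_pre m \<delta> S \<le> (\<Sum>i. hausdorff_weight m (U i))"
  unfolding hausdorff_pre_def hausdorff_weight_def by (rule INF_lower2[of U]) (use assms in auto)

lemma hausdorff_pre_approx:
  assumes "hausdorff_pre m \<delta> S < a"
  obtains U :: "nat \<Rightarrow> 'a::metric_space set" where "S \<subseteq> (\<Union>i. U i)" "\<And>i. bounded (U i)"
    "\<And>i. diameter (U i) \<le> \<delta>" "(\<Sum>i. hausdorff_weight m (U i)) < a"
  using assms unfolding hausdorff_pre_def INF_less_iff hausdorff_weight_def by blast

lemma hausdorff_pre_greatest:
  assumes "\<And>U. S \<subseteq> (\<Union>i. U i) \<Longrightarrow> (\<And>i. bounded (U i)) \<Longrightarrow> (\<And>i. diameter (U i) \<le> \<delta>)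
    \<Longrightarrow> a \<le> (\<Sum>i. hausdorff_weight m (U i))"
  shows "a \<le> hausdorff_pre m \<delta> S"
  unfolding hausdorff_pre_def by (rule INF_greatest) (use assms in \<open>auto simp: hausdorff_weight_def\<close>)

lemma hausdorff_pre_antimono: "\<delta> \<le> \<delta>' \<Longrightarrow> hausdorff_pre m \<delta>' S \<le> hausdorff_pre m \<delta> S"
  by (rule hausdorff_pre_greatest, rule hausdorff_pre_le) (auto intro: order_trans)

lemma hausdorff_pre_mono: "S \<subseteq> S' \<Longrightarrow> hausdorff_pre m \<delta> S \<le> hausdorff_pre m \<delta> S'"
  by (rule hausdorff_pre_greatest, rule hausdorff_pre_le) auto

lemma hausdorff_pre_empty: "0 < \<delta> \<Longrightarrow> hausdorff_pre m \<delta> {} = 0"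
  using hausdorff_pre_le[of "{}" "\<lambda>_. {}" \<delta> m] by (simp add: hausdorff_weight_def)

lemma hausdorff_pre_countably_subadditive:
  fixes A :: "nat \<Rightarrow> 'a::metric_space set"
  shows "hausdorff_pre m \<delta> (\<Union>i. A i) \<le> (\<Sum>i. hausdorff_pre m \<delta> (A i))"
proof (cases "(\<Sum>i. hausdorff_pre m \<delta> (A i)) < \<infinity>")
  case True
  then have fin: "hausdorff_pre m \<delta> (A i) < \<infinity>" for i
    by (metis ennreal_suminf_lessD infinity_ennreal_def)
  show ?thesis
  proof (rule ennreal_le_epsilon)
    fix e :: real assume e: "0 < e"
    have "\<exists>U. A i \<subseteq> (\<Union>j. U j) \<and> (\<forall>j. bounded (U j) \<and> diameter (U j) \<le> \<delta>)
        \<and> (\<Sum>j. hausdorff_weight m (U j)) < hausdorff_pre m \<delta> (A i) + ennreal (e * (1/2)^Suc i)" for i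
    proof -
      have "hausdorff_pre m \<delta> (A i) < hausdorff_pre m \<delta> (A i) + ennreal (e * (1/2)^Suc i)"
        using fin[of i] e ennreal_add_left_cancel_less[of "hausdorff_pre m \<delta> (A i)" 0 "ennreal (e * (1/2)^Suc i)"]
        by (simp add: ennreal_zero_less_mult_iff)
      from hausdorff_pre_approx[OF this] show ?thesis by metis
    qed
    then obtain U where U: "\<And>i. A i \<subseteq> (\<Union>j. U i j)" "\<And>i j. bounded (U i j)" "\<And>i j. diameter (U i j) \<le> \<delta>"
      "\<And>i. (\<Sum>j. hausdorff_weight m (U i j)) < hausdorff_pre m \<delta> (A i) + ennreal (e * (1/2)^Suc i)"
      by metis
    have "hausdorff_pre m \<delta> (\<Union>i. A i) \<le> (\<Sum>n. hausdorff_weight m (case prod_decode n of (i, j) \<Rightarrow> U i j))"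
    proof (rule hausdorff_pre_le)
      show "(\<Union>i. A i) \<subseteq> (\<Union>n. case prod_decode n of (i, j) \<Rightarrow> U i j)"
      proof
        fix x assume "x \<in> (\<Union>i. A i)"
        then obtain i j where "x \<in> U i j" using U(1) by blast
        then show "x \<in> (\<Union>n. case prod_decode n of (i, j) \<Rightarrow> U i j)"
          by (intro UN_I[of "prod_encode (i, j)"]) auto
      qed
    qed (auto simp: U split: prod.split)
    also have "\<dots> = (\<Sum>i. \<Sum>j. hausdorff_weight m (U i j))"
      using suminf_ennreal_2dimen[of "\<lambda>i. \<Sum>j. hausdorff_weight m (U i j)" "\<lambda>(i, j). hausdorff_weight m (U i j)"]
      by (simp add: case_prod_unfold)
    also have "\<dots> \<le> (\<Sum>i. hausdorff_pre m \<delta> (A i) + ennreal (e * (1/2)^Suc i))"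
      using U(4) by (intro suminf_le) (auto intro: less_imp_le)
    also have "\<dots> = (\<Sum>i. hausdorff_pre m \<delta> (A i)) + (\<Sum>i. ennreal (e * (1/2)^Suc i))"
      by (rule suminf_add[symmetric]) auto
    also have "(\<Sum>i. ennreal (e * (1/2)^Suc i)) = ennreal e"
      using sums_mult[OF power_half_series, of e] e by (intro suminf_ennreal_eq) auto
    finally show "hausdorff_pre m \<delta> (\<Union>i. A i) \<le> (\<Sum>i. hausdorff_pre m \<delta> (A i)) + ennreal e" .
  qed
qed (simp add: less_top[symmetric])

lemma hausdorff_pre_separated:
  assumes d: "\<delta> < d" and sep: "\<And>x y. x \<in> A \<Longrightarrow> y \<in> B \<Longrightarrow> d \<le> dist x y" and "0 < \<delta>"
  shows "hausdorff_pre m \<delta> A + hausdorff_pre m \<delta> B \<le> hausdorff_pre m \<delta> (A \<union> B)"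
proof (rule hausdorff_pre_greatest)
  fix U :: "nat \<Rightarrow> 'a set"
  assume U: "A \<union> B \<subseteq> (\<Union>i. U i)" "\<And>i. bounded (U i)" "\<And>i. diameter (U i) \<le> \<delta>"
  define V where "V X i = (if U i \<inter> X = {} then {} else U i)" for X :: "'a set" and i
  have V: "hausdorff_pre m \<delta> X \<le> (\<Sum>i. hausdorff_weight m (V X i))" if "X \<subseteq> A \<union> B" for X
  proof (rule hausdorff_pre_le)
    show "X \<subseteq> (\<Union>i. V X i)" using that U(1) by (force simp: V_def)
  qed (use U \<open>0 < \<delta>\<close> in \<open>auto simp: V_def\<close>)
  have "hausdorff_pre m \<delta> A + hausdorff_pre m \<delta> B
      \<le> (\<Sum>i. hausdorff_weight m (V A i)) + (\<Sum>i. hausdorff_weight m (V B i))"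
    by (intro add_mono V) auto
  also have "\<dots> = (\<Sum>i. hausdorff_weight m (V A i) + hausdorff_weight m (V B i))"
    by (rule suminf_add) auto
  also have "\<dots> \<le> (\<Sum>i. hausdorff_weight m (U i))"
  proof (rule suminf_le)
    fix i
    have "U i \<inter> A = {} \<or> U i \<inter> B = {}"
    proof (rule ccontr)
      assume "\<not> ?thesis"
      then obtain x y where "x \<in> U i" "x \<in> A" "y \<in> U i" "y \<in> B" by auto
      then have "d \<le> \<delta>" using diameter_bounded_bound[of "U i" x y] U(2,3)[of i] sep[of x y] by auto
      then show False using d by simp
    qed
    then show "hausdorff_weight m (V A i) + hausdorff_weight m (V B i) \<le> hausdorff_weight m (U i)"
      by (auto simp: V_def hausdorff_weight_def)
  qed auto
  finally show "hausdorff_pre m \<delta> A + hausdorff_pre m \<delta> B \<le> (\<Sum>i. hausdorff_weight m (U i))" .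
qed

lemma outer_measure_space_hausdorff_outer: "outer_measure_space UNIV (hausdorff_outer m :: 'a::metric_space set \<Rightarrow> ennreal)"
  unfolding outer_measure_space_def
proof (intro conjI)
  show "positive UNIV (hausdorff_outer m)"
    by (simp add: positive_def hausdorff_outer_def hausdorff_pre_empty)
  show "increasing UNIV (hausdorff_outer m)"
    by (auto simp: increasing_def hausdorff_outer_def intro!: SUP_mono' hausdorff_pre_mono)
  show "countably_subadditive UNIV (hausdorff_outer m :: 'a set \<Rightarrow> ennreal)"
    unfolding countably_subadditive_def
  proof (intro allI impI)
    fix A :: "nat \<Rightarrow> 'a set"
    show "hausdorff_outer m (\<Union>i. A i) \<le> (\<Sum>i. hausdorff_outer m (A i))"
      unfolding hausdorff_outer_def[of m "\<Union>i. A i"]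
    proof (rule SUP_least)
      fix \<delta> :: real assume "\<delta> \<in> {0<..}"
      have "hausdorff_pre m \<delta> (\<Union>i. A i) \<le> (\<Sum>i. hausdorff_pre m \<delta> (A i))"
        by (rule hausdorff_pre_countably_subadditive)
      also have "\<dots> \<le> (\<Sum>i. hausdorff_outer m (A i))"
        unfolding hausdorff_outer_def by (intro suminf_le SUP_upper \<open>\<delta> \<in> _\<close>) auto
      finally show "hausdorff_pre m \<delta> (\<Union>i. A i) \<le> (\<Sum>i. hausdorff_outer m (A i))" .
    qed
  qed
qed

lemma hausdorff_outer_separated:
  assumes d: "0 < d" and sep: "\<And>x y. x \<in> A \<Longrightarrow> y \<in> B \<Longrightarrow> d \<le> dist x y"
  shows "hausdorff_outer m A + hausdorff_outer m B \<le> hausdorff_outer m (A \<union> B)"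
proof -
  have "hausdorff_outer m A + hausdorff_outer m B
      = (SUP \<delta>\<in>{0<..}. hausdorff_pre m \<delta> A + hausdorff_pre m \<delta> B)"
    unfolding hausdorff_outer_def
  proof (rule SUP_add_directed_ennreal[symmetric])
    fix i j :: real assume "i \<in> {0<..}" "j \<in> {0<..}"
    then show "\<exists>k\<in>{0<..}. hausdorff_pre m i A + hausdorff_pre m j B \<le> hausdorff_pre m k A + hausdorff_pre m k B"
      by (intro bexI[of _ "min i j"] add_mono hausdorff_pre_antimono) auto
  qed
  also have "\<dots> \<le> hausdorff_outer m (A \<union> B)"
  proof (rule SUP_least)
    fix \<delta> :: real assume \<delta>: "\<delta> \<in> {0<..}"
    let ?\<epsilon> = "min \<delta> (d / 2)"
    have "hausdorff_pre m \<delta> A + hausdorff_pre m \<delta> B \<le> hausdorff_pre m ?\<epsilon> A + hausdorff_pre m ?\<epsilon> B"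
      by (intro add_mono hausdorff_pre_antimono) auto
    also have "\<dots> \<le> hausdorff_pre m ?\<epsilon> (A \<union> B)"
      by (rule hausdorff_pre_separated[OF _ sep]) (use d \<delta> in auto)
    also have "\<dots> \<le> hausdorff_outer m (A \<union> B)"
      unfolding hausdorff_outer_def by (rule SUP_upper) (use d \<delta> in auto)
    finally show "hausdorff_pre m \<delta> A + hausdorff_pre m \<delta> B \<le> hausdorff_outer m (A \<union> B)" .
  qed
  finally show ?thesis .
qed

lemma hausdorff_measure_eq: "hausdorff_measure m = measure_of UNIV (sets borel) (hausdorff_outer m)"
  by (simp add: hausdorff_measure_def hausdorff_outer_def[abs_def])

lemma sets_hausdorff_measure [simp, measurable_cong]: "sets (hausdorff_measure m) = sets borel"
  unfolding hausdorff_measure_def by (metis sets.sets_measure_of_eq space_borel)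

lemma space_hausdorff_measure [simp]: "space (hausdorff_measure m) = UNIV"
  unfolding hausdorff_measure_def by (simp add: space_measure_of_conv)

lemma measure_space_hausdorff_outer:
  "measure_space UNIV (sets (borel :: 'a::metric_space measure)) (hausdorff_outer m)"
proof -
  interpret P: sigma_algebra UNIV "UNIV :: 'a set set" using sigma_algebra_Pow[of UNIV] by simp
  have L: "measure_space UNIV (lambda_system UNIV UNIV (hausdorff_outer m)) (hausdorff_outer m :: 'a set \<Rightarrow> ennreal)"
    by (rule P.caratheodory_lemma[OF outer_measure_space_hausdorff_outer])
  then interpret L: sigma_algebra UNIV "lambda_system UNIV UNIV (hausdorff_outer m) :: 'a set set"
    by (simp add: measure_space_def)
  have "sets (borel :: 'a measure) = sigma_sets UNIV (Collect closed)"
    unfolding borel_eq_closed by simp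
  also have "\<dots> \<subseteq> lambda_system UNIV UNIV (hausdorff_outer m)"
    by (intro L.sigma_sets_subset)
      (auto intro!: metric_outer_measure_lambda_system outer_measure_space_hausdorff_outer hausdorff_outer_separated)
  finally have "sets (borel :: 'a measure) \<subseteq> lambda_system UNIV UNIV (hausdorff_outer m)" .
  from measure_down[OF L _ this] show ?thesis
    using sets.sigma_algebra_axioms[of "borel :: 'a measure"] by simp
qed

lemma emeasure_hausdorff_measure:
  assumes "S \<in> sets borel"
  shows "emeasure (hausdorff_measure m) S = hausdorff_outer m S"
  using measure_space_hausdorff_outer[where 'a='a, of m] assms unfolding hausdorff_measure_eq
  by (intro emeasure_measure_of_sigma) (auto simp: measure_space_def)

lemma emeasure_hausdorff_measure_le: "emeasure (hausdorff_measure m) S \<le> hausdorff_outer m S"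
  by (cases "S \<in> sets (borel :: 'a::metric_space measure)")
    (simp_all add: emeasure_hausdorff_measure emeasure_notin_sets)

lemma null_sets_axis_lines:
  fixes N :: "(real^'n::finite) set"
  assumes N: "hausdorff_outer (CARD('n) - 1) N = 0"
  shows "{x. \<exists>t. x + t *\<^sub>R axis i 1 \<in> N} \<in> null_sets lebesgue"
proof -
  let ?m = "CARD('n) - 1"
  let ?L = "{x. \<exists>t. x + t *\<^sub>R axis i 1 \<in> N}"
  have slab: "?L \<inter> {x. \<bar>x $ i\<bar> \<le> R} \<in> null_sets lebesgue" if R: "0 < R" for R :: real
  proof -
    define c where "c = 2 * R * 4 ^ ?m / unit_ball_vol (real ?m)"
    have c: "0 < c" using R by (simp add: c_def)
    have "\<exists>T. ?L \<inter> {x. \<bar>x $ i\<bar> \<le> R} \<subseteq> T \<and> T \<in> lmeasurable \<and> measure lebesgue T \<le> e" if e: "0 < e" for e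
    proof -
      have "hausdorff_pre ?m 1 N \<le> hausdorff_outer ?m N"
        unfolding hausdorff_outer_def by (rule SUP_upper) simp
      also have "\<dots> < ennreal (e / c)" using N e c by simp
      finally obtain U where U: "N \<subseteq> (\<Union>i. U i)" "\<And>i. bounded (U i)"
        "(\<Sum>i. hausdorff_weight ?m (U i)) < ennreal (e / c)" by (rule hausdorff_pre_approx) blast
      define x where "x j = (SOME z. z \<in> U j)" for j
      define d where "d j = diameter (U j)" for j
      define V where "V j = (if U j = {} then {} else
        cbox (\<chi> l. if l = i then - R else x j $ l - d j) (\<chi> l. if l = i then R else x j $ l + d j))" for j
      have d0: "0 \<le> d j" for j using U(2) by (simp add: d_def diameter_ge_0)
      have "?L \<inter> {x. \<bar>x $ i\<bar> \<le> R} \<subseteq> (\<Union>j. V j)"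
      proof
        fix z assume z: "z \<in> ?L \<inter> {x. \<bar>x $ i\<bar> \<le> R}"
        then obtain t j where t: "z + t *\<^sub>R axis i 1 \<in> U j" using U(1) by auto
        then have "x j \<in> U j" unfolding x_def by (rule someI)
        have "\<bar>(z + t *\<^sub>R axis i 1 - x j) $ l\<bar> \<le> d j" for l
        proof -
          have "\<bar>(z + t *\<^sub>R axis i 1 - x j) $ l\<bar> \<le> dist (z + t *\<^sub>R axis i 1) (x j)"
            unfolding dist_norm by (rule component_le_norm_cart)
          also have "\<dots> \<le> d j" unfolding d_def by (rule diameter_bounded_bound) (use U t \<open>x j \<in> U j\<close> in auto)
          finally show ?thesis .
        qed
        then have "\<bar>z $ l - x j $ l\<bar> \<le> d j" if "l \<noteq> i" for l
          using that \<open>\<And>l. \<bar>(z + t *\<^sub>R axis i 1 - x j) $ l\<bar> \<le> d j\<close>[of l] by (simp add: axis_def)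
        then have "z \<in> V j"
          using z t by (auto simp: V_def mem_box_cart abs_le_iff algebra_simps)
        then show "z \<in> (\<Union>j. V j)" by blast
      qed
      moreover have *: "emeasure lborel (\<Union>j. V j) \<le> ennreal e"
      proof -
      have "emeasure lborel (\<Union>j. V j) \<le> (\<Sum>j. emeasure lborel (V j))"
        by (rule emeasure_subadditive_countably) (auto simp: V_def)
      also have "\<dots> \<le> (\<Sum>j. ennreal c * hausdorff_weight ?m (U j))"
      proof (rule suminf_le)
        fix j
        show "emeasure lborel (V j) \<le> ennreal c * hausdorff_weight ?m (U j)"
        proof (cases "U j = {}")
          case False
          have "emeasure lborel (V j) = ennreal (\<Prod>l\<in>UNIV. (if l = i then 2 * R else 2 * d j))"
          proof -
            have "emeasure lborel (V j) = ennreal (measure lborel (V j))"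
              using False by (simp add: V_def emeasure_lborel_cbox_eq measure_lborel_cbox_eq)
            also have "measure lborel (V j) = (\<Prod>l\<in>UNIV. (if l = i then 2 * R else 2 * d j))"
            proof -
              have "measure lborel (V j) = (\<Prod>l\<in>UNIV. (\<chi> l. if l = i then R else x j $ l + d j) $ l
                  - (\<chi> l. if l = i then - R else x j $ l - d j) $ l)"
                using False R d0[of j] by (simp add: V_def content_cbox_cart interval_ne_empty_cart)
              also have "\<dots> = (\<Prod>l\<in>UNIV. (if l = i then 2 * R else 2 * d j))"
                by (rule prod.cong) auto
              finally show ?thesis .
            qed
            finally show ?thesis .
          qed
          also have "(\<Prod>l\<in>UNIV. (if l = i then 2 * R else 2 * d j)) = 2 * R * (2 * d j) ^ ?m"
            by (subst prod.remove[of _ i]) (auto simp: prod.If_cases card_Diff_singleton)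
          also have "2 * R * (2 * d j) ^ ?m = c * (unit_ball_vol (real ?m) * (d j / 2) ^ ?m)"
          proof -
            have "unit_ball_vol (real ?m) \<noteq> 0" by (rule less_imp_neq[THEN not_sym]) (rule unit_ball_vol_pos, simp)
            moreover have "(2 * d j) ^ ?m = 4 ^ ?m * (d j / 2) ^ ?m"
              unfolding power_mult_distrib[symmetric] by simp
            ultimately show ?thesis by (simp add: c_def)
          qed
          also have "ennreal \<dots> = ennreal c * hausdorff_weight ?m (U j)"
            using False c d0[of j] by (simp add: hausdorff_weight_def ennreal_mult d_def)
          finally show ?thesis by simp
        qed (simp add: V_def hausdorff_weight_def)
      qed auto
      also have "\<dots> = ennreal c * (\<Sum>j. hausdorff_weight ?m (U j))" by simp
      also have "\<dots> \<le> ennreal c * ennreal (e / c)" using U(3) by (intro mult_left_mono) auto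
      also have "\<dots> = ennreal e" using c e by (simp flip: ennreal_mult)
      finally show ?thesis .
      qed
      moreover have sV: "(\<Union>j. V j) \<in> sets borel" by (auto simp: V_def)
      have "(\<Union>j. V j) \<in> lmeasurable"
        using * sV by (auto intro!: fmeasurableI simp: le_less_trans[OF *])
      moreover have "measure lebesgue (\<Union>j. V j) \<le> e"
        using * sV e by (simp add: measure_def enn2real_leI)
      ultimately show ?thesis by blast
    qed
    then show ?thesis unfolding negligible_iff_null_sets[symmetric] negligible_outer_le by blast
  qed
  have "?L = (\<Union>k. ?L \<inter> {x. \<bar>x $ i\<bar> \<le> real (Suc k)})"
  proof -
    have "\<exists>k. \<bar>x $ i\<bar> \<le> real (Suc k)" for x :: "real^'n"
    proof -
      obtain k :: nat where "\<bar>x $ i\<bar> \<le> real k" using real_arch_simple by blast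
      then have "\<bar>x $ i\<bar> \<le> real (Suc k)" by simp
      then show ?thesis ..
    qed
    then show ?thesis by auto
  qed
  also have "\<dots> \<in> null_sets lebesgue" by (intro null_sets_UN slab) simp
  finally show ?thesis .
qed

lemma hausdorff_outer_lipschitz_hyperplane_finite:
  fixes R :: "(real^'n::finite) set" and F :: "real^'n \<Rightarrow> 'b::metric_space"
  assumes n: "n \<noteq> 0" and plane: "R \<subseteq> {x. n \<bullet> x = c}" and bdd: "bounded R"
    and lip: "L-lipschitz_on R F"
  shows "hausdorff_outer (CARD('n) - 1) (F ` R) < \<infinity>"
proof -
  let ?m = "CARD('n) - 1"
  obtain i where i: "n $ i \<noteq> 0" using n by (metis vec_eq_iff zero_index)
  obtain b where b: "0 < b" "\<And>x. x \<in> R \<Longrightarrow> norm x \<le> b" using bdd by (metis bounded_pos)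
  have L0: "0 \<le> L" using lip by (rule lipschitz_on_nonneg)
  define q where "q = 1 + (\<Sum>l\<in>UNIV. \<bar>n $ l\<bar>) / \<bar>n $ i\<bar>"
  have q1: "1 \<le> q" by (simp add: q_def sum_nonneg)
  define C where "C = L * (real CARD('n) * q)"
  have C0: "0 \<le> C" using L0 q1 by (simp add: C_def)
  have dist_le: "dist (F x) (F y) \<le> C * s"
    if "x \<in> R" "y \<in> R" and close: "\<And>l. l \<noteq> i \<Longrightarrow> \<bar>x $ l - y $ l\<bar> \<le> s" and s: "0 \<le> s" for x y s
  proof -
    have "\<bar>x $ l - y $ l\<bar> \<le> q * s" for l
    proof (cases "l = i")
      case True
      have "n \<bullet> (x - y) = 0" using that(1,2) plane by (auto simp: inner_diff_right)
      then have "(\<Sum>l\<in>UNIV. n $ l * (x $ l - y $ l)) = 0" by (simp add: inner_vec_def)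
      then have "n $ i * (x $ i - y $ i) = - (\<Sum>l\<in>UNIV - {i}. n $ l * (x $ l - y $ l))"
        by (simp add: sum.remove[of UNIV i])
      then have "\<bar>n $ i\<bar> * \<bar>x $ i - y $ i\<bar> = \<bar>\<Sum>l\<in>UNIV - {i}. n $ l * (x $ l - y $ l)\<bar>"
        by (simp flip: abs_mult)
      also have "\<dots> \<le> (\<Sum>l\<in>UNIV - {i}. \<bar>n $ l\<bar> * \<bar>x $ l - y $ l\<bar>)"
        by (rule order_trans[OF sum_abs]) (simp add: abs_mult)
      also have "\<dots> \<le> (\<Sum>l\<in>UNIV - {i}. \<bar>n $ l\<bar> * s)"
        by (intro sum_mono mult_left_mono close) auto
      also have "\<dots> \<le> (\<Sum>l\<in>UNIV. \<bar>n $ l\<bar> * s)" using s by (intro sum_mono2) auto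
      also have "\<dots> = (\<Sum>l\<in>UNIV. \<bar>n $ l\<bar>) * s" by (simp add: sum_distrib_right)
      finally have "\<bar>x $ i - y $ i\<bar> \<le> (\<Sum>l\<in>UNIV. \<bar>n $ l\<bar>) / \<bar>n $ i\<bar> * s"
        using i by (simp add: field_simps)
      also have "\<dots> \<le> q * s" using s by (intro mult_right_mono) (auto simp: q_def)
      finally show ?thesis using True by simp
    next
      case False
      have "s \<le> q * s" using q1 s mult_right_mono[of 1 q s] by simp
      then show ?thesis using close[OF False] by simp
    qed
    then have "norm (x - y) \<le> (\<Sum>l\<in>(UNIV::'n set). q * s)"
      by (intro order_trans[OF norm_le_l1_cart] sum_mono) simp
    then have "dist x y \<le> real CARD('n) * q * s" by (simp add: dist_norm)
    then have "L * dist x y \<le> C * s" unfolding C_def using L0 by (simp add: mult_left_mono mult.assoc)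
    then show ?thesis using lipschitz_onD[OF lip that(1,2)] by simp
  qed
  define M where "M = unit_ball_vol (real ?m) * (C * (2 * b)) ^ ?m"
  have pre: "hausdorff_pre ?m \<delta> (F ` R) \<le> ennreal M" if \<delta>: "0 < \<delta>" for \<delta>
  proof -
    obtain k :: nat where k: "k > 0" "C * (2 * b / real k) \<le> \<delta>"
    proof -
      obtain k0 :: nat where "C * (2 * b) / \<delta> \<le> real k0" using real_arch_simple by blast
      then have "C * (2 * b) \<le> \<delta> * real (Suc k0)" using \<delta> by (simp add: field_simps add_increasing)
      then have "C * (2 * b / real (Suc k0)) \<le> \<delta>" by (simp add: field_simps)
      then show ?thesis using that[of "Suc k0"] by simp
    qed
    define s where "s = 2 * b / real k"
    have s: "0 < s" using b k by (simp add: s_def)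
    define G where "G = PiE (UNIV - {i}) (\<lambda>_. {..k})"
    define cell where "cell x = restrict (\<lambda>l. nat \<lfloor>(x $ l + b) / s\<rfloor>) (UNIV - {i})" for x :: "real^'n"
    have fG: "finite G" by (simp add: G_def finite_PiE)
    have cG: "card G = (k + 1) ^ ?m" by (simp add: G_def card_PiE card_Diff_singleton)
    have cell: "cell x \<in> G" if "x \<in> R" for x
    proof -
      have "nat \<lfloor>(x $ l + b) / s\<rfloor> \<le> k" for l
      proof -
        have "x $ l \<le> b" using component_le_norm_cart[of x l] b(2)[OF that] by linarith
        then have "(x $ l + b) / s \<le> real k" using s b k by (simp add: s_def field_simps)
        then show ?thesis by (metis floor_mono floor_of_nat nat_int nat_mono of_int_of_nat_eq)
      qed
      then show ?thesis by (simp add: G_def cell_def)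
    qed
    have same: "\<bar>x $ l - y $ l\<bar> \<le> s" if "x \<in> R" "y \<in> R" "cell x = cell y" "l \<noteq> i" for x y l
    proof -
      have ge: "0 \<le> (z $ l + b) / s" if "z \<in> R" for z
        using component_le_norm_cart[of z l] b(2)[OF that] s by (intro divide_nonneg_nonneg) linarith+
      have "nat \<lfloor>(x $ l + b) / s\<rfloor> = nat \<lfloor>(y $ l + b) / s\<rfloor>"
        using fun_cong[OF that(3), of l] that(4) by (simp add: cell_def)
      then have "\<lfloor>(x $ l + b) / s\<rfloor> = \<lfloor>(y $ l + b) / s\<rfloor>"
        using ge[OF that(1)] ge[OF that(2)] by (metis eq_nat_nat_iff zero_le_floor)
      then have "\<bar>(x $ l + b) / s - (y $ l + b) / s\<bar> \<le> 1" by linarith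
      then have "\<bar>(x $ l - y $ l) / s\<bar> \<le> 1" by (simp add: diff_divide_distrib[symmetric])
      then show ?thesis using s by (simp add: field_simps)
    qed
    obtain g where g: "bij_betw g {0..<card G} G" using ex_bij_betw_nat_finite[OF fG] by blast
    define U where "U j = (if j < card G then F ` {x \<in> R. cell x = g j} else {})" for j
    have dU: "dist y z \<le> C * s" if yz: "y \<in> U j" "z \<in> U j" for y z j
      using yz by (auto simp: U_def split: if_splits intro!: dist_le same less_imp_le[OF s])
    have bU: "bounded (U j)" for j
      unfolding bounded_two_points using dU by blast
    have diamU: "diameter (U j) \<le> C * s" for j
      using dU[of _ j] C0 s by (auto simp: diameter_def intro!: cSUP_least)
    have "F ` R \<subseteq> (\<Union>j. U j)"
    proof
      fix y assume "y \<in> F ` R"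
      then obtain x where x: "x \<in> R" "y = F x" by auto
      obtain j where "j < card G" "g j = cell x"
        using bij_betw_imp_surj_on[OF g] cell[OF x(1)] by (metis atLeastLessThan_iff imageE)
      then show "y \<in> (\<Union>j. U j)" using x by (auto simp: U_def intro!: exI[of _ j])
    qed
    then have "hausdorff_pre ?m \<delta> (F ` R) \<le> (\<Sum>j. hausdorff_weight ?m (U j))"
      using bU order_trans[OF diamU k(2)[folded s_def]] by (intro hausdorff_pre_le) auto
    also have "\<dots> = (\<Sum>j<card G. hausdorff_weight ?m (U j))"
      by (rule suminf_finite) (auto simp: U_def hausdorff_weight_def)
    also have "\<dots> \<le> (\<Sum>j<card G. ennreal (unit_ball_vol (real ?m) * (C * s / 2) ^ ?m))"
      using diamU bU by (intro sum_mono)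
        (auto simp: hausdorff_weight_def intro!: ennreal_leI mult_left_mono power_mono divide_right_mono diameter_ge_0)
    also have "\<dots> = ennreal (real (card G) * (unit_ball_vol (real ?m) * (C * s / 2) ^ ?m))"
      using C0 s by (simp add: ennreal_mult ennreal_of_nat_eq_real_of_nat)
    also have "\<dots> \<le> ennreal M"
    proof (rule ennreal_leI)
      have "real (card G) * (unit_ball_vol (real ?m) * (C * s / 2) ^ ?m)
          = unit_ball_vol (real ?m) * ((real k + 1) * (C * s / 2)) ^ ?m"
        unfolding cG power_mult_distrib of_nat_power by (simp add: add.commute)
      also have "\<dots> \<le> unit_ball_vol (real ?m) * (C * (2 * b)) ^ ?m"
      proof (intro mult_left_mono power_mono)
        have "(real k + 1) * (C * s / 2) \<le> (2 * real k) * (C * s / 2)"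
          using k C0 s by (intro mult_right_mono) auto
        also have "\<dots> = C * (2 * b)" using k by (simp add: s_def)
        finally show "(real k + 1) * (C * s / 2) \<le> C * (2 * b)" .
      qed (use C0 s in auto)
      finally show "real (card G) * (unit_ball_vol (real ?m) * (C * s / 2) ^ ?m) \<le> M" by (simp add: M_def)
    qed
    finally show ?thesis .
  qed
  have "hausdorff_outer ?m (F ` R) \<le> ennreal M"
    unfolding hausdorff_outer_def by (intro SUP_least pre) simp
  also have "\<dots> < \<infinity>" by simp
  finally show ?thesis .
qed


section \<open>Differentiable functions with continuous extensions to the closure\<close>

definition C0_ext :: "'a::topological_space set \<Rightarrow> 'a set \<Rightarrow> ('a \<Rightarrow> 'b::topological_space) \<Rightarrow> bool" where
  "C0_ext K X f \<longleftrightarrow> (\<exists>w. continuous_on X w \<and> (\<forall>x\<in>K. w x = f x))"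

definition C1_ext :: "(real^'n) set \<Rightarrow> (real^'n) set \<Rightarrow> (real^'n \<Rightarrow> real) \<Rightarrow> bool" where
  "C1_ext K X f \<longleftrightarrow> C0_ext K X f \<and> (\<forall>x\<in>K. f differentiable (at x)) \<and> (\<forall>i. C0_ext K X (\<lambda>x. grad f x $ i))"

definition C2_ext :: "(real^'n) set \<Rightarrow> (real^'n) set \<Rightarrow> (real^'n \<Rightarrow> real) \<Rightarrow> bool" where
  "C2_ext K X f \<longleftrightarrow> C1_ext K X f \<and> (\<forall>i. C1_ext K X (\<lambda>x. grad f x $ i))"

lemma grad_nth: "(f has_derivative f') (at x) \<Longrightarrow> grad f x $ i = f' (axis i 1)"
  by (simp add: grad_def frechet_derivative_at[symmetric])

lemma has_derivative_grad:
  assumes "f differentiable (at x)"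
  shows "(f has_derivative (\<lambda>h. grad f x \<bullet> h)) (at x)"
proof -
  have d: "(f has_derivative frechet_derivative f (at x)) (at x)"
    using assms by (simp add: frechet_derivative_works)
  have lin: "linear (frechet_derivative f (at x))" using d by (rule has_derivative_linear)
  have "frechet_derivative f (at x) h = grad f x \<bullet> h" for h
  proof -
    have "frechet_derivative f (at x) h = frechet_derivative f (at x) (\<Sum>i\<in>UNIV. h $ i *\<^sub>R axis i 1)"
      by (rule arg_cong[OF basis_expansion[of h, symmetric, unfolded scalar_mult_eq_scaleR]])
    also have "\<dots> = (\<Sum>i\<in>UNIV. h $ i *\<^sub>R frechet_derivative f (at x) (axis i 1))"
      by (simp add: linear_sum[OF lin] linear_cmul[OF lin])
    finally have "frechet_derivative f (at x) h = (\<Sum>i\<in>UNIV. h $ i *\<^sub>R frechet_derivative f (at x) (axis i 1))" .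
    then show ?thesis by (simp add: grad_def inner_vec_def mult.commute)
  qed
  then have "frechet_derivative f (at x) = (\<lambda>h. grad f x \<bullet> h)" by (rule ext)
  then show ?thesis using d by simp
qed

lemma grad_transform:
  assumes "eventually (\<lambda>y. f y = g y) (nhds x)"
  shows "grad f x = grad g x"
proof -
  obtain S where S: "open S" "x \<in> S" "\<And>y. y \<in> S \<Longrightarrow> f y = g y" using assms by (auto simp: eventually_nhds)
  have "(f has_derivative D) (at x) \<longleftrightarrow> (g has_derivative D) (at x)" for D
    using has_derivative_transform_within_open[OF _ S(1,2), of f D UNIV g]
      has_derivative_transform_within_open[OF _ S(1,2), of g D UNIV f] S(3) by auto
  then show ?thesis by (simp add: grad_def frechet_derivative_def)
qed

lemma grad_cong_open: "open K \<Longrightarrow> x \<in> K \<Longrightarrow> (\<And>y. y \<in> K \<Longrightarrow> f y = g y) \<Longrightarrow> grad f x = grad g x"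
  by (rule grad_transform) (auto simp: eventually_nhds)

lemma grad_lincomb:
  assumes "f differentiable (at x)" "g differentiable (at x)"
  shows "grad (\<lambda>y. a * f y + b * g y) x = a *\<^sub>R grad f x + b *\<^sub>R grad g x"
proof -
  have "((\<lambda>y. a * f y + b * g y) has_derivative (\<lambda>h. a * (grad f x \<bullet> h) + b * (grad g x \<bullet> h))) (at x)"
    by (intro derivative_intros has_derivative_grad assms)
  then show ?thesis by (simp add: vec_eq_iff grad_nth inner_axis)
qed

lemma grad_mult:
  assumes "f differentiable (at x)" "g differentiable (at x)"
  shows "grad (\<lambda>y. f y * g y) x = f x *\<^sub>R grad g x + g x *\<^sub>R grad f x"
proof -
  have "((\<lambda>y. f y * g y) has_derivative (\<lambda>h. f x * (grad g x \<bullet> h) + (grad f x \<bullet> h) * g x)) (at x)"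
    by (intro derivative_intros has_derivative_grad assms)
  then show ?thesis by (simp add: vec_eq_iff grad_nth inner_axis mult.commute)
qed

lemma grad_const: "grad (\<lambda>y. c) x = 0"
  by (simp add: vec_eq_iff grad_nth[OF has_derivative_const])

lemma C0_ext_cong: "(\<And>x. x \<in> K \<Longrightarrow> f x = g x) \<Longrightarrow> C0_ext K X f \<longleftrightarrow> C0_ext K X g"
  by (simp add: C0_ext_def cong: ball_cong)

lemma C0_ext_const: "C0_ext K X (\<lambda>x. c)"
  unfolding C0_ext_def by (intro exI[of _ "\<lambda>x. c"]) auto

lemma C0_ext_compose:
  assumes "continuous_on X w" "\<And>x. x \<in> X \<Longrightarrow> w x \<in> U" "\<And>x. x \<in> K \<Longrightarrow> w x = f x" "continuous_on U h"
  shows "C0_ext K X (\<lambda>x. h (f x))"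
  unfolding C0_ext_def
  by (intro exI[of _ "\<lambda>x. h (w x)"]) (use assms in \<open>auto intro!: continuous_on_compose2[of U h X w]\<close>)

lemma C0_ext_add:
  fixes f g :: "'a::topological_space \<Rightarrow> 'b::topological_monoid_add"
  assumes "C0_ext K X f" "C0_ext K X g"
  shows "C0_ext K X (\<lambda>x. f x + g x)"
proof -
  obtain w v where "continuous_on X w" "\<forall>x\<in>K. w x = f x" "continuous_on X v" "\<forall>x\<in>K. v x = g x"
    using assms by (auto simp: C0_ext_def)
  then show ?thesis unfolding C0_ext_def
    by (intro exI[of _ "\<lambda>x. w x + v x"]) (auto intro: continuous_on_add)
qed

lemma C0_ext_mult:
  fixes f g :: "'a::topological_space \<Rightarrow> real"
  assumes "C0_ext K X f" "C0_ext K X g"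
  shows "C0_ext K X (\<lambda>x. f x * g x)"
proof -
  obtain w v where "continuous_on X w" "\<forall>x\<in>K. w x = f x" "continuous_on X v" "\<forall>x\<in>K. v x = g x"
    using assms by (auto simp: C0_ext_def)
  then show ?thesis unfolding C0_ext_def
    by (intro exI[of _ "\<lambda>x. w x * v x"]) (auto intro: continuous_on_mult)
qed

lemma C0_ext_sum:
  fixes f :: "'i \<Rightarrow> 'a::topological_space \<Rightarrow> real"
  assumes "\<And>i. i \<in> I \<Longrightarrow> C0_ext K X (f i)"
  shows "C0_ext K X (\<lambda>x. \<Sum>i\<in>I. f i x)"
  using assms by (induction I rule: infinite_finite_induct) (simp_all add: C0_ext_const C0_ext_add)

lemma C0_ext_vec:
  fixes f :: "'a::topological_space \<Rightarrow> 'b::topological_space^'n"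
  assumes "\<And>i. C0_ext K X (\<lambda>x. f x $ i)"
  shows "C0_ext K X f"
proof -
  obtain w where "\<And>i. continuous_on X (w i)" "\<And>i x. x \<in> K \<Longrightarrow> w i x = f x $ i"
    using assms unfolding C0_ext_def by metis
  then show ?thesis unfolding C0_ext_def
    by (intro exI[of _ "\<lambda>x. \<chi> i. w i x"]) (auto intro: continuous_on_vec_lambda simp: vec_eq_iff)
qed

lemma C1_ext_cong:
  assumes "open K" and eq: "\<And>x. x \<in> K \<Longrightarrow> f x = g x"
  shows "C1_ext K X f \<longleftrightarrow> C1_ext K X g"
proof -
  have "f differentiable (at x) \<longleftrightarrow> g differentiable (at x)" if "x \<in> K" for x
    unfolding differentiable_def
    using has_derivative_transform_within_open[OF _ \<open>open K\<close> that, of f _ UNIV g]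
      has_derivative_transform_within_open[OF _ \<open>open K\<close> that, of g _ UNIV f] eq by metis
  moreover have "C0_ext K X (\<lambda>x. grad f x $ i) \<longleftrightarrow> C0_ext K X (\<lambda>x. grad g x $ i)" for i
    by (rule C0_ext_cong) (use grad_cong_open[OF \<open>open K\<close>, of _ f g] eq in auto)
  ultimately show ?thesis
    unfolding C1_ext_def using C0_ext_cong[of K f g X] eq by simp
qed

lemma C1_ext_const: "C1_ext K X (\<lambda>x. c)"
  by (simp add: C1_ext_def C0_ext_const grad_const)

lemma C1_ext_add:
  assumes "C1_ext K X f" "C1_ext K X g"
  shows "C1_ext K X (\<lambda>x. f x + g x)"
proof -
  have "grad (\<lambda>x. f x + g x) x = grad f x + grad g x" if "x \<in> K" for x
    using grad_lincomb[of f x g 1 1] assms that by (simp add: C1_ext_def)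
  then have "C0_ext K X (\<lambda>x. grad (\<lambda>x. f x + g x) x $ i) \<longleftrightarrow> C0_ext K X (\<lambda>x. grad f x $ i + grad g x $ i)" for i
    by (intro C0_ext_cong) simp
  moreover have "C0_ext K X (\<lambda>x. grad f x $ i + grad g x $ i)" for i
    using assms by (intro C0_ext_add) (simp_all add: C1_ext_def)
  ultimately show ?thesis using assms by (simp add: C1_ext_def C0_ext_add)
qed

lemma C1_ext_mult:
  assumes "C1_ext K X f" "C1_ext K X g"
  shows "C1_ext K X (\<lambda>x. f x * g x)"
proof -
  have "C0_ext K X (\<lambda>x. grad (\<lambda>x. f x * g x) x $ i) \<longleftrightarrow>
      C0_ext K X (\<lambda>x. f x * grad g x $ i + g x * grad f x $ i)" for i
    using assms by (intro C0_ext_cong) (simp add: grad_mult C1_ext_def)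
  moreover have "C0_ext K X (\<lambda>x. f x * grad g x $ i + g x * grad f x $ i)" for i
    using assms by (intro C0_ext_add C0_ext_mult) (simp_all add: C1_ext_def)
  ultimately show ?thesis using assms by (simp add: C1_ext_def C0_ext_mult)
qed

lemma C1_ext_sum:
  assumes "\<And>i. i \<in> I \<Longrightarrow> C1_ext K X (f i)"
  shows "C1_ext K X (\<lambda>x. \<Sum>i\<in>I. f i x)"
  using assms by (induction I rule: infinite_finite_induct) (simp_all add: C1_ext_const C1_ext_add)

lemma C1_ext_compose:
  assumes f: "C1_ext K X f" and K: "K \<subseteq> X"
    and w: "continuous_on X w" "\<And>x. x \<in> X \<Longrightarrow> w x \<in> U" "\<And>x. x \<in> K \<Longrightarrow> w x = f x"
    and h: "\<And>t. t \<in> U \<Longrightarrow> (h has_real_derivative h' t) (at t)" "continuous_on U h'"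
  shows "C1_ext K X (\<lambda>x. h (f x))"
proof -
  have fU: "f x \<in> U" if "x \<in> K" for x using w(2)[of x] w(3)[of x] K that by auto
  have d: "((\<lambda>x. h (f x)) has_derivative (\<lambda>v. h' (f x) * (grad f x \<bullet> v))) (at x)" if "x \<in> K" for x
  proof -
    have "(h has_derivative (\<lambda>v. h' (f x) * v)) (at (f x))"
      using h(1)[OF fU[OF that]] by (simp add: has_field_derivative_def)
    then show ?thesis
      using has_derivative_compose[OF has_derivative_grad, of f x h] f that by (simp add: C1_ext_def)
  qed
  have "C0_ext K X (\<lambda>x. grad (\<lambda>x. h (f x)) x $ i) \<longleftrightarrow> C0_ext K X (\<lambda>x. h' (f x) * grad f x $ i)" for i
    by (intro C0_ext_cong) (simp add: grad_nth[OF d] inner_axis)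
  moreover have "C0_ext K X (\<lambda>x. h (f x))"
    by (rule C0_ext_compose[OF w]) (use h(1) in \<open>auto intro: DERIV_continuous_on DERIV_subset\<close>)
  moreover have "C0_ext K X (\<lambda>x. h' (f x))" by (rule C0_ext_compose[OF w h(2)])
  moreover have "C0_ext K X (\<lambda>x. grad f x $ i)" for i using f by (simp add: C1_ext_def)
  moreover have "(\<lambda>x. h (f x)) differentiable (at x)" if "x \<in> K" for x
    using d[OF that] unfolding differentiable_def by blast
  ultimately show ?thesis by (simp add: C1_ext_def C0_ext_mult)
qed

lemma C2_ext_cong:
  assumes "open K" and eq: "\<And>x. x \<in> K \<Longrightarrow> f x = g x"
  shows "C2_ext K X f \<longleftrightarrow> C2_ext K X g"
proof -
  have "C1_ext K X (\<lambda>x. grad f x $ i) \<longleftrightarrow> C1_ext K X (\<lambda>x. grad g x $ i)" for i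
  proof (rule C1_ext_cong[OF \<open>open K\<close>])
    fix x assume "x \<in> K"
    then have "grad f x = grad g x" by (rule grad_cong_open[OF \<open>open K\<close> _ eq])
    then show "grad f x $ i = grad g x $ i" by simp
  qed
  moreover have "C1_ext K X f \<longleftrightarrow> C1_ext K X g" by (rule C1_ext_cong[OF \<open>open K\<close> eq])
  ultimately show ?thesis unfolding C2_ext_def by blast
qed

lemma C2_ext_const: "C2_ext K X (\<lambda>x. c)"
  unfolding C2_ext_def grad_const by (intro conjI allI C1_ext_const)

lemma C2_ext_add:
  assumes "open K" "C2_ext K X f" "C2_ext K X g"
  shows "C2_ext K X (\<lambda>x. f x + g x)"
proof -
  have "grad (\<lambda>x. f x + g x) x = grad f x + grad g x" if "x \<in> K" for x
    using grad_lincomb[of f x g 1 1] assms that by (simp add: C2_ext_def C1_ext_def)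
  then have "C1_ext K X (\<lambda>x. grad (\<lambda>x. f x + g x) x $ i) \<longleftrightarrow> C1_ext K X (\<lambda>x. grad f x $ i + grad g x $ i)" for i
    by (intro C1_ext_cong[OF \<open>open K\<close>]) simp
  moreover have "C1_ext K X (\<lambda>x. grad f x $ i + grad g x $ i)" for i
    using assms by (intro C1_ext_add) (simp_all add: C2_ext_def)
  ultimately show ?thesis using assms by (simp add: C2_ext_def C1_ext_add)
qed

lemma C2_ext_mult:
  assumes "open K" "C2_ext K X f" "C2_ext K X g"
  shows "C2_ext K X (\<lambda>x. f x * g x)"
proof -
  have d: "f differentiable (at x)" "g differentiable (at x)" if "x \<in> K" for x
    using assms(2,3) that unfolding C2_ext_def C1_ext_def by blast+
  have "C1_ext K X (\<lambda>x. grad (\<lambda>x. f x * g x) x $ i) \<longleftrightarrow>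
      C1_ext K X (\<lambda>x. f x * grad g x $ i + g x * grad f x $ i)" for i
    by (rule C1_ext_cong[OF \<open>open K\<close>]) (simp add: grad_mult[OF d])
  moreover have "C1_ext K X (\<lambda>x. f x * grad g x $ i + g x * grad f x $ i)" for i
    using assms by (intro C1_ext_add C1_ext_mult) (simp_all add: C2_ext_def)
  ultimately show ?thesis using assms by (simp add: C2_ext_def C1_ext_mult)
qed

lemma C2_ext_sum:
  assumes "open K" "\<And>i. i \<in> I \<Longrightarrow> C2_ext K X (f i)"
  shows "C2_ext K X (\<lambda>x. \<Sum>i\<in>I. f i x)"
  using assms by (induction I rule: infinite_finite_induct) (simp_all add: C2_ext_const C2_ext_add)

lemma C2_ext_prod:
  assumes "open K" "\<And>i. i \<in> I \<Longrightarrow> C2_ext K X (f i)"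
  shows "C2_ext K X (\<lambda>x. \<Prod>i\<in>I. f i x)"
  using assms by (induction I rule: infinite_finite_induct) (simp_all add: C2_ext_const C2_ext_mult)

lemma C2_ext_power:
  assumes "open K" "C2_ext K X f"
  shows "C2_ext K X (\<lambda>x. f x ^ m)"
  using assms by (induction m) (simp_all add: C2_ext_const C2_ext_mult)

lemma det_closed:
  fixes A :: "'a \<Rightarrow> real^'n::finite^'n"
  assumes "\<And>c. P (\<lambda>x. c)" "\<And>f g. P f \<Longrightarrow> P g \<Longrightarrow> P (\<lambda>x. f x + g x)" "\<And>f g. P f \<Longrightarrow> P g \<Longrightarrow> P (\<lambda>x. f x * g x)"
    and A: "\<And>i j. P (\<lambda>x. A x $ i $ j)"
  shows "P (\<lambda>x. det (A x))"
proof -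
  have prod: "P (\<lambda>x. \<Prod>i\<in>I. f i x)" if "\<And>i. i \<in> I \<Longrightarrow> P (f i)" for I :: "'n set" and f
    using that finite[of I] by (induction I rule: infinite_finite_induct) (auto intro: assms)
  have sum: "P (\<lambda>x. \<Sum>i\<in>I. f i x)" if "\<And>i. i \<in> I \<Longrightarrow> P (f i)" for I :: "('n \<Rightarrow> 'n) set" and f
    using that by (induction I rule: infinite_finite_induct) (auto intro: assms)
  show ?thesis unfolding det_def by (intro sum assms(3) prod A assms(1))
qed

text \<open>The derivative of the inverse map is given by Cramer's rule, so it is a rational function
  of the entries of the Jacobian of \<open>F\<close>, with nonvanishing denominator up to the boundary.\<close>

lemma C2_ext_inv_into:
  fixes F :: "real^'n::finite \<Rightarrow> real^'n"
  assumes R: "open R" "bounded R"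
    and F: "C2_derivs_on (closure R) F F1 F2"
    and inj: "inj_on F (closure R)"
    and inj1: "\<And>x. x \<in> closure R \<Longrightarrow> inj (blinfun_apply (F1 x))"
  shows "open (F ` R)" "closure (F ` R) = F ` closure R"
    "C2_ext (F ` R) (closure (F ` R)) (\<lambda>y. inv_into R F y $ i)"
proof -
  have dF: "(F has_derivative blinfun_apply (F1 x)) (at x within closure R)" if "x \<in> closure R" for x
    using F that unfolding C2_derivs_on_def by simp
  have dF1: "(F1 has_derivative blinfun_apply (F2 x)) (at x within closure R)" if "x \<in> closure R" for x
    using F that unfolding C2_derivs_on_def by simp
  have cF: "continuous_on (closure R) F" "continuous_on (closure R) F1" "continuous_on (closure R) F2"
  proof -
    show "continuous_on (closure R) F" by (rule has_derivative_continuous_on[OF dF])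
    show "continuous_on (closure R) F1" by (rule has_derivative_continuous_on[OF dF1])
    show "continuous_on (closure R) F2" using F by (simp add: C2_derivs_on_def)
  qed
  have at: "(F has_derivative blinfun_apply (F1 x)) (at x)" "(F1 has_derivative blinfun_apply (F2 x)) (at x)" if "x \<in> R" for x
  proof -
    have "x \<in> closure R" using that closure_subset by blast
    from has_derivative_subset[OF dF[OF this] closure_subset] has_derivative_subset[OF dF1[OF this] closure_subset]
    show "(F has_derivative blinfun_apply (F1 x)) (at x)" "(F1 has_derivative blinfun_apply (F2 x)) (at x)"
      by (simp_all add: at_within_open[OF that R(1)])
  qed
  have comp: "compact (closure R)" using R(2) by (simp add: compact_closure)
  define K where "K = F ` R"
  define G where "G = inv_into R F"
  define G' where "G' = inv_into (closure R) F"
  have injR: "inj_on F R" using inj closure_subset inj_on_subset by blast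
  show op: "open (F ` R)"
  proof -
    have "F x \<in> interior (F ` R)" if "x \<in> R" for x
    proof -
      have lin: "linear (blinfun_apply (F1 x))" by (rule bounded_linear.linear[OF blinfun.bounded_linear_right])
      have xc: "x \<in> closure R" using that closure_subset by blast
      obtain g where g: "linear g" "g \<circ> blinfun_apply (F1 x) = id"
        using linear_injective_left_inverse[OF lin inj1[OF xc]] by blast
      then have "blinfun_apply (F1 x) \<circ> g = id"
        using lin linear_inverse_left by blast
      moreover have "continuous_on R F" using cF(1) closure_subset continuous_on_subset by blast
      moreover have "x \<in> interior R" using that R(1) by (simp add: interior_open)
      ultimately show ?thesis
        using g(1) sussmann_open_mapping[OF R(1) _ that at(1)[OF that] _ _ order_refl, of g]
        by (simp add: linear_conv_bounded_linear)
    qed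
    then show ?thesis by (metis image_subsetI interior_subset open_interior subset_antisym)
  qed
  show cl: "closure (F ` R) = F ` closure R"
  proof
    show "closure (F ` R) \<subseteq> F ` closure R"
      by (intro closure_minimal image_mono closure_subset compact_imp_closed compact_continuous_image cF comp)
    show "F ` closure R \<subseteq> closure (F ` R)"
      by (rule image_closure_subset[OF cF(1)]) (auto intro: closure_subset[THEN subsetD])
  qed
  have X: "closure K = F ` closure R" and opK: "open K" using cl op by (simp_all add: K_def)
  have KX: "K \<subseteq> closure K" by (rule closure_subset)
  have GF: "G (F x) = x" if "x \<in> R" for x unfolding G_def using injR that by (rule inv_into_f_f)
  have G'F: "G' (F x) = x" if "x \<in> closure R" for x unfolding G'_def using inj that by (rule inv_into_f_f)
  have cG': "continuous_on (closure K) G'" unfolding X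
    by (rule continuous_on_inv[OF cF(1) comp]) (simp add: G'F)
  have G'in: "G' y \<in> closure R" if "y \<in> closure K" for y using that G'F unfolding X by auto
  have GG': "G' y = G y" "G y \<in> R" if "y \<in> K" for y
    using that GF G'F closure_subset[of R] unfolding K_def by auto
  define M where "M x = matrix (blinfun_apply (F1 x))" for x
  have M: "M x $ i $ j = F1 x (axis j 1) $ i" for x i j by (simp add: M_def matrix_def)
  have detM: "det (M x) \<noteq> 0" if "x \<in> closure R" for x
    unfolding M_def using det_nz_iff_inj[of "blinfun_apply (F1 x)"] inj1[OF that]
    by (simp add: bounded_linear.linear[OF blinfun.bounded_linear_right])
  define C where "C k l y = (\<chi> i j. if j = k then axis l 1 $ i else M (G y) $ i $ j)" for k l y
  define N where "N x h = (\<chi> k. det (\<chi> i j. if j = k then h $ i else M x $ i $ j) / det (M x))" for x h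
  have dG: "(G has_derivative N (G y)) (at y)" if "y \<in> K" for y
  proof -
    have "(G has_derivative N (G y)) (at (F (G y)))"
    proof (rule has_derivative_inverse_strong[OF R(1) GG'(2)[OF that] _ _ at(1)[OF GG'(2)[OF that]]])
      show "continuous_on R F" using cF(1) closure_subset continuous_on_subset by blast
      show "G (F x) = x" if "x \<in> R" for x using GF[OF that] .
      have "M (G y) *v N (G y) h = h" for h
        unfolding N_def using cramer[of "M (G y)" _ h] detM[of "G y"] GG'(2)[OF that] closure_subset[of R] by blast
      then show "blinfun_apply (F1 (G y)) \<circ> N (G y) = id"
        by (auto simp: fun_eq_iff M_def matrix_works bounded_linear.linear[OF blinfun.bounded_linear_right])
    qed
    moreover have "F (G y) = y" using that GF by (auto simp: K_def)
    ultimately show ?thesis by simp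
  qed
  have dGi: "((\<lambda>y. G y $ k) has_derivative (\<lambda>h. N (G y) h $ k)) (at y)" if "y \<in> K" for y k
    by (rule bounded_linear.has_derivative[OF bounded_linear_vec_nth dG[OF that]])
  have gradG: "grad (\<lambda>y. G y $ k) y $ l = det (C k l y) / det (M (G y))" if "y \<in> K" for y k l
    by (simp add: grad_nth[OF dGi[OF that]] N_def C_def)
  have cF1: "continuous_on (closure R) (\<lambda>x. F1 x v $ i)" for v i
    by (intro continuous_intros cF)
  have detcont: "continuous_on (closure K) (\<lambda>y. det (M (G' y)))"
    by (rule det_closed[where P="continuous_on (closure K)"])
      (auto simp: M intro!: continuous_intros continuous_on_compose2[OF cF1 cG'] G'in)
  have inverse0: "C0_ext K (closure K) (\<lambda>y. inverse (det (M (G y))))"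
    by (rule C0_ext_compose[OF detcont, where U="- {0}"])
      (auto simp: GG' detM G'in intro!: continuous_intros)
  have M0: "C0_ext K (closure K) (\<lambda>y. M (G y) $ i $ j)" for i j
    unfolding M by (rule C0_ext_compose[OF cG' _ _ cF1]) (auto simp: GG' G'in)
  have CE0: "C0_ext K (closure K) (\<lambda>y. C k l y $ i $ j)" for k l i j
    by (cases "j = k") (simp_all add: C_def M0 C0_ext_const)
  have det0: "C0_ext K (closure K) (\<lambda>y. det (C k l y))" for k l
    by (rule det_closed[where P="C0_ext K (closure K)", OF C0_ext_const C0_ext_add C0_ext_mult CE0])
  have gradG0: "C0_ext K (closure K) (\<lambda>y. grad (\<lambda>y. G y $ k) y $ l)" for k l
  proof -
    have "C0_ext K (closure K) (\<lambda>y. det (C k l y) * inverse (det (M (G y))))"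
      by (intro C0_ext_mult det0 inverse0)
    then show ?thesis
      using C0_ext_cong[of K "\<lambda>y. grad (\<lambda>y. G y $ k) y $ l" "\<lambda>y. det (C k l y) * inverse (det (M (G y)))"]
      by (simp add: gradG divide_inverse)
  qed
  have G1: "C1_ext K (closure K) (\<lambda>y. G y $ k)" for k
    unfolding C1_ext_def
  proof (intro conjI ballI allI gradG0)
    show "C0_ext K (closure K) (\<lambda>y. G y $ k)"
      unfolding C0_ext_def by (intro exI[of _ "\<lambda>y. G' y $ k"]) (auto simp: GG' intro!: continuous_intros cG')
    show "(\<lambda>y. G y $ k) differentiable at y" if "y \<in> K" for y
      using dGi[OF that] by (auto simp: differentiable_def)
  qed
  have M1: "C1_ext K (closure K) (\<lambda>y. M (G y) $ i $ j)" for i j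
  proof -
    have d: "((\<lambda>y. M (G y) $ i $ j) has_derivative (\<lambda>h. F2 (G y) (N (G y) h) (axis j 1) $ i)) (at y)"
      if "y \<in> K" for y
    proof -
      have "((\<lambda>x. F1 x (axis j 1) $ i) has_derivative (\<lambda>h. F2 (G y) h (axis j 1) $ i)) (at (G y))"
        by (rule bounded_linear.has_derivative[OF bounded_linear_vec_nth]
          bounded_linear.has_derivative[OF blinfun.bounded_linear_left] at(2) GG'(2) that)+
      from has_derivative_compose[OF dG[OF that] this] show ?thesis by (simp add: M)
    qed
    have "grad (\<lambda>y. M (G y) $ i $ j) y $ l
        = (\<Sum>m\<in>UNIV. F2 (G y) (axis m 1) (axis j 1) $ i * grad (\<lambda>y. G y $ m) y $ l)" if "y \<in> K" for y l
    proof -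
      let ?v = "N (G y) (axis l 1)"
      have "F2 (G y) ?v (axis j 1) $ i = F2 (G y) (\<Sum>m\<in>UNIV. ?v $ m *\<^sub>R axis m 1) (axis j 1) $ i"
        by (rule arg_cong[OF basis_expansion[of ?v, symmetric, unfolded scalar_mult_eq_scaleR]])
      also have "\<dots> = (\<Sum>m\<in>UNIV. ?v $ m * (F2 (G y) (axis m 1) (axis j 1) $ i))"
        by (simp add: blinfun.sum_right blinfun.sum_left blinfun.scaleR_right blinfun.scaleR_left)
      finally show ?thesis by (simp add: grad_nth[OF d[OF that]] grad_nth[OF dGi[OF that]] mult.commute)
    qed
    moreover have "C0_ext K (closure K)
        (\<lambda>y. \<Sum>m\<in>UNIV. F2 (G y) (axis m 1) (axis j 1) $ i * grad (\<lambda>y. G y $ m) y $ l)" for l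
    proof (intro C0_ext_sum C0_ext_mult gradG0)
      fix m
      have "continuous_on (closure R) (\<lambda>x. F2 x (axis m 1) (axis j 1) $ i)" by (intro continuous_intros cF)
      then show "C0_ext K (closure K) (\<lambda>y. F2 (G y) (axis m 1) (axis j 1) $ i)"
        by (intro C0_ext_compose[OF cG']) (auto simp: GG' G'in)
    qed
    ultimately have "C0_ext K (closure K) (\<lambda>y. grad (\<lambda>y. M (G y) $ i $ j) y $ l)" for l
      by (simp cong: C0_ext_cong)
    moreover have "(\<lambda>y. M (G y) $ i $ j) differentiable (at y)" if "y \<in> K" for y
      using d[OF that] unfolding differentiable_def by blast
    ultimately show ?thesis using M0 by (simp add: C1_ext_def)
  qed
  have CE1: "C1_ext K (closure K) (\<lambda>y. C k l y $ i $ j)" for k l i j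
    by (cases "j = k") (simp_all add: C_def M1 C1_ext_const)
  have det1: "C1_ext K (closure K) (\<lambda>y. det (C k l y))" for k l
    by (rule det_closed[where P="C1_ext K (closure K)", OF C1_ext_const C1_ext_add C1_ext_mult CE1])
  have detM1: "C1_ext K (closure K) (\<lambda>y. det (M (G y)))"
    by (rule det_closed[where P="C1_ext K (closure K)", OF C1_ext_const C1_ext_add C1_ext_mult M1])
  have inverse1: "C1_ext K (closure K) (\<lambda>y. inverse (det (M (G y))))"
  proof (rule C1_ext_compose[OF detM1 KX detcont, where U="- {0}"])
    show "(inverse has_real_derivative - (inverse t ^ Suc (Suc 0))) (at t)" if "t \<in> - {0}" for t :: real
      by (rule DERIV_inverse) (use that in simp)
    show "continuous_on (- {0}) (\<lambda>t::real. - (inverse t ^ Suc (Suc 0)))"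
      by (intro continuous_intros) auto
  qed (simp_all add: GG' detM G'in)
  have "C1_ext K (closure K) (\<lambda>y. grad (\<lambda>y. G y $ k) y $ l)" for k l
  proof -
    have "C1_ext K (closure K) (\<lambda>y. det (C k l y) * inverse (det (M (G y))))"
      by (intro C1_ext_mult det1 inverse1)
    then show ?thesis
      using C1_ext_cong[OF opK, of "\<lambda>y. grad (\<lambda>y. G y $ k) y $ l" "\<lambda>y. det (C k l y) * inverse (det (M (G y)))"]
      by (simp add: gradG divide_inverse)
  qed
  with G1 show "C2_ext (F ` R) (closure (F ` R)) (\<lambda>y. inv_into R F y $ i)"
    by (simp add: C2_ext_def K_def G_def)
qed

lemma at_within_open_closure_neq_bot:
  fixes x :: "'a::perfect_space"
  assumes "open K" "x \<in> closure K"
  shows "at x within K \<noteq> bot"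
  using assms by (metis closure_def UnE interior_open interior_limit_point mem_Collect_eq trivial_limit_within)

lemma tr_eqI:
  fixes x :: "real^'n"
  assumes "open K" "x \<in> closure K" "(f \<longlongrightarrow> l) (at x within K)"
  shows "tr K f x = l"
  unfolding tr_def by (rule tendsto_Lim[OF at_within_open_closure_neq_bot]) fact+

lemma C0_ext_closureE:
  fixes f :: "real^'n \<Rightarrow> 'b::t2_space"
  assumes "open K" "C0_ext K (closure K) f"
  shows "continuous_on (closure K) (tr K f)" "\<And>x. x \<in> K \<Longrightarrow> tr K f x = f x"
    "\<And>x. x \<in> closure K \<Longrightarrow> (f \<longlongrightarrow> tr K f x) (at x within K)"
proof -
  obtain w where w: "continuous_on (closure K) w" "\<And>x. x \<in> K \<Longrightarrow> w x = f x"
    using assms by (auto simp: C0_ext_def)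
  have lim: "(f \<longlongrightarrow> w x) (at x within K)" if "x \<in> closure K" for x
  proof -
    have "(w \<longlongrightarrow> w x) (at x within closure K)" using w(1) that by (auto simp: continuous_on_def)
    then have "(w \<longlongrightarrow> w x) (at x within K)" by (rule tendsto_within_subset) (rule closure_subset)
    then show ?thesis by (rule Lim_transform_within[of _ _ _ _ 1]) (use w(2) in auto)
  qed
  have eq: "tr K f x = w x" if "x \<in> closure K" for x by (rule tr_eqI[OF assms(1) that lim[OF that]])
  show "continuous_on (closure K) (tr K f)" using w(1) eq by (simp cong: continuous_on_cong)
  show "\<And>x. x \<in> K \<Longrightarrow> tr K f x = f x" using eq w(2) closure_subset by (metis subsetD)
  show "\<And>x. x \<in> closure K \<Longrightarrow> (f \<longlongrightarrow> tr K f x) (at x within K)" using eq lim by simp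
qed


section \<open>Geometry of the elements and finite-dimensional bilinear forms\<close>

lemma exact_mesh_refel:
  assumes "exact_mesh \<Omega> T"
  shows "open (refel T)" "convex (refel T)" "bounded (refel T)"
proof -
  have "open (refel T) \<and> convex (refel T) \<and> bounded (refel T)"
  proof (cases "reference_simplex (refel T)")
    case True
    then obtain S where S: "int CARD('a) simplex S" "refel T = interior S"
      by (auto simp: reference_simplex_def)
    then show ?thesis
      using compact_simplex[OF S(1)] convex_simplex[OF S(1)]
      by (auto intro: convex_interior bounded_subset[OF compact_imp_bounded interior_subset])
  next
    case False
    then have "reference_parallelepiped (refel T)" using assms by (auto simp: exact_mesh_def)
    then obtain B :: "real^'a^'a" and b where B: "invertible B"
      "refel T = (\<lambda>x. B *v x + b) ` {x. \<forall>i. 0 < x $ i \<and> x $ i < 1}"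
      unfolding reference_parallelepiped_def by blast
    have box: "{x::real^'a. \<forall>i. 0 < x $ i \<and> x $ i < 1} = box 0 1" by (auto simp: mem_box_cart)
    have img: "refel T = (+) b ` ((*v) B ` box 0 1)" unfolding B(2) box image_image by (simp add: add.commute)
    have lin: "linear ((*v) B)" by simp
    have "surj ((*v) B)" using B(1) invertible_right_inverse matrix_right_invertible_surjective by blast
    then have "open ((*v) B ` box 0 1)" using open_surjective_linear_image[OF open_box lin] by simp
    moreover have "convex ((*v) B ` box 0 1)" by (intro convex_linear_image lin convex_box)
    moreover have "bounded ((*v) B ` box 0 1)"
      by (intro bounded_linear_image bounded_box) (simp add: linear_conv_bounded_linear[symmetric])
    ultimately show ?thesis unfolding img
      by (intro conjI open_translation convex_translation bounded_translation)
  qed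
  then show "open (refel T)" "convex (refel T)" "bounded (refel T)" by auto
qed

lemma invertible_mult_matrix_inv:
  fixes B :: "real^'n^'n"
  assumes "invertible B"
  shows "matrix_inv B *v (B *v h) = h"
proof -
  have "B ** matrix_inv B = mat 1 \<and> matrix_inv B ** B = mat 1"
    using assms unfolding invertible_def matrix_inv_def by (rule someI_ex)
  then show ?thesis by (simp add: matrix_vector_mul_assoc)
qed

lemma pert_derivative_bound:
  fixes T :: "'n::finite mesh"
  assumes ex: "exact_mesh \<Omega> T" and K: "K \<in> elems T"
    and C2: "C2_derivs_on (closure (refel T)) (pert T K) p1 p2"
  obtains c where "0 \<le> c" "c < 1"
    "\<And>x h. x \<in> closure (refel T) \<Longrightarrow> norm (blinfun_apply (p1 x) h) \<le> c * norm (aff_mat T K *v h)"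
proof -
  let ?R = "refel T" and ?B = "aff_mat T K"
  note R = exact_mesh_refel[OF ex]
  have inv: "invertible ?B" and C1: "pert_bound T K < 1" using ex K by (auto simp: exact_mesh_def)
  have d: "(pert T K has_derivative blinfun_apply (p1 x)) (at x within closure ?R)" if "x \<in> closure ?R" for x
    using C2 that unfolding C2_derivs_on_def by simp
  have d1: "(p1 has_derivative blinfun_apply (p2 x)) (at x within closure ?R)" if "x \<in> closure ?R" for x
    using C2 that unfolding C2_derivs_on_def by simp
  have cp1: "continuous_on (closure ?R) p1" by (rule has_derivative_continuous_on[OF d1])
  have fd: "frechet_derivative (pert T K) (at x) = blinfun_apply (p1 x)" if "x \<in> ?R" for x
  proof -
    have "x \<in> closure ?R" using that closure_subset by blast
    from has_derivative_subset[OF d[OF this] closure_subset]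
    have "(pert T K has_derivative blinfun_apply (p1 x)) (at x)"
      by (simp add: at_within_open[OF that R(1)])
    then show ?thesis by (rule frechet_derivative_at[symmetric])
  qed
  define g where "g x = (\<lambda>v. blinfun_apply (p1 x) (matrix_inv ?B *v v))" for x
  have blB: "bounded_linear ((*v) (matrix_inv ?B))" by (simp add: linear_conv_bounded_linear[symmetric])
  have blg: "bounded_linear (g x)" for x
    unfolding g_def by (rule bounded_linear_compose[OF blinfun.bounded_linear_right blB])
  have pb: "pert_bound T K = (SUP x\<in>?R. onorm (g x))"
    unfolding pert_bound_def g_def by (rule SUP_cong) (simp_all add: fd)
  have "bdd_above ((\<lambda>x. onorm (g x)) ` ?R)"
  proof -
    have "compact (p1 ` closure ?R)"
      by (intro compact_continuous_image cp1) (simp add: compact_closure R)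
    then have "bounded (p1 ` closure ?R)" by (rule compact_imp_bounded)
    then obtain M where M: "\<And>x. x \<in> closure ?R \<Longrightarrow> norm (p1 x) \<le> M"
      unfolding bounded_iff by auto
    have "onorm (g x) \<le> M * onorm ((*v) (matrix_inv ?B))" if "x \<in> ?R" for x
    proof -
      have "onorm (g x) \<le> onorm (blinfun_apply (p1 x)) * onorm ((*v) (matrix_inv ?B))"
        using onorm_compose[OF blinfun.bounded_linear_right[of "p1 x"] blB] by (simp add: g_def comp_def)
      also have "\<dots> \<le> M * onorm ((*v) (matrix_inv ?B))"
        using M[of x] closure_subset[of ?R] that
        by (intro mult_right_mono onorm_pos_le[OF blB]) (auto simp: norm_blinfun.rep_eq)
      finally show ?thesis .
    qed
    then show ?thesis by (rule bdd_aboveI2)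
  qed
  then have le: "onorm (g x) \<le> pert_bound T K" if "x \<in> ?R" for x
    unfolding pb by (rule cSUP_upper[OF that])
  define c where "c = max 0 (pert_bound T K)"
  have bound: "norm (blinfun_apply (p1 x) h) \<le> c * norm (?B *v h)" if "x \<in> ?R" for x h
  proof -
    have "norm (blinfun_apply (p1 x) h) = norm (g x (?B *v h))"
      by (simp add: g_def invertible_mult_matrix_inv[OF inv])
    also have "\<dots> \<le> onorm (g x) * norm (?B *v h)" by (rule onorm[OF blg])
    also have "\<dots> \<le> c * norm (?B *v h)" using le[OF that] by (intro mult_right_mono) (auto simp: c_def)
    finally show ?thesis .
  qed
  show ?thesis
  proof
    fix x h assume x: "x \<in> closure ?R"
    have "continuous_on (closure ?R) (\<lambda>x. norm (blinfun_apply (p1 x) h))" by (intro continuous_intros cp1)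
    from continuous_le_on_closure[OF this x] bound
    show "norm (blinfun_apply (p1 x) h) \<le> c * norm (?B *v h)" by blast
  qed (use C1 in \<open>auto simp: c_def\<close>)
qed

lemma elem_map_C2_diffeo:
  fixes T :: "'n::finite mesh"
  assumes ex: "exact_mesh \<Omega> T" and K: "K \<in> elems T"
  obtains F1 F2 L where "C2_derivs_on (closure (refel T)) (elem_map T K) F1 F2"
    "inj_on (elem_map T K) (closure (refel T))"
    "\<And>x. x \<in> closure (refel T) \<Longrightarrow> inj (blinfun_apply (F1 x))"
    "L-lipschitz_on (closure (refel T)) (elem_map T K)"
proof -
  let ?S = "closure (refel T)" and ?B = "aff_mat T K"
  note R = exact_mesh_refel[OF ex]
  have cS: "convex ?S" "compact ?S" using R by (auto simp: convex_closure compact_closure)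
  have inv: "invertible ?B" using ex K by (auto simp: exact_mesh_def)
  obtain p1 p2 where p: "C2_derivs_on ?S (pert T K) p1 p2"
    using ex K by (auto simp: exact_mesh_def C2_on_def)
  obtain c where c: "0 \<le> c" "c < 1" "\<And>x h. x \<in> ?S \<Longrightarrow> norm (blinfun_apply (p1 x) h) \<le> c * norm (?B *v h)"
    using pert_derivative_bound[OF ex K p] by blast
  have d: "(pert T K has_derivative blinfun_apply (p1 x)) (at x within ?S)" if "x \<in> ?S" for x
    using p that unfolding C2_derivs_on_def by simp
  have d1: "(p1 has_derivative blinfun_apply (p2 x)) (at x within ?S)" if "x \<in> ?S" for x
    using p that unfolding C2_derivs_on_def by simp
  have c2: "continuous_on ?S p2" using p unfolding C2_derivs_on_def by simp
  have blB: "bounded_linear ((*v) ?B)" by (simp add: linear_conv_bounded_linear[symmetric])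
  define F1 where "F1 x = Blinfun ((*v) ?B) + p1 x" for x
  have F1: "blinfun_apply (F1 x) h = ?B *v h + p1 x h" for x h
    by (simp add: F1_def blinfun.add_left bounded_linear_Blinfun_apply[OF blB])
  have B0: "?B *v h = 0 \<Longrightarrow> h = 0" for h
    using invertible_mult_matrix_inv[OF inv, of h] by simp
  have dF: "(elem_map T K has_derivative blinfun_apply (F1 x)) (at x within ?S)" if "x \<in> ?S" for x
  proof -
    have "((\<lambda>x. ?B *v x + aff_vec T K + pert T K x) has_derivative (\<lambda>h. ?B *v h + 0 + p1 x h)) (at x within ?S)"
      by (intro has_derivative_add bounded_linear_imp_has_derivative[OF blB] has_derivative_const d that)
    then show ?thesis by (simp add: elem_map_def[abs_def] aff_map_def F1[abs_def])
  qed
  have dF1: "(F1 has_derivative blinfun_apply (p2 x)) (at x within ?S)" if "x \<in> ?S" for x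
    unfolding F1_def[abs_def] using has_derivative_add[OF has_derivative_const d1[OF that]] by simp
  have C2: "C2_derivs_on ?S (elem_map T K) F1 p2"
    unfolding C2_derivs_on_def using dF dF1 c2 by simp
  have inj1: "inj (blinfun_apply (F1 x))" if "x \<in> ?S" for x
  proof -
    have "h = 0" if "blinfun_apply (F1 x) h = 0" for h
    proof -
      have "norm (?B *v h) = norm (p1 x h)" using that by (simp add: F1 add_eq_0_iff)
      then have "(1 - c) * norm (?B *v h) \<le> 0" using c(3)[OF \<open>x \<in> ?S\<close>, of h] by (simp add: algebra_simps)
      then have "norm (?B *v h) \<le> 0" using c(2) by (simp add: mult_le_0_iff)
      then show ?thesis using B0 by simp
    qed
    then show ?thesis
      using linear_injective_0[OF bounded_linear.linear[OF blinfun.bounded_linear_right], of "F1 x"] by blast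
  qed
  have inj: "inj_on (elem_map T K) ?S"
  proof (rule inj_onI)
    fix x y assume x: "x \<in> ?S" and y: "y \<in> ?S" and eq: "elem_map T K x = elem_map T K y"
    let ?l = "\<lambda>t. y + t *\<^sub>R (x - y)"
    have seg: "?l ` {0..1} \<subseteq> ?S"
      using convexD_alt[OF cS(1) y x] by (auto simp: algebra_simps)
    have "norm (pert T K (?l 1) - pert T K (?l 0)) \<le> (c * norm (?B *v (x - y))) * norm (1 - 0 :: real)"
    proof (rule differentiable_bound[of "{0..1}" "\<lambda>t. pert T K (?l t)" "\<lambda>t s. p1 (?l t) (s *\<^sub>R (x - y))"])
      fix t :: real assume t: "t \<in> {0..1}"
      have "(?l has_derivative (\<lambda>s. s *\<^sub>R (x - y))) (at t within {0..1})"
        by (auto intro!: derivative_eq_intros)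
      moreover have "(pert T K has_derivative blinfun_apply (p1 (?l t))) (at (?l t) within ?l ` {0..1})"
      proof (rule has_derivative_subset[OF d seg])
        show "?l t \<in> ?S" using seg t by blast
      qed
      ultimately show "((\<lambda>t. pert T K (?l t)) has_derivative (\<lambda>s. p1 (?l t) (s *\<^sub>R (x - y)))) (at t within {0..1})"
        by (rule has_derivative_in_compose)
      show "onorm (\<lambda>s. p1 (?l t) (s *\<^sub>R (x - y))) \<le> c * norm (?B *v (x - y))"
      proof (rule onorm_le)
        fix s
        have "norm (p1 (?l t) (s *\<^sub>R (x - y))) = \<bar>s\<bar> * norm (p1 (?l t) (x - y))"
          by (simp add: blinfun.scaleR_right)
        also have "\<dots> \<le> \<bar>s\<bar> * (c * norm (?B *v (x - y)))"
        proof (intro mult_left_mono c(3))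
          show "?l t \<in> ?S" using seg t by blast
        qed simp
        also have "\<dots> = c * norm (?B *v (x - y)) * norm s" by simp
        finally show "norm (p1 (?l t) (s *\<^sub>R (x - y))) \<le> c * norm (?B *v (x - y)) * norm s" .
      qed
    qed auto
    then have "norm (pert T K x - pert T K y) \<le> c * norm (?B *v (x - y))" by simp
    moreover have "pert T K x - pert T K y = - (?B *v (x - y))"
      using eq by (simp add: elem_map_def aff_map_def matrix_vector_mult_diff_distrib algebra_simps)
    ultimately have "norm (?B *v (x - y)) \<le> c * norm (?B *v (x - y))" by (simp only: norm_minus_cancel)
    then have "(1 - c) * norm (?B *v (x - y)) \<le> 0" by (simp only: left_diff_distrib mult_1 diff_le_0_iff_le)
    then have "norm (?B *v (x - y)) \<le> 0" using c(2) by (simp add: mult_le_0_iff)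
    then have "?B *v (x - y) = 0" by (simp only: norm_le_zero_iff)
    then have "x - y = 0" by (rule B0)
    then show "x = y" by simp
  qed
  have cF1: "continuous_on ?S F1" by (rule has_derivative_continuous_on[OF dF1])
  have "compact (F1 ` ?S)" by (intro compact_continuous_image cF1 cS)
  then have "bounded (F1 ` ?S)" by (rule compact_imp_bounded)
  then obtain M where M: "\<And>x. x \<in> ?S \<Longrightarrow> norm (F1 x) \<le> M"
    unfolding bounded_iff by auto
  have "(max 0 M)-lipschitz_on ?S (elem_map T K)"
    by (rule bounded_derivative_imp_lipschitz[OF dF cS(1)])
      (use M in \<open>auto simp: norm_blinfun.rep_eq[symmetric] le_max_iff_disj\<close>)
  with C2 inj inj1 show ?thesis by (rule that)
qed

lemma exact_mesh_elem:
  fixes T :: "'n::finite mesh"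
  assumes ex: "exact_mesh \<Omega> T" and K: "K \<in> elems T"
  shows "open K" "connected K" "bounded K" "closure K = elem_map T K ` closure (refel T)"
    "C2_ext K (closure K) (\<lambda>y. inv_into (refel T) (elem_map T K) y $ i)"
proof -
  note R = exact_mesh_refel[OF ex]
  obtain F1 F2 L where F: "C2_derivs_on (closure (refel T)) (elem_map T K) F1 F2"
    "inj_on (elem_map T K) (closure (refel T))"
    "\<And>x. x \<in> closure (refel T) \<Longrightarrow> inj (blinfun_apply (F1 x))"
    "L-lipschitz_on (closure (refel T)) (elem_map T K)"
    by (rule elem_map_C2_diffeo[OF ex K]) blast
  have KF: "elem_map T K ` refel T = K" using ex K by (auto simp: exact_mesh_def)
  note C = C2_ext_inv_into[OF R(1,3) F(1-3), unfolded KF]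
  show "open K" by (rule C(1))
  show "closure K = elem_map T K ` closure (refel T)" by (rule C(2))
  show "C2_ext K (closure K) (\<lambda>y. inv_into (refel T) (elem_map T K) y $ i)" by (rule C(3))
  have cont: "continuous_on (closure (refel T)) (elem_map T K)"
    using F(4) by (rule lipschitz_on_continuous_on)
  have "connected (elem_map T K ` refel T)"
    by (intro connected_continuous_image continuous_on_subset[OF cont] closure_subset convex_connected R)
  then show "connected K" by (simp add: KF)
  have "compact (elem_map T K ` closure (refel T))"
    by (intro compact_continuous_image cont) (simp add: compact_closure R)
  then have "bounded (elem_map T K ` closure (refel T))" by (rule compact_imp_bounded)
  then have "bounded (closure K)" by (subst C(2))
  then show "bounded K" using bounded_subset closure_subset by blast
qed

lemma hausdorff_outer_mono: "A \<subseteq> B \<Longrightarrow> hausdorff_outer m A \<le> hausdorff_outer m B"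
  using outer_measure_space_hausdorff_outer[of m] unfolding outer_measure_space_def increasing_def by blast

lemma facet_image_hausdorff_finite:
  fixes T :: "'n::finite mesh"
  assumes ex: "exact_mesh \<Omega> T" and K: "K \<in> elems T" and R: "R facet_of closure (refel T)"
    and S: "S \<subseteq> elem_map T K ` R"
  shows "hausdorff_outer (CARD('n) - 1) S < \<infinity>"
proof -
  obtain L where L: "L-lipschitz_on (closure (refel T)) (elem_map T K)"
    by (rule elem_map_C2_diffeo[OF ex K]) blast
  have RS: "R \<subseteq> closure (refel T)" using R by (auto simp: facet_of_def dest: face_of_imp_subset)
  have "aff_dim R < int (DIM(real^'n))"
    using R aff_dim_le_DIM[of "closure (refel T)"] by (simp add: facet_of_def)
  then obtain n c where n: "n \<noteq> 0" "R \<subseteq> {x. n \<bullet> x = c}" by (rule aff_lowdim_subset_hyperplane)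
  have "bounded R" by (rule bounded_subset[OF _ RS]) (rule bounded_closure[OF exact_mesh_refel(3)[OF ex]])
  then have "hausdorff_outer (CARD('n) - 1) (elem_map T K ` R) < \<infinity>"
    by (rule hausdorff_outer_lipschitz_hyperplane_finite[OF n _ lipschitz_on_subset[OF L RS]])
  then show ?thesis using hausdorff_outer_mono[OF S, of "CARD('n) - 1"] by (rule le_less_trans[rotated])
qed

definition lincomb_closed :: "('a \<Rightarrow> real) set \<Rightarrow> bool" where
  "lincomb_closed V \<longleftrightarrow> (\<forall>u\<in>V. \<forall>v\<in>V. \<forall>a b. (\<lambda>x. a * u x + b * v x) \<in> V)"

definition lin_functional :: "('a \<Rightarrow> real) set \<Rightarrow> (('a \<Rightarrow> real) \<Rightarrow> real) \<Rightarrow> bool" where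
  "lin_functional V L \<longleftrightarrow> (\<forall>u\<in>V. \<forall>v\<in>V. \<forall>a b. L (\<lambda>x. a * u x + b * v x) = a * L u + b * L v)"

definition bilin :: "('a \<Rightarrow> real) set \<Rightarrow> (('a \<Rightarrow> real) \<Rightarrow> ('a \<Rightarrow> real) \<Rightarrow> real) \<Rightarrow> bool" where
  "bilin V B \<longleftrightarrow> (\<forall>v\<in>V. lin_functional V (\<lambda>u. B u v) \<and> lin_functional V (B v))"

lemma lin_functionalD:
  "lin_functional V L \<Longrightarrow> u \<in> V \<Longrightarrow> v \<in> V \<Longrightarrow> L (\<lambda>x. a * u x + b * v x) = a * L u + b * L v"
  by (simp add: lin_functional_def)

lemma lincomb_closedD: "lincomb_closed V \<Longrightarrow> u \<in> V \<Longrightarrow> v \<in> V \<Longrightarrow> (\<lambda>x. a * u x + b * v x) \<in> V"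
  by (simp add: lincomb_closed_def)

lemma lincomb_sum:
  assumes V: "lincomb_closed V" "V \<noteq> {}" and "finite I" "\<And>i. i \<in> I \<Longrightarrow> b i \<in> V"
  shows "(\<lambda>x. \<Sum>i\<in>I. c i * b i x) \<in> V"
    and "lin_functional V L \<Longrightarrow> L (\<lambda>x. \<Sum>i\<in>I. c i * b i x) = (\<Sum>i\<in>I. c i * L (b i))"
proof -
  obtain v where v: "v \<in> V" using V(2) by blast
  have zero: "(\<lambda>x. 0) \<in> V" using lincomb_closedD[OF V(1) v v, of 0 0] by simp
  have "(\<lambda>x. \<Sum>i\<in>I. c i * b i x) \<in> V \<and>
      (lin_functional V L \<longrightarrow> L (\<lambda>x. \<Sum>i\<in>I. c i * b i x) = (\<Sum>i\<in>I. c i * L (b i)))"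
    using assms(3,4)
  proof (induction I)
    case empty
    have "L (\<lambda>x. 0) = 0" if "lin_functional V L"
      using lin_functionalD[OF that v v, of 0 0] by simp
    then show ?case using zero by simp
  next
    case (insert i I)
    then have mem: "(\<lambda>x. \<Sum>i\<in>I. c i * b i x) \<in> V" "b i \<in> V" by auto
    show ?case
      using lincomb_closedD[OF V(1) mem(2,1), where a="c i" and b=1] insert
        lin_functionalD[OF _ mem(2,1), where L=L and a="c i" and b=1] by simp
  qed
  then show "(\<lambda>x. \<Sum>i\<in>I. c i * b i x) \<in> V"
    and "lin_functional V L \<Longrightarrow> L (\<lambda>x. \<Sum>i\<in>I. c i * b i x) = (\<Sum>i\<in>I. c i * L (b i))" by auto
qed

text \<open>Induction on the number of spanning functions: the new function \<open>b\<close> is corrected by an element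
  \<open>w\<close> of the old span so that \<open>B (b - w)\<close> vanishes on the old span, which needs no symmetry of \<open>B\<close>.\<close>

lemma lax_milgram_span:
  fixes B :: "('a \<Rightarrow> real) \<Rightarrow> ('a \<Rightarrow> real) \<Rightarrow> real"
  assumes V: "lincomb_closed V" and B: "bilin V B"
    and pos: "\<And>v. v \<in> V \<Longrightarrow> v \<noteq> (\<lambda>x. 0) \<Longrightarrow> B v v > 0"
    and I: "finite I" and b: "\<And>i. i \<in> I \<Longrightarrow> b i \<in> V" and ne: "V \<noteq> {}" and L: "lin_functional V L"
  shows "\<exists>c. \<forall>j\<in>I. B (\<lambda>x. \<Sum>i\<in>I. c i * b i x) (b j) = L (b j)"
  using I b L
proof (induction I arbitrary: L)
  case (insert k I)
  have bI: "\<And>i. i \<in> I \<Longrightarrow> b i \<in> V" and bk: "b k \<in> V" using insert.prems by auto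
  have sumV: "(\<lambda>x. \<Sum>i\<in>I. c i * b i x) \<in> V" for c
    using lincomb_sum(1)[OF V ne insert.hyps(1)] bI by blast
  have sumL: "M (\<lambda>x. \<Sum>i\<in>I. c i * b i x) = (\<Sum>i\<in>I. c i * M (b i))" if "lin_functional V M" for c M
    using lincomb_sum(2)[OF V ne insert.hyps(1) _ that] bI by blast
  have linB: "lin_functional V (B u)" "lin_functional V (\<lambda>v. B v u)" if "u \<in> V" for u
    using B that by (auto simp: bilin_def)
  obtain cw where cw: "\<forall>j\<in>I. B (\<lambda>x. \<Sum>i\<in>I. cw i * b i x) (b j) = B (b k) (b j)"
    using insert.IH[of "B (b k)"] bI linB(1)[OF bk] by blast
  obtain cu where cu: "\<forall>j\<in>I. B (\<lambda>x. \<Sum>i\<in>I. cu i * b i x) (b j) = L (b j)"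
    using insert.IH[of L] bI insert.prems(2) by blast
  let ?w = "\<lambda>x. \<Sum>i\<in>I. cw i * b i x" and ?u = "\<lambda>x. \<Sum>i\<in>I. cu i * b i x"
  define e where "e = (\<lambda>x. 1 * b k x + (-1) * ?w x)"
  have eV: "e \<in> V" unfolding e_def by (rule lincomb_closedD[OF V bk sumV])
  have e0: "B e (b j) = 0" if "j \<in> I" for j
    unfolding e_def using lin_functionalD[OF linB(2)[OF bI[OF that]] bk sumV[of cw], of 1 "-1"] cw that by simp
  then have ew: "B e ?w = 0" using sumL[OF linB(1)[OF eV], of cw] by simp
  have ee: "B e e = B e (b k)"
    using lin_functionalD[OF linB(1)[OF eV] bk sumV[of cw], of 1 "-1", folded e_def] ew by simp
  show ?case
  proof (cases "e = (\<lambda>x. 0)")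
    case True
    have bkw: "b k = ?w"
    proof
      fix x show "b k x = ?w x" using fun_cong[OF True, of x] by (simp add: e_def)
    qed
    have "L ?w = B ?u ?w"
      unfolding sumL[OF insert.prems(2)] sumL[OF linB(1)[OF sumV]] using cu by simp
    then have "L (b k) = B ?u (b k)" by (simp only: bkw)
    with cu have "\<forall>j\<in>insert k I. B ?u (b j) = L (b j)" by simp
    moreover have "(\<lambda>x. \<Sum>i\<in>insert k I. (cu(k := 0)) i * b i x) = ?u"
    proof
      fix x
      have "(\<Sum>i\<in>I. (cu(k := 0)) i * b i x) = ?u x"
        using insert.hyps(2) by (intro sum.cong) auto
      then show "(\<Sum>i\<in>insert k I. (cu(k := 0)) i * b i x) = ?u x" using insert.hyps by simp
    qed
    ultimately show ?thesis by (intro exI[of _ "cu(k := 0)"]) (simp only:)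
  next
    case False
    then have p: "B e (b k) > 0" using pos[OF eV] ee by simp
    define t where "t = (L (b k) - B ?u (b k)) / B e (b k)"
    let ?v = "\<lambda>x. 1 * ?u x + t * e x"
    have Bv: "B ?v (b j) = B ?u (b j) + t * B e (b j)" if "j \<in> insert k I" for j
    proof -
      have "b j \<in> V" using that bI bk by auto
      from lin_functionalD[OF linB(2)[OF this] sumV[of cu] eV, of 1 t] show ?thesis by simp
    qed
    have "\<forall>j\<in>insert k I. B ?v (b j) = L (b j)"
      using Bv cu e0 p by (auto simp: t_def)
    moreover have "(\<lambda>x. \<Sum>i\<in>insert k I. (if i = k then t else cu i - t * cw i) * b i x) = ?v"
    proof
      fix x
      have "(\<Sum>i\<in>I. (if i = k then t else cu i - t * cw i) * b i x) = (\<Sum>i\<in>I. cu i * b i x - t * (cw i * b i x))"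
        using insert.hyps(2) by (intro sum.cong) (auto simp: algebra_simps)
      also have "\<dots> = ?u x - t * ?w x" by (simp add: sum_subtractf sum_distrib_left)
      finally show "(\<Sum>i\<in>insert k I. (if i = k then t else cu i - t * cw i) * b i x) = ?v x"
        using insert.hyps by (simp add: e_def algebra_simps)
    qed
    ultimately show ?thesis
      by (intro exI[of _ "\<lambda>i. if i = k then t else cu i - t * cw i"]) (simp only:)
  qed
qed simp

lemma lax_milgram_finite:
  fixes B :: "('a \<Rightarrow> real) \<Rightarrow> ('a \<Rightarrow> real) \<Rightarrow> real"
  assumes V: "lincomb_closed V" and B: "bilin V B"
    and pos: "\<And>v. v \<in> V \<Longrightarrow> v \<noteq> (\<lambda>x. 0) \<Longrightarrow> B v v > 0"
    and I: "finite I" and b: "\<And>i. i \<in> I \<Longrightarrow> b i \<in> V" and ne: "V \<noteq> {}" and L: "lin_functional V L"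
    and span: "\<And>v. v \<in> V \<Longrightarrow> \<exists>c. v = (\<lambda>x. \<Sum>i\<in>I. c i * b i x)"
  shows "\<exists>!u. u \<in> V \<and> (\<forall>v\<in>V. B u v = L v)"
proof -
  have sumV: "(\<lambda>x. \<Sum>i\<in>I. c i * b i x) \<in> V" for c
    using lincomb_sum(1)[OF V ne I] b by blast
  have sumL: "M (\<lambda>x. \<Sum>i\<in>I. c i * b i x) = (\<Sum>i\<in>I. c i * M (b i))" if "lin_functional V M" for c M
    using lincomb_sum(2)[OF V ne I _ that] b by blast
  have linB: "lin_functional V (B u)" "lin_functional V (\<lambda>v. B v u)" if "u \<in> V" for u
    using B that by (auto simp: bilin_def)
  obtain c where c: "\<forall>j\<in>I. B (\<lambda>x. \<Sum>i\<in>I. c i * b i x) (b j) = L (b j)"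
    using lax_milgram_span[OF V B _ I _ ne L, of b] pos b by blast
  let ?u = "\<lambda>x. \<Sum>i\<in>I. c i * b i x"
  have "B ?u v = L v" if v: "v \<in> V" for v
  proof -
    obtain d where d: "v = (\<lambda>x. \<Sum>i\<in>I. d i * b i x)" using span[OF v] by blast
    show ?thesis unfolding d sumL[OF L] sumL[OF linB(1)[OF sumV]] using c by simp
  qed
  moreover have "u = u'" if u: "u \<in> V" "\<forall>v\<in>V. B u v = L v" and u': "u' \<in> V" "\<forall>v\<in>V. B u' v = L v" for u u'
  proof -
    let ?e = "\<lambda>x. 1 * u x + (-1) * u' x"
    have e: "?e \<in> V" by (rule lincomb_closedD[OF V u(1) u'(1)])
    have "B ?e ?e = 0" using lin_functionalD[OF linB(2)[OF e] u(1) u'(1), of 1 "-1"] u u' e by simp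
    then have "?e = (\<lambda>x. 0)" using pos[OF e] by fastforce
    then have "u x - u' x = 0" for x by (simp add: fun_eq_iff)
    then show ?thesis by (auto simp: fun_eq_iff)
  qed
  ultimately show ?thesis using sumV by (intro ex1I[of _ ?u]) blast+
qed


section \<open>The discrete space and its traces\<close>

lemma finite_exponents: "finite (exponents k p :: ('n::finite \<Rightarrow> nat) set)"
proof -
  have fin: "finite {m :: 'n \<Rightarrow> nat. \<forall>i. m i \<le> p}"
  proof -
    have "{m :: 'n \<Rightarrow> nat. \<forall>i. m i \<le> p} = PiE UNIV (\<lambda>_. {..p})" by (auto simp: PiE_def extensional_def)
    then show ?thesis by (simp add: finite_PiE)
  qed
  show ?thesis
  proof (cases k)
    case TotalDegree
    have "exponents k p \<subseteq> {m :: 'n \<Rightarrow> nat. \<forall>i. m i \<le> p}"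
    proof
      fix m :: "'n \<Rightarrow> nat" assume "m \<in> exponents k p"
      then have s: "(\<Sum>i\<in>UNIV. m i) \<le> p" using TotalDegree by simp
      have "m i \<le> (\<Sum>i\<in>UNIV. m i)" for i by (rule member_le_sum) auto
      then show "m \<in> {m. \<forall>i. m i \<le> p}" using s order_trans by blast
    qed
    then show ?thesis using fin by (rule finite_subset)
  qed (use fin in simp)
qed

lemma lipschitz_domain_lmeasurable: "lipschitz_domain \<Omega> \<Longrightarrow> \<Omega> \<in> lmeasurable"
  by (simp add: lipschitz_domain_def lmeasurable_open)

lemma C0_ext_bounded:
  fixes f :: "real^'n \<Rightarrow> 'b::real_normed_vector"
  assumes "bounded K" "C0_ext K (closure K) f"
  obtains C where "\<And>x. x \<in> K \<Longrightarrow> norm (f x) \<le> C"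
proof -
  obtain w where w: "continuous_on (closure K) w" "\<And>x. x \<in> K \<Longrightarrow> w x = f x"
    using assms(2) by (auto simp: C0_ext_def)
  have "compact (w ` closure K)"
    by (intro compact_continuous_image w) (simp add: compact_closure assms)
  then have "bounded (w ` closure K)" by (rule compact_imp_bounded)
  then obtain C where C: "\<And>x. x \<in> closure K \<Longrightarrow> norm (w x) \<le> C" unfolding bounded_iff by auto
  have "norm (f x) \<le> C" if "x \<in> K" for x
    using C[of x] w(2)[OF that] closure_subset[of K] that by auto
  then show ?thesis by (rule that)
qed

lemma C0_ext_continuous_on: "C0_ext K (closure K) f \<Longrightarrow> continuous_on K f"
proof -
  assume "C0_ext K (closure K) f"
  then obtain w where w: "continuous_on (closure K) w" "\<forall>x\<in>K. w x = f x" by (auto simp: C0_ext_def)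
  have "continuous_on K w" by (rule continuous_on_subset[OF w(1) closure_subset])
  then show "continuous_on K f" using w(2) continuous_on_cong[of K K w f] by simp
qed

lemma L2_fun_bounded:
  assumes "\<Omega> \<in> lmeasurable" "f \<in> borel_measurable (lebesgue_on \<Omega>)" "\<And>x. \<bar>f x\<bar> \<le> C"
  shows "L2_fun \<Omega> f"
proof -
  have "(f x)\<^sup>2 \<le> C\<^sup>2" for x using power_mono[OF assms(3) abs_ge_zero, of x 2] by simp
  then have "integrable (lebesgue_on \<Omega>) (\<lambda>x. (f x)\<^sup>2)"
    using assms(2)
    by (intro finite_measure.integrable_const_bound[OF finite_measure_lebesgue_on[OF assms(1)], of _ "C\<^sup>2"]) auto
  then show ?thesis using assms(2) by (simp add: L2_fun_def)
qed

lemma L2_fun_lincomb: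
  assumes "L2_fun \<Omega> f" "L2_fun \<Omega> g"
  shows "L2_fun \<Omega> (\<lambda>x. a * f x + b * g x)"
proof -
  have m: "f \<in> borel_measurable (lebesgue_on \<Omega>)" "g \<in> borel_measurable (lebesgue_on \<Omega>)"
    and i: "integrable (lebesgue_on \<Omega>) (\<lambda>x. (f x)\<^sup>2)" "integrable (lebesgue_on \<Omega>) (\<lambda>x. (g x)\<^sup>2)"
    using assms by (auto simp: L2_fun_def)
  have le: "(a * s + b * t)\<^sup>2 \<le> 2 * a\<^sup>2 * s\<^sup>2 + 2 * b\<^sup>2 * t\<^sup>2" for s t :: real
    using zero_le_power2[of "a * s - b * t"] by (simp add: power2_eq_square algebra_simps)
  have "integrable (lebesgue_on \<Omega>) (\<lambda>x. (a * f x + b * g x)\<^sup>2)"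
  proof (rule Bochner_Integration.integrable_bound)
    show "integrable (lebesgue_on \<Omega>) (\<lambda>x. 2 * a\<^sup>2 * (f x)\<^sup>2 + 2 * b\<^sup>2 * (g x)\<^sup>2)"
      using i by (intro Bochner_Integration.integrable_add integrable_mult_right) auto
    show "(\<lambda>x. (a * f x + b * g x)\<^sup>2) \<in> borel_measurable (lebesgue_on \<Omega>)" using m by measurable
    show "AE x in lebesgue_on \<Omega>. norm ((a * f x + b * g x)\<^sup>2) \<le> norm (2 * a\<^sup>2 * (f x)\<^sup>2 + 2 * b\<^sup>2 * (g x)\<^sup>2)"
    proof (rule AE_I2)
      fix x show "norm ((a * f x + b * g x)\<^sup>2) \<le> norm (2 * a\<^sup>2 * (f x)\<^sup>2 + 2 * b\<^sup>2 * (g x)\<^sup>2)"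
        unfolding real_norm_def abs_power2
        using le[of "f x" "g x"] abs_ge_self[of "2 * a\<^sup>2 * (f x)\<^sup>2 + 2 * b\<^sup>2 * (g x)\<^sup>2"]
        by linarith
    qed
  qed
  then show ?thesis using m by (simp add: L2_fun_def)
qed

lemma dg_space_lincomb_closed: "lincomb_closed (dg_space \<Omega> T k p)"
  unfolding lincomb_closed_def
proof (intro ballI allI)
  fix u v a b assume u: "u \<in> dg_space \<Omega> T k p" and v: "v \<in> dg_space \<Omega> T k p"
  have "\<exists>\<rho>\<in>poly_space k p. \<forall>x\<in>K. a * u x + b * v x = \<rho> (inv_into (refel T) (elem_map T K) x)"
    if K: "K \<in> elems T" for K
  proof -
    obtain r s where r: "r \<in> poly_space k p" "\<forall>x\<in>K. u x = r (inv_into (refel T) (elem_map T K) x)"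
      and s: "s \<in> poly_space k p" "\<forall>x\<in>K. v x = s (inv_into (refel T) (elem_map T K) x)"
      using u v K unfolding dg_space_def by blast
    obtain c d where c: "r = (\<lambda>x. \<Sum>m\<in>exponents k p. c m * (\<Prod>i\<in>UNIV. x $ i ^ m i))"
      and d: "s = (\<lambda>x. \<Sum>m\<in>exponents k p. d m * (\<Prod>i\<in>UNIV. x $ i ^ m i))"
      using r(1) s(1) unfolding poly_space_def by blast
    have "(\<lambda>x. a * r x + b * s x) = (\<lambda>x. \<Sum>m\<in>exponents k p. (a * c m + b * d m) * (\<Prod>i\<in>UNIV. x $ i ^ m i))"
      unfolding c d by (simp add: sum_distrib_left sum.distrib algebra_simps)
    then have "(\<lambda>x. a * r x + b * s x) \<in> poly_space k p"
      unfolding poly_space_def by (intro CollectI exI[of _ "\<lambda>m. a * c m + b * d m"])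
    then show ?thesis using r(2) s(2) by (intro bexI[of _ "\<lambda>x. a * r x + b * s x"]) auto
  qed
  moreover have "L2_fun \<Omega> (\<lambda>x. a * u x + b * v x)"
    using u v by (intro L2_fun_lincomb) (simp_all add: dg_space_def)
  moreover have "\<forall>x. x \<notin> \<Union> (elems T) \<longrightarrow> a * u x + b * v x = 0"
    using u v unfolding dg_space_def by simp
  ultimately show "(\<lambda>x. a * u x + b * v x) \<in> dg_space \<Omega> T k p" unfolding dg_space_def by simp
qed

definition dg_basis :: "'n::finite mesh \<Rightarrow> (real^'n) set \<times> ('n \<Rightarrow> nat) \<Rightarrow> real^'n \<Rightarrow> real" where
  "dg_basis T b x = (if x \<in> fst b then (\<Prod>i\<in>UNIV. inv_into (refel T) (elem_map T (fst b)) x $ i ^ snd b i) else 0)"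

lemma monomial_C2_ext:
  fixes T :: "'n::finite mesh"
  assumes "exact_mesh \<Omega> T" "K \<in> elems T"
  shows "C2_ext K (closure K) (\<lambda>x. \<Prod>i\<in>UNIV. inv_into (refel T) (elem_map T K) x $ i ^ m i)"
  by (intro C2_ext_prod C2_ext_power exact_mesh_elem[OF assms])

lemma dg_basis_mem:
  fixes T :: "'n::finite mesh"
  assumes ex: "exact_mesh \<Omega> T" and \<Omega>: "\<Omega> \<in> lmeasurable" and b: "b \<in> elems T \<times> exponents k p"
  shows "dg_basis T b \<in> dg_space \<Omega> T k p"
proof -
  obtain K m where Km: "b = (K, m)" "K \<in> elems T" "m \<in> exponents k p" using b by auto
  note E = exact_mesh_elem[OF ex Km(2)]
  have c0: "C0_ext K (closure K) (\<lambda>x. \<Prod>i\<in>UNIV. inv_into (refel T) (elem_map T K) x $ i ^ m i)"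
    using monomial_C2_ext[OF ex Km(2), of m] unfolding C2_ext_def C1_ext_def by blast
  have eqb: "dg_basis T b = (\<lambda>x. if x \<in> K then \<Prod>i\<in>UNIV. inv_into (refel T) (elem_map T K) x $ i ^ m i else 0)"
    by (rule ext) (simp add: dg_basis_def Km(1))
  obtain C where C: "\<And>x. x \<in> K \<Longrightarrow> norm (\<Prod>i\<in>UNIV. inv_into (refel T) (elem_map T K) x $ i ^ m i) \<le> C"
    using C0_ext_bounded[OF E(3) c0] by blast
  have "(\<lambda>x. if x \<in> K then \<Prod>i\<in>UNIV. inv_into (refel T) (elem_map T K) x $ i ^ m i else 0) \<in> borel_measurable lebesgue"
    using E(1) by (intro borel_measurable_if_I continuous_imp_measurable_on_sets_lebesgue C0_ext_continuous_on c0) auto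
  then have meas: "dg_basis T b \<in> borel_measurable (lebesgue_on \<Omega>)"
    unfolding eqb by (rule measurable_restrict_space1)
  have "\<bar>dg_basis T b x\<bar> \<le> max 0 C" for x
    using C[of x] by (cases "x \<in> K") (auto simp: eqb le_max_iff_disj)
  with meas have "L2_fun \<Omega> (dg_basis T b)" by (rule L2_fun_bounded[OF \<Omega>])
  moreover have "\<exists>\<rho>\<in>poly_space k p. \<forall>x\<in>K'. dg_basis T b x = \<rho> (inv_into (refel T) (elem_map T K') x)"
    if K': "K' \<in> elems T" for K'
  proof -
    define c :: real where "c = (if K' = K then 1 else 0)"
    let ?\<rho> = "\<lambda>x. \<Sum>m'\<in>exponents k p. (if m' = m then c else 0) * (\<Prod>i\<in>UNIV. x $ i ^ m' i)"
    have \<rho>: "?\<rho> x = c * (\<Prod>i\<in>UNIV. x $ i ^ m i)" for x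
    proof -
      have "?\<rho> x = (\<Sum>m'\<in>exponents k p. if m' = m then c * (\<Prod>i\<in>UNIV. x $ i ^ m' i) else 0)"
        by (intro sum.cong) auto
      also have "\<dots> = c * (\<Prod>i\<in>UNIV. x $ i ^ m i)" using Km(3) by (simp add: sum.delta[OF finite_exponents])
      finally show ?thesis .
    qed
    have "disjoint (elems T)" using ex by (simp add: exact_mesh_def)
    then have "x \<notin> K" if "x \<in> K'" "K' \<noteq> K" for x
      using disjointD[of "elems T" K' K] K' Km(2) that by blast
    then have "\<forall>x\<in>K'. dg_basis T b x = ?\<rho> (inv_into (refel T) (elem_map T K') x)"
      unfolding \<rho> eqb by (auto simp: c_def)
    moreover have "?\<rho> \<in> poly_space k p"
      unfolding poly_space_def by (intro CollectI exI[of _ "\<lambda>m'. if m' = m then c else 0"] refl)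
    ultimately show ?thesis by (intro bexI[of _ ?\<rho>])
  qed
  moreover have "\<forall>x. x \<notin> \<Union> (elems T) \<longrightarrow> dg_basis T b x = 0" using Km(2) by (auto simp: eqb)
  ultimately show ?thesis unfolding dg_space_def by blast
qed

lemma dg_space_span:
  assumes ex: "exact_mesh \<Omega> T" and v: "v \<in> dg_space \<Omega> T k p"
  shows "\<exists>c. v = (\<lambda>x. \<Sum>b\<in>elems T \<times> exponents k p. c b * dg_basis T b x)"
proof -
  have fin: "finite (elems T)" and dj: "disjoint (elems T)" using ex by (auto simp: exact_mesh_def)
  have "\<exists>c. \<forall>x\<in>K. v x = (\<Sum>m\<in>exponents k p. c m * (\<Prod>i\<in>UNIV. inv_into (refel T) (elem_map T K) x $ i ^ m i))"
    if "K \<in> elems T" for K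
  proof -
    obtain \<rho> where \<rho>: "\<rho> \<in> poly_space k p" "\<forall>x\<in>K. v x = \<rho> (inv_into (refel T) (elem_map T K) x)"
      using v \<open>K \<in> elems T\<close> unfolding dg_space_def by blast
    obtain c where "\<rho> = (\<lambda>x. \<Sum>m\<in>exponents k p. c m * (\<Prod>i\<in>UNIV. x $ i ^ m i))"
      using \<rho>(1) unfolding poly_space_def by blast
    with \<rho>(2) show ?thesis by (intro exI[of _ c]) simp
  qed
  then obtain c where c: "\<And>K x. K \<in> elems T \<Longrightarrow> x \<in> K \<Longrightarrow>
      v x = (\<Sum>m\<in>exponents k p. c K m * (\<Prod>i\<in>UNIV. inv_into (refel T) (elem_map T K) x $ i ^ m i))"
    using bchoice[of "elems T" "\<lambda>K c. \<forall>x\<in>K. v x = (\<Sum>m\<in>exponents k p. c m *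
      (\<Prod>i\<in>UNIV. inv_into (refel T) (elem_map T K) x $ i ^ m i))"] by blast
  have "v x = (\<Sum>b\<in>elems T \<times> exponents k p. c (fst b) (snd b) * dg_basis T b x)" for x
  proof -
    have eq: "(\<Sum>b\<in>elems T \<times> exponents k p. c (fst b) (snd b) * dg_basis T b x)
        = (\<Sum>K\<in>elems T. \<Sum>m\<in>exponents k p. c K m * dg_basis T (K, m) x)"
      by (simp add: sum.cartesian_product case_prod_unfold)
    show ?thesis
    proof (cases "x \<in> \<Union> (elems T)")
      case True
      then obtain K where K: "K \<in> elems T" "x \<in> K" by blast
      have "x \<notin> K'" if "K' \<in> elems T" "K' \<noteq> K" for K' using dj K that unfolding disjoint_def by blast
      then have "(\<Sum>K'\<in>elems T - {K}. \<Sum>m\<in>exponents k p. c K' m * dg_basis T (K', m) x) = 0"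
        by (intro sum.neutral ballI) (simp add: dg_basis_def)
      then have "(\<Sum>K\<in>elems T. \<Sum>m\<in>exponents k p. c K m * dg_basis T (K, m) x)
          = (\<Sum>m\<in>exponents k p. c K m * dg_basis T (K, m) x)"
        by (subst sum.remove[OF fin K(1)]) simp
      then show ?thesis unfolding eq using c[OF K] K(2) by (simp add: dg_basis_def)
    next
      case False
      then have "(\<Sum>K\<in>elems T. \<Sum>m\<in>exponents k p. c K m * dg_basis T (K, m) x) = 0"
        by (intro sum.neutral ballI) (auto simp: dg_basis_def)
      then show ?thesis unfolding eq using v False by (simp add: dg_space_def)
    qed
  qed
  then show ?thesis by (intro exI[of _ "\<lambda>b. c (fst b) (snd b)"] ext)
qed

lemma dg_space_C2_ext:
  fixes T :: "'n::finite mesh"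
  assumes ex: "exact_mesh \<Omega> T" and v: "v \<in> dg_space \<Omega> T k p" and K: "K \<in> elems T"
  shows "C2_ext K (closure K) v"
proof -
  note E = exact_mesh_elem[OF ex K]
  obtain \<rho> where \<rho>: "\<rho> \<in> poly_space k p" "\<forall>x\<in>K. v x = \<rho> (inv_into (refel T) (elem_map T K) x)"
    using v K unfolding dg_space_def by blast
  obtain c where c: "\<rho> = (\<lambda>x. \<Sum>m\<in>exponents k p. c m * (\<Prod>i\<in>UNIV. x $ i ^ m i))"
    using \<rho>(1) unfolding poly_space_def by blast
  have "C2_ext K (closure K) (\<lambda>x. \<Sum>m\<in>exponents k p. c m *
      (\<Prod>i\<in>UNIV. inv_into (refel T) (elem_map T K) x $ i ^ m i))"
    by (intro C2_ext_sum C2_ext_mult C2_ext_const monomial_C2_ext[OF ex K] E(1))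
  moreover have "C2_ext K (closure K) v \<longleftrightarrow> C2_ext K (closure K) (\<lambda>x. \<Sum>m\<in>exponents k p. c m *
      (\<Prod>i\<in>UNIV. inv_into (refel T) (elem_map T K) x $ i ^ m i))"
    by (rule C2_ext_cong[OF E(1)]) (use \<rho>(2) c in simp)
  ultimately show ?thesis by simp
qed

lemma C2_ext_D:
  assumes "C2_ext K X u"
  shows "C0_ext K X u" "C0_ext K X (grad u)" "C0_ext K X (\<lambda>y. grad u y \<bullet> t)"
    "C0_ext K X (grad (\<lambda>y. grad u y $ j))" "C0_ext K X (hess u)" "C0_ext K X (laplacian u)"
    "x \<in> K \<Longrightarrow> u differentiable (at x)" "x \<in> K \<Longrightarrow> (\<lambda>y. grad u y $ j) differentiable (at x)"
proof -
  have g: "C0_ext K X (\<lambda>x. grad u x $ i)" for i using assms by (simp add: C2_ext_def C1_ext_def)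
  have h: "C0_ext K X (\<lambda>x. grad (\<lambda>y. grad u y $ j) x $ i)" for i j
    using assms by (simp add: C2_ext_def C1_ext_def)
  show "C0_ext K X u" "x \<in> K \<Longrightarrow> u differentiable (at x)" "x \<in> K \<Longrightarrow> (\<lambda>y. grad u y $ j) differentiable (at x)"
    using assms by (simp_all add: C2_ext_def C1_ext_def)
  show "C0_ext K X (grad u)" by (rule C0_ext_vec) (rule g)
  show "C0_ext K X (grad (\<lambda>y. grad u y $ j))" by (rule C0_ext_vec) (rule h)
  show "C0_ext K X (\<lambda>y. grad u y \<bullet> t)"
    unfolding inner_vec_def inner_real_def by (intro C0_ext_sum C0_ext_mult g C0_ext_const)
  have hij: "hess u x $ i $ j = grad (\<lambda>y. grad u y $ j) x $ i" for x i j by (simp add: hess_def jac_def)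
  show "C0_ext K X (hess u)"
    by (rule C0_ext_vec, rule C0_ext_vec) (simp only: hij h)
  show "C0_ext K X (laplacian u)"
    unfolding laplacian_def[abs_def] trace_def by (rule C0_ext_sum) (simp only: hij h)
qed

definition cont_lin :: "(real^'n) set \<Rightarrow> (real^'n \<Rightarrow> real) set
    \<Rightarrow> ((real^'n \<Rightarrow> real) \<Rightarrow> real^'n \<Rightarrow> 'b::real_normed_vector) \<Rightarrow> bool" where
  "cont_lin S V Q \<longleftrightarrow> (\<forall>u\<in>V. continuous_on S (Q u)) \<and>
     (\<forall>u\<in>V. \<forall>v\<in>V. \<forall>a b. \<forall>x\<in>S. Q (\<lambda>y. a * u y + b * v y) x = a *\<^sub>R Q u x + b *\<^sub>R Q v x)"

lemma cont_lin_mono: "cont_lin S V Q \<Longrightarrow> S' \<subseteq> S \<Longrightarrow> cont_lin S' V Q"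
  unfolding cont_lin_def using continuous_on_subset by blast

lemma cont_lin_add:
  assumes "cont_lin S V P" "cont_lin S V Q"
  shows "cont_lin S V (\<lambda>u x. P u x + Q u x)"
  using assms unfolding cont_lin_def by (simp add: continuous_on_add algebra_simps)

lemma cont_lin_diff:
  assumes "cont_lin S V P" "cont_lin S V Q"
  shows "cont_lin S V (\<lambda>u x. P u x - Q u x)"
  using assms unfolding cont_lin_def by (simp add: continuous_on_diff algebra_simps)

lemma cont_lin_zero: "cont_lin S V (\<lambda>u x. 0)"
  by (simp add: cont_lin_def)

lemma cont_lin_sum:
  assumes "\<And>i. i \<in> I \<Longrightarrow> cont_lin S V (Q i)"
  shows "cont_lin S V (\<lambda>u x. \<Sum>i\<in>I. Q i u x)"
  using assms by (induction I rule: infinite_finite_induct) (simp_all add: cont_lin_zero cont_lin_add)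

lemma cont_lin_apply:
  assumes Q: "cont_lin S V Q" and h: "\<And>x. x \<in> S \<Longrightarrow> linear (h x)"
    and c: "\<And>q. continuous_on S q \<Longrightarrow> continuous_on S (\<lambda>x. h x (q x))"
  shows "cont_lin S V (\<lambda>u x. h x (Q u x))"
  using Q c linear_add[OF h] linear_cmul[OF h] unfolding cont_lin_def by simp

lemma cont_lin_cong:
  assumes "cont_lin S V P" "\<And>u x. u \<in> V \<Longrightarrow> x \<in> S \<Longrightarrow> P u x = Q u x" "lincomb_closed V"
  shows "cont_lin S V Q"
proof -
  have eq: "P u x = Q u x" if "u \<in> V" "x \<in> S" for u x using assms(2) that .
  have "continuous_on S (Q u)" if "u \<in> V" for u
  proof (rule continuous_on_eq)
    show "continuous_on S (P u)" using assms(1) that unfolding cont_lin_def by blast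
  qed (rule eq[OF that])
  moreover have "Q (\<lambda>y. a * u y + b * v y) x = a *\<^sub>R Q u x + b *\<^sub>R Q v x"
    if "u \<in> V" "v \<in> V" "x \<in> S" for u v a b x
  proof -
    have "P (\<lambda>y. a * u y + b * v y) x = a *\<^sub>R P u x + b *\<^sub>R P v x"
      using assms(1) that unfolding cont_lin_def by blast
    then show ?thesis using eq[OF lincomb_closedD[OF assms(3) that(1,2)] that(3)] eq that by simp
  qed
  ultimately show ?thesis unfolding cont_lin_def by blast
qed

lemma cont_lin_tr:
  fixes \<Phi> :: "(real^'n \<Rightarrow> real) \<Rightarrow> real^'n \<Rightarrow> 'b::real_normed_vector"
  assumes K: "open K" and V: "lincomb_closed V" and ext: "\<And>u. u \<in> V \<Longrightarrow> C0_ext K (closure K) (\<Phi> u)"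
    and lin: "\<And>u v a b x. u \<in> V \<Longrightarrow> v \<in> V \<Longrightarrow> x \<in> K \<Longrightarrow> \<Phi> (\<lambda>y. a * u y + b * v y) x = a *\<^sub>R \<Phi> u x + b *\<^sub>R \<Phi> v x"
  shows "cont_lin (closure K) V (\<lambda>u. tr K (\<Phi> u))"
  unfolding cont_lin_def
proof (intro conjI ballI allI)
  fix u v a b x assume u: "u \<in> V" and v: "v \<in> V" and x: "x \<in> closure K"
  have "((\<lambda>x. a *\<^sub>R \<Phi> u x + b *\<^sub>R \<Phi> v x) \<longlongrightarrow> a *\<^sub>R tr K (\<Phi> u) x + b *\<^sub>R tr K (\<Phi> v) x) (at x within K)"
    by (intro tendsto_intros C0_ext_closureE(3)[OF K ext x] u v)
  then have "(\<Phi> (\<lambda>y. a * u y + b * v y) \<longlongrightarrow> a *\<^sub>R tr K (\<Phi> u) x + b *\<^sub>R tr K (\<Phi> v) x) (at x within K)"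
    by (rule Lim_transform_within[of _ _ _ _ 1]) (use lin[OF u v] in auto)
  then show "tr K (\<Phi> (\<lambda>y. a * u y + b * v y)) x = a *\<^sub>R tr K (\<Phi> u) x + b *\<^sub>R tr K (\<Phi> v) x"
    by (rule tr_eqI[OF K x])
qed (rule C0_ext_closureE(1)[OF K ext])

lemma grad_lincomb_open:
  assumes K: "open K" "x \<in> K" and d: "\<And>y. y \<in> K \<Longrightarrow> u differentiable (at y)" "\<And>y. y \<in> K \<Longrightarrow> v differentiable (at y)"
    and d2: "(\<lambda>y. grad u y $ j) differentiable (at x)" "(\<lambda>y. grad v y $ j) differentiable (at x)"
  shows "grad (\<lambda>y. grad (\<lambda>y. a * u y + b * v y) y $ j) x
    = a *\<^sub>R grad (\<lambda>y. grad u y $ j) x + b *\<^sub>R grad (\<lambda>y. grad v y $ j) x"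
proof -
  have "grad (\<lambda>y. grad (\<lambda>y. a * u y + b * v y) y $ j) x = grad (\<lambda>y. a * (grad u y $ j) + b * (grad v y $ j)) x"
    by (rule grad_cong_open[OF K]) (simp add: grad_lincomb[OF d])
  also have "\<dots> = a *\<^sub>R grad (\<lambda>y. grad u y $ j) x + b *\<^sub>R grad (\<lambda>y. grad v y $ j) x"
    by (rule grad_lincomb[OF d2])
  finally show ?thesis .
qed

lemma grad_inner_field:
  fixes u :: "real^'n \<Rightarrow> real" and \<nu> :: "real^'n \<Rightarrow> real^'n"
  assumes "\<And>j. (\<lambda>y. grad u y $ j) differentiable (at x)" "\<And>j. (\<lambda>y. \<nu> y $ j) differentiable (at x)"
  shows "grad (\<lambda>y. grad u y \<bullet> \<nu> y) x
    = (\<Sum>j\<in>UNIV. (\<nu> x $ j) *\<^sub>R grad (\<lambda>y. grad u y $ j) x + (grad u x $ j) *\<^sub>R grad (\<lambda>y. \<nu> y $ j) x)"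
proof -
  have "((\<lambda>y. \<Sum>j\<in>UNIV. (grad u y $ j) * (\<nu> y $ j)) has_derivative
      (\<lambda>h. \<Sum>j\<in>UNIV. (grad u x $ j) * (grad (\<lambda>y. \<nu> y $ j) x \<bullet> h) + (grad (\<lambda>y. grad u y $ j) x \<bullet> h) * (\<nu> x $ j))) (at x)"
    by (intro has_derivative_sum has_derivative_mult has_derivative_grad assms)
  then have "((\<lambda>y. grad u y \<bullet> \<nu> y) has_derivative
      (\<lambda>h. \<Sum>j\<in>UNIV. (grad u x $ j) * (grad (\<lambda>y. \<nu> y $ j) x \<bullet> h) + (grad (\<lambda>y. grad u y $ j) x \<bullet> h) * (\<nu> x $ j))) (at x)"
    by (simp add: inner_vec_def)
  then show ?thesis
    by (simp add: vec_eq_iff grad_nth inner_axis algebra_simps)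
qed

lemma tr_grad_inner_field:
  assumes K: "open K" and u: "C2_ext K (closure K) u" and W: "open W" and \<nu>: "\<And>j. C1_ext W W (\<lambda>y. \<nu> y $ j)"
    and x: "x \<in> closure K" "x \<in> W"
  shows "tr K (grad (\<lambda>y. grad u y \<bullet> \<nu> y)) x
    = (\<Sum>j\<in>UNIV. (\<nu> x $ j) *\<^sub>R tr K (grad (\<lambda>y. grad u y $ j)) x + (tr K (grad u) x $ j) *\<^sub>R grad (\<lambda>y. \<nu> y $ j) x)"
proof -
  have cont: "continuous_on W (\<lambda>y. \<nu> y $ j)" "continuous_on W (grad (\<lambda>y. \<nu> y $ j))" for j
  proof -
    have c: "continuous_on W f" if f: "C0_ext W W f" for f :: "real^'a \<Rightarrow> real"
    proof -
      obtain w where "continuous_on W w" "\<forall>x\<in>W. w x = f x" using f by (auto simp: C0_ext_def)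
      then show ?thesis using continuous_on_cong[of W W w f] by simp
    qed
    show "continuous_on W (\<lambda>y. \<nu> y $ j)" using \<nu>[of j] c by (simp add: C1_ext_def)
    have "continuous_on W (\<lambda>x. grad (\<lambda>y. \<nu> y $ j) x $ i)" for i using \<nu>[of j] c by (simp add: C1_ext_def)
    then have "continuous_on W (\<lambda>x. \<chi> i. grad (\<lambda>y. \<nu> y $ j) x $ i)" by (rule continuous_on_vec_lambda)
    then show "continuous_on W (grad (\<lambda>y. \<nu> y $ j))" by (simp add: vec_lambda_eta)
  qed
  have lim\<nu>: "((\<lambda>y. \<nu> y $ j) \<longlongrightarrow> \<nu> x $ j) (at x within K)"
    "(grad (\<lambda>y. \<nu> y $ j) \<longlongrightarrow> grad (\<lambda>y. \<nu> y $ j) x) (at x within K)" for j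
    using cont[of j] W x(2) by (auto simp: continuous_on_eq_continuous_at isCont_def intro: tendsto_within_subset)
  have "((\<lambda>z. \<Sum>j\<in>UNIV. (\<nu> z $ j) *\<^sub>R grad (\<lambda>y. grad u y $ j) z + (grad u z $ j) *\<^sub>R grad (\<lambda>y. \<nu> y $ j) z)
    \<longlongrightarrow> (\<Sum>j\<in>UNIV. (\<nu> x $ j) *\<^sub>R tr K (grad (\<lambda>y. grad u y $ j)) x + (tr K (grad u) x $ j) *\<^sub>R grad (\<lambda>y. \<nu> y $ j) x))
    (at x within K)"
    by (intro tendsto_sum tendsto_add tendsto_scaleR lim\<nu> tendsto_vec_nth
      C0_ext_closureE(3)[OF K C2_ext_D(4)[OF u] x(1)] C0_ext_closureE(3)[OF K C2_ext_D(2)[OF u] x(1)])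
  moreover have "eventually (\<lambda>z. (\<Sum>j\<in>UNIV. (\<nu> z $ j) *\<^sub>R grad (\<lambda>y. grad u y $ j) z + (grad u z $ j) *\<^sub>R grad (\<lambda>y. \<nu> y $ j) z)
      = grad (\<lambda>y. grad u y \<bullet> \<nu> y) z) (at x within K)"
  proof -
    have "eventually (\<lambda>z. z \<in> W) (at x within K)"
      using eventually_nhds_in_open[OF W x(2)] by (rule filter_leD[rotated]) (simp add: at_within_def)
    moreover have "eventually (\<lambda>z. z \<in> K) (at x within K)" by (simp add: eventually_at_filter)
    ultimately show ?thesis
    proof eventually_elim
      case (elim z)
      show ?case
        by (rule grad_inner_field[symmetric])
          (use C2_ext_D(8)[OF u elim(2)] \<nu> elim(1) in \<open>simp_all add: C1_ext_def\<close>)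
    qed
  qed
  ultimately have "((grad (\<lambda>y. grad u y \<bullet> \<nu> y)) \<longlongrightarrow> (\<Sum>j\<in>UNIV. (\<nu> x $ j) *\<^sub>R tr K (grad (\<lambda>y. grad u y $ j)) x
      + (tr K (grad u) x $ j) *\<^sub>R grad (\<lambda>y. \<nu> y $ j) x)) (at x within K)"
    by (rule Lim_transform_eventually)
  then show ?thesis by (rule tr_eqI[OF K x(1)])
qed

lemma tangent_basis:
  fixes n :: "real^'n"
  shows "pairwise orthogonal (tangent_basis n)" "\<And>t. t \<in> tangent_basis n \<Longrightarrow> norm t = 1"
    "span (tangent_basis n) = {t. n \<bullet> t = 0}" "finite (tangent_basis n)"
proof -
  have "subspace {t. n \<bullet> t = 0}" by (rule subspace_hyperplane)
  then obtain B where "pairwise orthogonal B" "\<And>x. x \<in> B \<Longrightarrow> norm x = 1" "span B = {t. n \<bullet> t = 0}"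
    by (rule orthonormal_basis_subspace) blast
  then have "\<exists>B. pairwise orthogonal B \<and> (\<forall>t\<in>B. norm t = 1) \<and> span B = {t. n \<bullet> t = 0}" by blast
  then have *: "pairwise orthogonal (tangent_basis n) \<and> (\<forall>t\<in>tangent_basis n. norm t = 1) \<and>
      span (tangent_basis n) = {t. n \<bullet> t = 0}"
    unfolding tangent_basis_def by (rule someI_ex)
  then show "pairwise orthogonal (tangent_basis n)" "\<And>t. t \<in> tangent_basis n \<Longrightarrow> norm t = 1"
    "span (tangent_basis n) = {t. n \<bullet> t = 0}" by auto
  have "0 \<notin> tangent_basis n" using * by force
  then show "finite (tangent_basis n)"
    using * pairwise_orthogonal_independent independent_imp_finite by blast
qed

lemma tangent_projection:
  fixes n g :: "real^'n"
  assumes "norm n = 1"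
  shows "(\<Sum>t\<in>tangent_basis n. (g \<bullet> t) *\<^sub>R t) = g - (g \<bullet> n) *\<^sub>R n"
proof -
  let ?y = "g - (g \<bullet> n) *\<^sub>R n"
  have "n \<bullet> n = 1" using assms by (simp add: norm_eq_1)
  then have y: "?y \<in> span (tangent_basis n)"
    by (simp add: tangent_basis inner_diff_right inner_commute)
  have "n \<bullet> t = 0" if "t \<in> tangent_basis n" for t
    using span_base[OF that] by (simp add: tangent_basis)
  then have "(\<Sum>t\<in>tangent_basis n. (g \<bullet> t) *\<^sub>R t) = (\<Sum>t\<in>tangent_basis n. (?y \<bullet> t) *\<^sub>R t)"
    by (intro sum.cong) (simp_all add: inner_diff_left)
  also have "\<dots> = ?y" by (rule orthonormal_basis_expand[OF tangent_basis(1,2) y tangent_basis(4)])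
  finally show ?thesis .
qed

lemma tan_grad_eq: "norm n = 1 \<Longrightarrow> tan_grad K w n x = tr K (grad w) x - (tr K (grad w) x \<bullet> n) *\<^sub>R n"
  unfolding tan_grad_def by (rule tangent_projection)


section \<open>Bilinearity of the forms\<close>

lemma C0_ext_self_iff: "C0_ext W W f \<longleftrightarrow> continuous_on W f"
proof
  assume "C0_ext W W f"
  then obtain w where "continuous_on W w" "\<forall>x\<in>W. w x = f x" by (auto simp: C0_ext_def)
  then show "continuous_on W f" using continuous_on_cong[of W W w f] by simp
qed (auto simp: C0_ext_def)

lemma C1_ext_subset:
  assumes "C1_ext U U f" "W \<subseteq> U"
  shows "C1_ext W W f"
  using assms continuous_on_subset[OF _ assms(2)] unfolding C1_ext_def C0_ext_self_iff by blast

lemma C2_derivs_on_open: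
  fixes \<phi> :: "real^'n \<Rightarrow> real"
  assumes U: "open U" and \<phi>: "C2_derivs_on U \<phi> f1 f2"
  shows "C2_ext U U \<phi>"
proof -
  have d: "(\<phi> has_derivative blinfun_apply (f1 x)) (at x)" if "x \<in> U" for x
  proof -
    have "(\<phi> has_derivative blinfun_apply (f1 x)) (at x within U)"
      using \<phi> that unfolding C2_derivs_on_def by simp
    then show ?thesis by (simp add: at_within_open[OF that U])
  qed
  have d1: "(f1 has_derivative blinfun_apply (f2 x)) (at x)" if "x \<in> U" for x
  proof -
    have "(f1 has_derivative blinfun_apply (f2 x)) (at x within U)"
      using \<phi> that unfolding C2_derivs_on_def by simp
    then show ?thesis by (simp add: at_within_open[OF that U])
  qed
  have d1i: "((\<lambda>x. f1 x (axis i 1)) has_derivative (\<lambda>h. f2 x h (axis i 1))) (at x)" if "x \<in> U" for x i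
    by (rule bounded_linear.has_derivative[OF blinfun.bounded_linear_left d1[OF that]])
  have c2: "continuous_on U f2" using \<phi> by (simp add: C2_derivs_on_def)
  have "continuous_on U f1"
    by (intro continuous_at_imp_continuous_on ballI has_derivative_continuous[OF d1])
  then have c1: "continuous_on U (\<lambda>x. f1 x (axis i 1))" for i by (intro continuous_intros)
  have g: "grad \<phi> x $ i = f1 x (axis i 1)" if "x \<in> U" for x i by (rule grad_nth[OF d[OF that]])
  have C1: "C1_ext U U (\<lambda>x. f1 x (axis i 1))" for i
    unfolding C1_ext_def C0_ext_self_iff
  proof (intro conjI allI ballI c1)
    show "(\<lambda>x. f1 x (axis i 1)) differentiable at x" if "x \<in> U" for x
      using d1i[OF that] unfolding differentiable_def by blast
    fix j
    have "continuous_on U (\<lambda>x. f2 x (axis j 1) (axis i 1))" by (intro continuous_intros c2)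
    then show "continuous_on U (\<lambda>x. grad (\<lambda>x. f1 x (axis i 1)) x $ j)"
      by (rule continuous_on_eq) (simp add: grad_nth[OF d1i])
  qed
  have C1g: "C1_ext U U (\<lambda>x. grad \<phi> x $ i)" for i
    using C1[of i] C1_ext_cong[OF U, of "\<lambda>x. grad \<phi> x $ i" "\<lambda>x. f1 x (axis i 1)" U] g by simp
  moreover have "C1_ext U U \<phi>"
    unfolding C1_ext_def C0_ext_self_iff
  proof (intro conjI allI ballI)
    show "continuous_on U \<phi>"
      by (intro continuous_at_imp_continuous_on ballI has_derivative_continuous[OF d])
    show "\<phi> differentiable at x" if "x \<in> U" for x using d[OF that] unfolding differentiable_def by blast
    show "continuous_on U (\<lambda>x. grad \<phi> x $ i)" for i
      using C1g[of i] by (simp add: C1_ext_def C0_ext_self_iff)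
  qed
  ultimately show ?thesis by (simp add: C2_ext_def)
qed

lemma convex_critical_point_min:
  fixes \<phi> :: "'a::real_normed_vector \<Rightarrow> real"
  assumes cv: "convex_on U \<phi>" and x: "x \<in> U" and y: "y \<in> U" and d: "(\<phi> has_derivative (\<lambda>h. 0)) (at x)"
  shows "\<phi> x \<le> \<phi> y"
proof -
  let ?l = "\<lambda>t. x + t *\<^sub>R (y - x)"
  have "(?l has_derivative (\<lambda>s. s *\<^sub>R (y - x))) (at 0)"
    by (auto intro!: derivative_eq_intros)
  from has_derivative_compose[OF this, of \<phi> "\<lambda>h. 0"] d
  have "((\<lambda>t. \<phi> (?l t)) has_derivative (\<lambda>s. 0 * s)) (at 0)" by simp
  then have "((\<lambda>t. \<phi> (?l t)) has_real_derivative 0) (at 0)" by (simp only: has_field_derivative_def)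
  then have "((\<lambda>t. (\<phi> (?l t) - \<phi> (?l 0)) / (t - 0)) \<longlongrightarrow> 0) (at 0)"
    unfolding has_field_derivative_iff .
  then have "((\<lambda>t. (\<phi> (?l t) - \<phi> x) / t) \<longlongrightarrow> 0) (at_right 0)"
    by (auto intro: tendsto_within_subset)
  moreover have "eventually (\<lambda>t. (\<phi> (?l t) - \<phi> x) / t \<le> \<phi> y - \<phi> x) (at_right 0)"
  proof (rule eventually_at_rightI[of 0 1])
    fix t :: real assume t: "t \<in> {0<..<1}"
    have "?l t = (1 - t) *\<^sub>R x + t *\<^sub>R y" by (simp add: algebra_simps)
    then have "\<phi> (?l t) \<le> (1 - t) * \<phi> x + t * \<phi> y" using convex_onD[OF cv, of t x y] t x y by simp
    then have "\<phi> (?l t) - \<phi> x \<le> (\<phi> y - \<phi> x) * t" by (simp add: algebra_simps)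
    then show "(\<phi> (?l t) - \<phi> x) / t \<le> \<phi> y - \<phi> x" using t by (simp add: divide_le_eq)
  qed simp
  ultimately have "0 \<le> \<phi> y - \<phi> x" by (rule tendsto_upperbound) simp
  then show ?thesis by simp
qed

text \<open>A critical point of a convex function is a global minimum, so if the gradient vanished at a limit
  point of a level set, it would vanish on the level set as well.\<close>

lemma grad_nonzero_closure_level_set:
  fixes \<phi> :: "real^'n \<Rightarrow> real"
  assumes U: "open U" and cv: "convex_on U \<phi>" and C2: "C2_ext U U \<phi>" and P: "closure P \<subseteq> U"
    and lev: "\<And>x. x \<in> P \<Longrightarrow> \<phi> x = c" and nz: "\<And>x. x \<in> P \<Longrightarrow> grad \<phi> x \<noteq> 0" and x: "x \<in> closure P"
  shows "grad \<phi> x \<noteq> 0"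
proof
  assume 0: "grad \<phi> x = 0"
  have xU: "x \<in> U" using x P by blast
  have diff: "\<phi> differentiable (at y)" if "y \<in> U" for y using C2_ext_D(7)[OF C2 that] .
  have cont: "continuous_on (closure P) \<phi>"
    by (rule continuous_on_subset[OF _ P]) (use C2_ext_D(1)[OF C2] in \<open>simp add: C0_ext_self_iff\<close>)
  have "(\<phi> has_derivative (\<lambda>h. 0)) (at x)" using has_derivative_grad[OF diff[OF xU]] 0 by simp
  then have min: "\<phi> x \<le> \<phi> y" if "y \<in> U" for y by (rule convex_critical_point_min[OF cv xU that])
  have "\<phi> x = c" by (rule continuous_constant_on_closure[OF cont lev x])
  obtain y where y: "y \<in> P" using x by (metis closure_empty all_not_in_conv)
  have yU: "y \<in> U" using y P closure_subset by blast
  have "(\<lambda>h. grad \<phi> y \<bullet> h) = (\<lambda>h. 0)"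
    by (rule differential_zero_maxmin[OF yU U has_derivative_grad[OF diff[OF yU]]])
      (use min \<open>\<phi> x = c\<close> lev[OF y] in auto)
  then have "grad \<phi> y \<bullet> grad \<phi> y = 0" by (rule fun_cong)
  then show False using nz[OF y] by simp
qed

lemma unit_normal_field_C1:
  fixes \<phi> :: "real^'n \<Rightarrow> real"
  assumes U: "open U" and C2: "C2_ext U U \<phi>"
  defines "W \<equiv> {x \<in> U. grad \<phi> x \<noteq> 0}"
  shows "open W" "C1_ext W W (\<lambda>x. unit_normal_field \<phi> x $ j)"
proof -
  have gc: "continuous_on U (grad \<phi>)" using C2_ext_D(2)[OF C2] by (simp add: C0_ext_self_iff)
  have "W = U \<inter> grad \<phi> -` (- {0})" by (auto simp: W_def)
  then show oW: "open W"
    using continuous_open_preimage[OF gc U open_Compl[OF closed_singleton[of 0]]] by simp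
  have WU: "W \<subseteq> U" by (auto simp: W_def)
  have g: "C1_ext W W (\<lambda>x. grad \<phi> x $ i)" for i
    by (rule C1_ext_subset[OF _ WU]) (use C2 in \<open>simp add: C2_ext_def\<close>)
  define q where "q x = (\<Sum>i\<in>UNIV. (grad \<phi> x $ i) * (grad \<phi> x $ i))" for x
  have q: "C1_ext W W q" unfolding q_def[abs_def] by (intro C1_ext_sum C1_ext_mult g)
  have qn: "sqrt (q x) = norm (grad \<phi> x)" for x by (simp add: q_def norm_eq_sqrt_inner inner_vec_def)
  have q0: "q x \<in> {0<..}" if "x \<in> W" for x
  proof -
    have "q x = (norm (grad \<phi> x))\<^sup>2" by (simp add: q_def power2_norm_eq_inner inner_vec_def)
    then show ?thesis using that by (simp add: W_def)
  qed
  have "C1_ext W W (\<lambda>x. inverse (sqrt (q x)))"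
  proof (rule C1_ext_compose[OF q order_refl _ q0])
    show "continuous_on W q" using q by (simp add: C1_ext_def C0_ext_self_iff)
    show "((\<lambda>t. inverse (sqrt t)) has_real_derivative - (inverse (sqrt t) * (inverse (sqrt t) / 2) * inverse (sqrt t))) (at t)"
      if "t \<in> {0<..}" for t
    proof (rule DERIV_inverse')
      show "(sqrt has_real_derivative inverse (sqrt t) / 2) (at t)" using that by (intro DERIV_real_sqrt) simp
    qed (use that in simp)
    show "continuous_on {0<..} (\<lambda>t. - (inverse (sqrt t) * (inverse (sqrt t) / 2) * inverse (sqrt t)))"
      by (intro continuous_intros) auto
  qed simp_all
  then have "C1_ext W W (\<lambda>x. inverse (sqrt (q x)) * (grad \<phi> x $ j))" by (intro C1_ext_mult g)
  then show "C1_ext W W (\<lambda>x. unit_normal_field \<phi> x $ j)"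
    by (simp add: unit_normal_field_def qn)
qed

locale dg_mesh =
  fixes D :: "'n::finite piecewise_domain" and T :: "'n mesh" and k :: degree_kind and p :: nat and \<alpha> :: real
  assumes domain: "piecewise_C2_convex_domain \<alpha> D"
    and mesh: "exact_mesh (region D) T"
    and faces_in_pieces: "\<And>F. F \<in> bfaces T \<Longrightarrow> \<exists>n\<in>{1..num_pieces D}. face_set F \<subseteq> closure (piece D n)"
begin

abbreviation V :: "(real^'n \<Rightarrow> real) set" where "V \<equiv> dg_space (region D) T k p"

fun sides :: "'n face \<Rightarrow> (real^'n) set set" where
  "sides (IFace K K') = {K, K'}"
| "sides (BFace K S) = {K}"

lemmas V_closed = dg_space_lincomb_closed[of "region D" T k p]

lemma V_C2: "v \<in> V \<Longrightarrow> K \<in> elems T \<Longrightarrow> C2_ext K (closure K) v"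
  by (rule dg_space_C2_ext[OF mesh])

lemmas elem = exact_mesh_elem[OF mesh]

lemma iface_cases:
  assumes "F \<in> ifaces T"
  obtains K K' where "F = IFace K K'" "K \<in> elems T" "K' \<in> elems T" "K \<noteq> K'"
    "emeasure surf_measure (closure K \<inter> closure K') > 0"
    "flat_outward_normal K (closure K \<inter> closure K') (nF D F x)"
proof -
  have "interior_faces_of T" using mesh by (simp add: exact_mesh_def)
  then have "\<forall>F\<in>ifaces T. \<exists>K\<in>elems T. \<exists>K'\<in>elems T. F = IFace K K' \<and> K \<noteq> K' \<and>
      emeasure surf_measure (closure K \<inter> closure K') > 0 \<and>
      (\<exists>n. flat_outward_normal K (closure K \<inter> closure K') n)"
    unfolding interior_faces_of_def by (rule conjunct1)
  from bspec[OF this assms] obtain K K' n where *: "F = IFace K K'" "K \<in> elems T" "K' \<in> elems T" "K \<noteq> K'"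
    "emeasure surf_measure (closure K \<inter> closure K') > 0" "flat_outward_normal K (closure K \<inter> closure K') n"
    by (elim bexE conjE exE)
  have "flat_outward_normal K (closure K \<inter> closure K') (nF D F x)"
    unfolding *(1) nF.simps by (rule someI, rule *(6))
  with *(1-5) show ?thesis by (rule that)
qed

lemma bface_cases:
  assumes "F \<in> bfaces T"
  obtains K S where "F = BFace K S" "K \<in> elems T" "closed S" "S \<subseteq> frontier K \<inter> frontier (region D)"
    "hausdorff_outer (CARD('n) - 1) S < \<infinity>" "emeasure surf_measure S > 0"
proof -
  have "boundary_faces_of (region D) T" using mesh by (simp add: exact_mesh_def)
  then have "\<forall>F\<in>bfaces T. \<exists>K\<in>elems T. \<exists>S. F = BFace K S \<and> closed S \<and>
        S \<subseteq> frontier K \<inter> frontier (region D) \<and>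
        (\<exists>R. R facet_of closure (refel T) \<and> S \<subseteq> elem_map T K ` R) \<and> emeasure surf_measure S > 0"
    unfolding boundary_faces_of_def by (elim conjE)
  from bspec[OF this assms] obtain K S R where *: "F = BFace K S" "K \<in> elems T" "closed S"
    "S \<subseteq> frontier K \<inter> frontier (region D)"
    "R facet_of closure (refel T)" "S \<subseteq> elem_map T K ` R" "emeasure surf_measure S > 0"
    by (elim bexE conjE exE)
  show ?thesis
    by (rule that[OF *(1-4) facet_image_hausdorff_finite[OF mesh *(2,5,6)] *(7)])
qed

lemma finite_ifaces: "finite (ifaces T)"
proof -
  have "finite (elems T)" using mesh by (simp add: exact_mesh_def)
  moreover have "ifaces T \<subseteq> (\<lambda>(K, K'). IFace K K') ` (elems T \<times> elems T)"
  proof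
    fix F assume "F \<in> ifaces T"
    then show "F \<in> (\<lambda>(K, K'). IFace K K') ` (elems T \<times> elems T)" by (rule iface_cases) auto
  qed
  ultimately show ?thesis by (meson finite_SigmaI finite_imageI finite_subset)
qed

lemma finite_faces: "finite (faces T)"
  using finite_ifaces mesh by (simp add: faces_def exact_mesh_def boundary_faces_of_def)

lemma face_facts:
  assumes "F \<in> faces T"
  shows "compact (face_set F)" "hausdorff_outer (CARD('n) - 1) (face_set F) < \<infinity>"
    "emeasure surf_measure (face_set F) > 0"
    "\<And>K. K \<in> sides F \<Longrightarrow> K \<in> elems T \<and> face_set F \<subseteq> closure K"
proof -
  have "compact (face_set F) \<and> hausdorff_outer (CARD('n) - 1) (face_set F) < \<infinity> \<and>
    emeasure surf_measure (face_set F) > 0 \<and> (\<forall>K\<in>sides F. K \<in> elems T \<and> face_set F \<subseteq> closure K)"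
  proof (cases "F \<in> ifaces T")
    case True
    then obtain K K' where F: "F = IFace K K'" "K \<in> elems T" "K' \<in> elems T"
      "emeasure surf_measure (closure K \<inter> closure K') > 0"
      "flat_outward_normal K (closure K \<inter> closure K') (nF D F 0)"
      using iface_cases by metis
    have cl: "compact (closure K)" using elem(3)[OF F(2)] by (simp add: compact_closure)
    then have c: "compact (closure K \<inter> closure K')" by (simp add: compact_Int_closed)
    obtain c where n: "norm (nF D F 0) = 1" "closure K \<inter> closure K' \<subseteq> {x. nF D F 0 \<bullet> x = c}"
      using F(5) unfolding flat_outward_normal_def by blast
    have "nF D F 0 \<noteq> 0" using n(1) by force
    from hausdorff_outer_lipschitz_hyperplane_finite[OF this n(2) compact_imp_bounded[OF c], of 1 "\<lambda>x. x"]
    have "hausdorff_outer (CARD('n) - 1) (closure K \<inter> closure K') < \<infinity>" by (simp add: lipschitz_on_id)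
    then show ?thesis using F c by simp
  next
    case False
    then have "F \<in> bfaces T" using assms by (simp add: faces_def)
    then obtain K S where F: "F = BFace K S" "K \<in> elems T" "closed S" "S \<subseteq> frontier K \<inter> frontier (region D)"
      "hausdorff_outer (CARD('n) - 1) S < \<infinity>" "emeasure surf_measure S > 0"
      using bface_cases by metis
    have SK: "S \<subseteq> closure K" using F(4) by (auto simp: frontier_def)
    have "bounded (closure K)" using elem(3)[OF F(2)] by (rule bounded_closure)
    then have "compact S" using F(3) SK by (metis bounded_subset compact_eq_bounded_closed)
    then show ?thesis using F SK by simp
  qed
  then show "compact (face_set F)" "hausdorff_outer (CARD('n) - 1) (face_set F) < \<infinity>"
    "emeasure surf_measure (face_set F) > 0"
    "\<And>K. K \<in> sides F \<Longrightarrow> K \<in> elems T \<and> face_set F \<subseteq> closure K" by auto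
qed

lemma normal_field:
  assumes "F \<in> faces T"
  obtains W where "open W" "face_set F \<subseteq> W" "\<And>j. C1_ext W W (\<lambda>x. nF D F x $ j)"
    "\<And>x. x \<in> face_set F \<Longrightarrow> norm (nF D F x) = 1"
proof (cases "F \<in> ifaces T")
  case True
  then obtain K K' where F: "F = IFace K K'" "flat_outward_normal K (closure K \<inter> closure K') (nF D F 0)"
    using iface_cases by metis
  have const: "nF D F x = nF D F 0" for x by (simp add: F(1))
  have C1: "C1_ext UNIV UNIV (\<lambda>x. nF D F x $ j)" for j by (subst const) (rule C1_ext_const)
  have "norm (nF D F x) = 1" for x using F(2) by (subst const) (simp add: flat_outward_normal_def)
  then show ?thesis using that[of UNIV] C1 by simp
next
  case False
  then have b: "F \<in> bfaces T" using assms by (simp add: faces_def)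
  then obtain K S where F: "F = BFace K S" using bface_cases by metis
  define n where "n = (SOME n. n \<in> {1..num_pieces D} \<and> S \<subseteq> closure (piece D n))"
  have "n \<in> {1..num_pieces D} \<and> S \<subseteq> closure (piece D n)"
    unfolding n_def by (rule someI_ex) (use faces_in_pieces[OF b] F in auto)
  then have n: "n \<in> {1..num_pieces D}" "S \<subseteq> closure (piece D n)" by auto
  have nF: "nF D F = unit_normal_field (level_fun D n)" by (simp add: F n_def)
  let ?U = "level_nbhd D n" and ?\<phi> = "level_fun D n" and ?P = "piece D n"
  have dn: "open ?U" "closure ?P \<subseteq> ?U" "convex_on ?U ?\<phi>" "C2_holder_on \<alpha> ?U ?\<phi>"
    "\<exists>c. \<forall>x\<in>?P. ?\<phi> x = c" "\<forall>x\<in>?P. outward_unit_normal (region D) x (unit_normal_field ?\<phi> x)"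
    using domain n(1) unfolding piecewise_C2_convex_domain_def by simp_all
  obtain c where c: "\<And>x. x \<in> ?P \<Longrightarrow> ?\<phi> x = c" using dn(5) by blast
  have C2: "C2_ext ?U ?U ?\<phi>" using dn(4) C2_derivs_on_open[OF dn(1)] unfolding C2_holder_on_def by blast
  have nz: "grad ?\<phi> x \<noteq> 0" if "x \<in> ?P" for x
  proof
    assume "grad ?\<phi> x = 0"
    then have "norm (unit_normal_field ?\<phi> x) = 0" by (simp add: unit_normal_field_def)
    moreover have "norm (unit_normal_field ?\<phi> x) = 1" using dn(6) that by (simp add: outward_unit_normal_def)
    ultimately show False by simp
  qed
  have nz': "grad ?\<phi> x \<noteq> 0" if "x \<in> closure ?P" for x
    by (rule grad_nonzero_closure_level_set[OF dn(1,3) C2 dn(2) c nz that])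
  show ?thesis
  proof (rule that[OF unit_normal_field_C1(1)[OF dn(1) C2]])
    show "face_set F \<subseteq> {x \<in> ?U. grad ?\<phi> x \<noteq> 0}"
    proof
      fix x assume "x \<in> face_set F"
      then have "x \<in> closure ?P" using n(2) by (auto simp: F)
      then show "x \<in> {x \<in> ?U. grad ?\<phi> x \<noteq> 0}" using dn(2) nz' by blast
    qed
    show "C1_ext {x \<in> ?U. grad ?\<phi> x \<noteq> 0} {x \<in> ?U. grad ?\<phi> x \<noteq> 0} (\<lambda>x. nF D F x $ j)" for j
      unfolding nF by (rule unit_normal_field_C1(2)[OF dn(1) C2])
    show "norm (nF D F x) = 1" if "x \<in> face_set F" for x
    proof -
      have "x \<in> closure ?P" using that n(2) by (auto simp: F)
      from nz'[OF this] show ?thesis by (simp add: nF unit_normal_field_def)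
    qed
  qed
qed

lemma normal_field_continuous:
  assumes "F \<in> faces T"
  shows "continuous_on (face_set F) (nF D F)"
    "continuous_on (face_set F) (grad (\<lambda>y. nF D F y $ j))"
    "continuous_on (face_set F) (\<lambda>x. jac (nF D F) x)"
    "continuous_on (face_set F) (mean_curv D F)"
proof -
  obtain W where W: "open W" "face_set F \<subseteq> W" "\<And>j. C1_ext W W (\<lambda>x. nF D F x $ j)"
    using normal_field[OF assms] by metis
  have c0: "continuous_on (face_set F) (\<lambda>x. nF D F x $ j)" for j
    by (rule continuous_on_subset[OF _ W(2)]) (use W(3)[of j] in \<open>simp add: C1_ext_def C0_ext_self_iff\<close>)
  have c1: "continuous_on (face_set F) (\<lambda>x. grad (\<lambda>y. nF D F y $ j) x $ i)" for i j
    by (rule continuous_on_subset[OF _ W(2)]) (use W(3)[of j] in \<open>simp add: C1_ext_def C0_ext_self_iff\<close>)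
  have "continuous_on (face_set F) (\<lambda>x. \<chi> j. nF D F x $ j)" by (rule continuous_on_vec_lambda) (rule c0)
  then show "continuous_on (face_set F) (nF D F)" by (simp add: vec_lambda_eta)
  have "continuous_on (face_set F) (\<lambda>x. \<chi> i. grad (\<lambda>y. nF D F y $ j) x $ i)"
    by (rule continuous_on_vec_lambda) (rule c1)
  then show "continuous_on (face_set F) (grad (\<lambda>y. nF D F y $ j))" by (simp add: vec_lambda_eta)
  show "continuous_on (face_set F) (\<lambda>x. jac (nF D F) x)"
    unfolding jac_def by (rule continuous_on_vec_lambda, rule continuous_on_vec_lambda) (rule c1)
  show "continuous_on (face_set F) (mean_curv D F)"
    unfolding mean_curv_def[abs_def] trace_def jac_def vec_lambda_beta by (rule continuous_on_sum) (rule c1)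
qed

lemma cont_lin_tr_val: "K \<in> elems T \<Longrightarrow> cont_lin (closure K) V (\<lambda>u. tr K u)"
proof (rule cont_lin_tr[OF elem(1) V_closed])
  show "C0_ext K (closure K) u" if "u \<in> V" "K \<in> elems T" for u using C2_ext_D(1)[OF V_C2[OF that]] .
qed simp_all

lemma cont_lin_tr_grad:
  assumes K: "K \<in> elems T"
  shows "cont_lin (closure K) V (\<lambda>u. tr K (grad u))"
proof (rule cont_lin_tr[OF elem(1)[OF K] V_closed])
  show "C0_ext K (closure K) (grad u)" if "u \<in> V" for u by (rule C2_ext_D(2)[OF V_C2[OF that K]])
  show "grad (\<lambda>y. a * u y + b * v y) x = a *\<^sub>R grad u x + b *\<^sub>R grad v x"
    if "u \<in> V" "v \<in> V" "x \<in> K" for u v a b x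
    by (rule grad_lincomb) (rule C2_ext_D(7)[OF V_C2[OF _ K]]; fact)+
qed

lemma cont_lin_tr_grad_grad:
  assumes K: "K \<in> elems T"
  shows "cont_lin (closure K) V (\<lambda>u. tr K (grad (\<lambda>y. grad u y $ j)))"
proof (rule cont_lin_tr[OF elem(1)[OF K] V_closed])
  show "C0_ext K (closure K) (grad (\<lambda>y. grad u y $ j))" if "u \<in> V" for u by (rule C2_ext_D(4)[OF V_C2[OF that K]])
  show "grad (\<lambda>y. grad (\<lambda>y. a * u y + b * v y) y $ j) x
      = a *\<^sub>R grad (\<lambda>y. grad u y $ j) x + b *\<^sub>R grad (\<lambda>y. grad v y $ j) x"
    if "u \<in> V" "v \<in> V" "x \<in> K" for u v a b x
    using C2_ext_D(7,8)[OF V_C2[OF that(1) K]] C2_ext_D(7,8)[OF V_C2[OF that(2) K]] \<open>x \<in> K\<close>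
    by (intro grad_lincomb_open[OF elem(1)[OF K] \<open>x \<in> K\<close>]) simp_all
qed

lemma cont_lin_inner:
  fixes Q :: "(real^'n \<Rightarrow> real) \<Rightarrow> real^'n \<Rightarrow> real^'n"
  assumes "cont_lin S X Q" "continuous_on S \<nu>"
  shows "cont_lin S X (\<lambda>u x. Q u x \<bullet> \<nu> x)"
  by (rule cont_lin_apply[OF assms(1)])
    (use assms(2) in \<open>auto intro!: continuous_on_inner linearI simp: inner_add_left\<close>)

lemma cont_lin_scaleR:
  fixes Q :: "(real^'n \<Rightarrow> real) \<Rightarrow> real^'n \<Rightarrow> 'b::real_normed_vector"
  assumes "cont_lin S X Q" "continuous_on S g"
  shows "cont_lin S X (\<lambda>u x. g x *\<^sub>R Q u x)"
  by (rule cont_lin_apply[OF assms(1)])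
    (use assms(2) in \<open>auto intro!: continuous_on_scaleR linearI simp: scaleR_add_right\<close>)

lemma cont_lin_scaleR_vec:
  fixes Q :: "(real^'n \<Rightarrow> real) \<Rightarrow> real^'n \<Rightarrow> real"
  assumes "cont_lin S X Q" "continuous_on S g"
  shows "cont_lin S X (\<lambda>u x. Q u x *\<^sub>R (g x :: real^'n))"
  by (rule cont_lin_apply[OF assms(1)])
    (use assms(2) in \<open>auto intro!: continuous_on_scaleR linearI simp: scaleR_add_left\<close>)

lemma cont_lin_tangent:
  fixes Q :: "(real^'n \<Rightarrow> real) \<Rightarrow> real^'n \<Rightarrow> real^'n"
  assumes "cont_lin S X Q" "continuous_on S \<nu>"
  shows "cont_lin S X (\<lambda>u x. Q u x - (Q u x \<bullet> \<nu> x) *\<^sub>R \<nu> x)"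
  by (intro cont_lin_diff assms(1) cont_lin_scaleR_vec cont_lin_inner assms(2))

lemma cont_lin_jump:
  fixes S :: "(real^'n) set"
  assumes "\<And>K. K \<in> sides F \<Longrightarrow> cont_lin S X (q K)"
  shows "cont_lin S X (\<lambda>u x. jump F (\<lambda>K. q K u x))"
  using assms by (cases F) (simp_all add: cont_lin_diff)

lemma cont_lin_avg:
  fixes S :: "(real^'n) set"
  assumes "\<And>K. K \<in> sides F \<Longrightarrow> cont_lin S X (q K)"
  shows "cont_lin S X (\<lambda>u x. avg F (\<lambda>K. q K u x))"
proof (cases F)
  case (IFace K K')
  then have c: "cont_lin S X (q K)" "cont_lin S X (q K')" using assms by simp_all
  have "cont_lin S X (\<lambda>u x. (1/2) *\<^sub>R (q K u x + q K' u x))"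
    by (intro cont_lin_scaleR continuous_on_const cont_lin_add c)
  then show ?thesis by (simp add: IFace)
next
  case (BFace K S)
  then show ?thesis using assms by simp
qed

lemma cont_lin_face_grad:
  assumes F: "F \<in> faces T" and K: "K \<in> sides F"
  shows "cont_lin (face_set F) V (\<lambda>u. tr K (grad u))"
  using cont_lin_mono[OF cont_lin_tr_grad] face_facts(4)[OF F K] by blast

lemma cont_lin_jump_val: "F \<in> faces T \<Longrightarrow> cont_lin (face_set F) V (jump_val F)"
  unfolding jump_val_def[abs_def]
  by (rule cont_lin_jump) (use cont_lin_mono[OF cont_lin_tr_val] face_facts(4) in blast)

lemma cont_lin_jump_nderiv: "F \<in> faces T \<Longrightarrow> cont_lin (face_set F) V (jump_nderiv D F)"
  unfolding jump_nderiv_def[abs_def]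
  by (rule cont_lin_jump) (intro cont_lin_inner cont_lin_face_grad normal_field_continuous(1))

lemma cont_lin_tan_grad:
  assumes F: "F \<in> faces T" and Q: "cont_lin (face_set F) V (\<lambda>u. tr K (grad (w u)))"
  shows "cont_lin (face_set F) V (\<lambda>u x. tan_grad K (w u) (nF D F x) x)"
proof -
  have n: "norm (nF D F x) = 1" if "x \<in> face_set F" for x using normal_field[OF F] that by metis
  show ?thesis
    by (rule cont_lin_cong[OF cont_lin_tangent[OF Q normal_field_continuous(1)[OF F]] _ V_closed])
      (simp add: tan_grad_eq n)
qed

lemma cont_lin_jump_tgrad: "F \<in> faces T \<Longrightarrow> cont_lin (face_set F) V (jump_tgrad D F)"
  unfolding jump_tgrad_def[abs_def]
  by (rule cont_lin_jump) (intro cont_lin_tan_grad cont_lin_face_grad)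

lemma cont_lin_grad_field:
  assumes S: "S \<subseteq> closure K" "S \<subseteq> W" and K: "K \<in> elems T" and W: "open W" and \<nu>: "\<And>j. C1_ext W W (\<lambda>y. \<nu> y $ j)"
  shows "cont_lin S V (\<lambda>u. tr K (grad (\<lambda>y. grad u y \<bullet> \<nu> y)))"
proof -
  have c: "continuous_on S (\<lambda>x. \<nu> x $ j)" "continuous_on S (grad (\<lambda>y. \<nu> y $ j))" for j
  proof -
    show "continuous_on S (\<lambda>x. \<nu> x $ j)"
      by (rule continuous_on_subset[OF _ S(2)]) (use \<nu>[of j] in \<open>simp add: C1_ext_def C0_ext_self_iff\<close>)
    have "continuous_on S (\<lambda>x. grad (\<lambda>y. \<nu> y $ j) x $ i)" for i
      by (rule continuous_on_subset[OF _ S(2)]) (use \<nu>[of j] in \<open>simp add: C1_ext_def C0_ext_self_iff\<close>)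
    then have "continuous_on S (\<lambda>x. \<chi> i. grad (\<lambda>y. \<nu> y $ j) x $ i)" by (rule continuous_on_vec_lambda)
    then show "continuous_on S (grad (\<lambda>y. \<nu> y $ j))" by (simp add: vec_lambda_eta)
  qed
  have g: "cont_lin S V (\<lambda>u x. tr K (grad u) x $ j)" for j
    by (rule cont_lin_apply[OF cont_lin_mono[OF cont_lin_tr_grad[OF K] S(1)]])
      (auto intro!: linearI continuous_on_component)
  have "cont_lin S V (\<lambda>u x. \<Sum>j\<in>UNIV. (\<nu> x $ j) *\<^sub>R tr K (grad (\<lambda>y. grad u y $ j)) x
      + (tr K (grad u) x $ j) *\<^sub>R grad (\<lambda>y. \<nu> y $ j) x)"
    by (intro cont_lin_sum cont_lin_add cont_lin_scaleR cont_lin_scaleR_vec g c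
      cont_lin_mono[OF cont_lin_tr_grad_grad[OF K] S(1)])
  then show ?thesis
  proof (rule cont_lin_cong[OF _ _ V_closed])
    fix u x assume "u \<in> V" "x \<in> S"
    then show "(\<Sum>j\<in>UNIV. (\<nu> x $ j) *\<^sub>R tr K (grad (\<lambda>y. grad u y $ j)) x
      + (tr K (grad u) x $ j) *\<^sub>R grad (\<lambda>y. \<nu> y $ j) x) = tr K (grad (\<lambda>y. grad u y \<bullet> \<nu> y)) x"
      by (intro tr_grad_inner_field[OF elem(1)[OF K] V_C2[OF _ K] W \<nu>, symmetric]) (use S in auto)
  qed
qed

lemma cont_lin_tgrad_avg_nderiv:
  assumes F: "F \<in> faces T"
  shows "cont_lin (face_set F) V (tgrad_avg_nderiv D F)"
  unfolding tgrad_avg_nderiv_def[abs_def]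
proof (intro cont_lin_avg cont_lin_tan_grad F)
  fix K assume K: "K \<in> sides F"
  obtain W where "open W" "face_set F \<subseteq> W" "\<And>j. C1_ext W W (\<lambda>x. nF D F x $ j)"
    using normal_field[OF F] by metis
  then show "cont_lin (face_set F) V (\<lambda>u. tr K (grad (\<lambda>y. grad u y \<bullet> nF D F y)))"
    using face_facts(4)[OF F K] by (intro cont_lin_grad_field) auto
qed

lemma cont_lin_tdivgrad_avg:
  assumes F: "F \<in> ifaces T"
  shows "cont_lin (face_set F) V (tdivgrad_avg D F)"
proof -
  have F': "F \<in> faces T" using F by (simp add: faces_def)
  have const: "nF D F x = nF D F 0" for x using iface_cases[OF F] by (metis nF.simps(1))
  show ?thesis
    unfolding tdivgrad_avg_def[abs_def] tan_div_grad_def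
  proof (subst const, intro cont_lin_avg cont_lin_sum cont_lin_inner continuous_on_const)
    fix K t assume "K \<in> sides F"
    then show "cont_lin (face_set F) V (\<lambda>u. tr K (grad (\<lambda>y. grad u y \<bullet> t)))"
      using face_facts(4)[OF F', of K] by (intro cont_lin_grad_field[of _ _ UNIV "\<lambda>_. t"] C1_ext_const) auto
  qed
qed

end

definition lin_op :: "'a measure \<Rightarrow> ('c \<Rightarrow> real) set \<Rightarrow> (('c \<Rightarrow> real) \<Rightarrow> 'a \<Rightarrow> 'b::euclidean_space) \<Rightarrow> bool" where
  "lin_op M X Q \<longleftrightarrow> finite_measure M \<and>
     (\<forall>u\<in>X. Q u \<in> borel_measurable M \<and> (\<exists>C. AE x in M. norm (Q u x) \<le> C)) \<and>
     (\<forall>u\<in>X. \<forall>v\<in>X. \<forall>a b. AE x in M. Q (\<lambda>y. a * u y + b * v y) x = a *\<^sub>R Q u x + b *\<^sub>R Q v x)"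

lemma lin_op_integrable:
  fixes P Q :: "('c \<Rightarrow> real) \<Rightarrow> 'a \<Rightarrow> 'b::euclidean_space"
  assumes P: "lin_op M X P" and Q: "lin_op M X Q" and uv: "u \<in> X" "v \<in> X"
  shows "integrable M (\<lambda>x. P u x \<bullet> Q v x)"
proof -
  obtain C where C: "AE x in M. norm (P u x) \<le> C" using P uv unfolding lin_op_def by blast
  obtain C' where C': "AE x in M. norm (Q v x) \<le> C'" using Q uv unfolding lin_op_def by blast
  have m: "P u \<in> borel_measurable M" "Q v \<in> borel_measurable M" "finite_measure M"
    using P Q uv unfolding lin_op_def by blast+
  have "AE x in M. norm (P u x \<bullet> Q v x) \<le> C * C'"
    using C C'
  proof eventually_elim
    case (elim x)
    have "norm (P u x \<bullet> Q v x) \<le> norm (P u x) * norm (Q v x)" by (simp add: Cauchy_Schwarz_ineq2)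
    also have "\<dots> \<le> C * C'" using elim by (intro mult_mono) (auto intro: order_trans[OF norm_ge_zero])
    finally show ?case .
  qed
  then show ?thesis
    by (rule finite_measure.integrable_const_bound[OF m(3)]) (intro borel_measurable_inner m)
qed

lemma bilin_integral:
  fixes P Q :: "('c \<Rightarrow> real) \<Rightarrow> 'a \<Rightarrow> 'b::euclidean_space"
  assumes X: "lincomb_closed X" and P: "lin_op M X P" and Q: "lin_op M X Q"
  shows "bilin X (\<lambda>u v. \<integral>x. P u x \<bullet> Q v x \<partial>M)"
proof -
  note int = lin_op_integrable[OF P Q]
  have meas: "P u \<in> borel_measurable M" "Q u \<in> borel_measurable M" if "u \<in> X" for u
    using P Q that unfolding lin_op_def by blast+
  have A: "(\<integral>x. P (\<lambda>y. a * u y + b * v y) x \<bullet> Q w x \<partial>M) = a * (\<integral>x. P u x \<bullet> Q w x \<partial>M) + b * (\<integral>x. P v x \<bullet> Q w x \<partial>M)"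
    if "u \<in> X" "v \<in> X" "w \<in> X" for u v w a b
  proof -
    have "(\<integral>x. P (\<lambda>y. a * u y + b * v y) x \<bullet> Q w x \<partial>M) = (\<integral>x. a * (P u x \<bullet> Q w x) + b * (P v x \<bullet> Q w x) \<partial>M)"
    proof (rule integral_cong_AE)
      have "AE x in M. P (\<lambda>y. a * u y + b * v y) x = a *\<^sub>R P u x + b *\<^sub>R P v x"
        using P that unfolding lin_op_def by blast
      then show "AE x in M. P (\<lambda>y. a * u y + b * v y) x \<bullet> Q w x = a * (P u x \<bullet> Q w x) + b * (P v x \<bullet> Q w x)"
        by eventually_elim (simp add: inner_add_left)
    qed (use meas[OF that(1)] meas[OF that(2)] meas[OF that(3)] meas[OF lincomb_closedD[OF X that(1,2)]] in measurable)
    also have "\<dots> = a * (\<integral>x. P u x \<bullet> Q w x \<partial>M) + b * (\<integral>x. P v x \<bullet> Q w x \<partial>M)"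
      using int that by simp
    finally show ?thesis .
  qed
  have B: "(\<integral>x. P w x \<bullet> Q (\<lambda>y. a * u y + b * v y) x \<partial>M) = a * (\<integral>x. P w x \<bullet> Q u x \<partial>M) + b * (\<integral>x. P w x \<bullet> Q v x \<partial>M)"
    if "u \<in> X" "v \<in> X" "w \<in> X" for u v w a b
  proof -
    have "(\<integral>x. P w x \<bullet> Q (\<lambda>y. a * u y + b * v y) x \<partial>M) = (\<integral>x. a * (P w x \<bullet> Q u x) + b * (P w x \<bullet> Q v x) \<partial>M)"
    proof (rule integral_cong_AE)
      have "AE x in M. Q (\<lambda>y. a * u y + b * v y) x = a *\<^sub>R Q u x + b *\<^sub>R Q v x"
        using Q that unfolding lin_op_def by blast
      then show "AE x in M. P w x \<bullet> Q (\<lambda>y. a * u y + b * v y) x = a * (P w x \<bullet> Q u x) + b * (P w x \<bullet> Q v x)"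
        by eventually_elim (simp add: inner_add_right)
    qed (use meas[OF that(1)] meas[OF that(2)] meas[OF that(3)] meas[OF lincomb_closedD[OF X that(1,2)]] in measurable)
    also have "\<dots> = a * (\<integral>x. P w x \<bullet> Q u x \<partial>M) + b * (\<integral>x. P w x \<bullet> Q v x \<partial>M)"
      using int that by simp
    finally show ?thesis .
  qed
  show ?thesis unfolding bilin_def lin_functional_def using A B by blast
qed

lemma bilin_swap: "bilin X B \<Longrightarrow> bilin X (\<lambda>u v. B v u)"
  by (simp add: bilin_def)

lemma bilin_add: "bilin X A \<Longrightarrow> bilin X B \<Longrightarrow> bilin X (\<lambda>u v. A u v + B u v)"
  by (simp add: bilin_def lin_functional_def algebra_simps)

lemma bilin_diff: "bilin X A \<Longrightarrow> bilin X B \<Longrightarrow> bilin X (\<lambda>u v. A u v - B u v)"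
  by (simp add: bilin_def lin_functional_def algebra_simps)

lemma bilin_scale: "bilin X A \<Longrightarrow> bilin X (\<lambda>u v. c * A u v)"
  by (simp add: bilin_def lin_functional_def algebra_simps)

lemma bilin_sum:
  assumes "\<And>i. i \<in> I \<Longrightarrow> bilin X (A i)"
  shows "bilin X (\<lambda>u v. \<Sum>i\<in>I. A i u v)"
  using assms
proof (induction I rule: infinite_finite_induct)
  case (insert i I)
  then show ?case by (simp add: bilin_add)
qed (simp_all add: bilin_def lin_functional_def)

lemma lin_op_face:
  fixes Q :: "(real^'n::finite \<Rightarrow> real) \<Rightarrow> real^'n \<Rightarrow> 'b::euclidean_space"
  assumes S: "compact S" and fin: "hausdorff_outer (CARD('n) - 1) S < \<infinity>" and Q: "cont_lin S X Q"
  shows "lin_op (restrict_space surf_measure S) X Q"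
proof -
  have sp: "space (restrict_space (surf_measure :: (real^'n) measure) S) = S" by (simp add: space_restrict_space)
  have Sb: "S \<in> sets borel" using S by (simp add: borel_closed compact_imp_closed)
  have "emeasure surf_measure S < \<infinity>"
    using emeasure_hausdorff_measure_le[of "CARD('n) - 1" S] fin by (rule le_less_trans)
  then have "finite_measure (restrict_space (surf_measure :: (real^'n) measure) S)"
    using Sb by (intro finite_measureI) (simp add: sp emeasure_restrict_space)
  moreover have "Q u \<in> borel_measurable (restrict_space surf_measure S) \<and>
      (\<exists>C. AE x in restrict_space surf_measure S. norm (Q u x) \<le> C)" if "u \<in> X" for u
  proof
    have c: "continuous_on S (Q u)" using Q that by (simp add: cont_lin_def)
    have "sets (restrict_space surf_measure S) = sets (restrict_space (borel :: (real^'n) measure) S)"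
      by (rule sets_restrict_space_cong) simp
    then show "Q u \<in> borel_measurable (restrict_space surf_measure S)"
      using borel_measurable_continuous_on_restrict[OF c] measurable_cong_sets by blast
    have "bounded (Q u ` S)" by (rule compact_imp_bounded[OF compact_continuous_image[OF c S]])
    then obtain C where "\<And>x. x \<in> S \<Longrightarrow> norm (Q u x) \<le> C" unfolding bounded_iff by auto
    then show "\<exists>C. AE x in restrict_space surf_measure S. norm (Q u x) \<le> C"
      by (intro exI[of _ C] AE_I2) (simp only: sp)
  qed
  moreover have "AE x in restrict_space surf_measure S. Q (\<lambda>y. a * u y + b * v y) x = a *\<^sub>R Q u x + b *\<^sub>R Q v x"
    if "u \<in> X" "v \<in> X" for u v a b
  proof (rule AE_I2)
    fix x assume "x \<in> space (restrict_space (surf_measure :: (real^'n) measure) S)"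
    then have "x \<in> S" by (simp only: sp)
    then show "Q (\<lambda>y. a * u y + b * v y) x = a *\<^sub>R Q u x + b *\<^sub>R Q v x"
      using Q that unfolding cont_lin_def by blast
  qed
  ultimately show ?thesis unfolding lin_op_def by blast
qed

lemma lin_op_elem:
  fixes Q :: "(real^'n::finite \<Rightarrow> real) \<Rightarrow> real^'n \<Rightarrow> 'b::euclidean_space"
  assumes K: "open K" "bounded K" and C0: "\<And>u. u \<in> X \<Longrightarrow> C0_ext K (closure K) (Q u)"
    and lin: "\<And>u v a b x. u \<in> X \<Longrightarrow> v \<in> X \<Longrightarrow> x \<in> K \<Longrightarrow> Q (\<lambda>y. a * u y + b * v y) x = a *\<^sub>R Q u x + b *\<^sub>R Q v x"
  shows "lin_op (lebesgue_on K) X Q"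
proof -
  have "K \<in> lmeasurable" using K by (simp add: lmeasurable_open)
  then have "finite_measure (lebesgue_on K)" by (rule finite_measure_lebesgue_on)
  moreover have "Q u \<in> borel_measurable (lebesgue_on K) \<and> (\<exists>C. AE x in lebesgue_on K. norm (Q u x) \<le> C)"
    if u: "u \<in> X" for u
  proof
    show "Q u \<in> borel_measurable (lebesgue_on K)"
      using C0_ext_continuous_on[OF C0[OF u]] K by (intro continuous_imp_measurable_on_sets_lebesgue) auto
    obtain C where "\<And>x. x \<in> K \<Longrightarrow> norm (Q u x) \<le> C" using C0_ext_bounded[OF K(2) C0[OF u]] by blast
    then show "\<exists>C. AE x in lebesgue_on K. norm (Q u x) \<le> C"
      by (intro exI[of _ C] AE_I2) simp
  qed
  moreover have "AE x in lebesgue_on K. Q (\<lambda>y. a * u y + b * v y) x = a *\<^sub>R Q u x + b *\<^sub>R Q v x"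
    if "u \<in> X" "v \<in> X" for u v a b
    by (rule AE_I2) (use lin that in simp)
  ultimately show ?thesis unfolding lin_op_def by blast
qed

context dg_mesh
begin

lemma lin_op_hess: "K \<in> elems T \<Longrightarrow> lin_op (lebesgue_on K) V hess"
  and lin_op_laplacian: "K \<in> elems T \<Longrightarrow> lin_op (lebesgue_on K) V laplacian"
proof -
  assume K: "K \<in> elems T"
  have h: "hess (\<lambda>y. a * u y + b * v y) x = a *\<^sub>R hess u x + b *\<^sub>R hess v x"
    if "u \<in> V" "v \<in> V" "x \<in> K" for u v a b x
  proof -
    have "grad (\<lambda>y. grad (\<lambda>y. a * u y + b * v y) y $ j) x
      = a *\<^sub>R grad (\<lambda>y. grad u y $ j) x + b *\<^sub>R grad (\<lambda>y. grad v y $ j) x" for j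
      using C2_ext_D(7,8)[OF V_C2[OF that(1) K]] C2_ext_D(7,8)[OF V_C2[OF that(2) K]] \<open>x \<in> K\<close>
      by (intro grad_lincomb_open[OF elem(1)[OF K] \<open>x \<in> K\<close>]) simp_all
    then show ?thesis by (simp add: vec_eq_iff hess_def jac_def)
  qed
  show "lin_op (lebesgue_on K) V hess"
    by (rule lin_op_elem[OF elem(1,3)[OF K] C2_ext_D(5)[OF V_C2[OF _ K]] h])
  have l: "laplacian (\<lambda>y. a * u y + b * v y) x = a *\<^sub>R laplacian u x + b *\<^sub>R laplacian v x"
    if "u \<in> V" "v \<in> V" "x \<in> K" for u v a b x
    unfolding laplacian_def h[OF that] by (simp add: trace_def sum.distrib sum_distrib_left)
  show "lin_op (lebesgue_on K) V laplacian"
    by (rule lin_op_elem[OF elem(1,3)[OF K] C2_ext_D(6)[OF V_C2[OF _ K]] l])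
qed

lemma bilin_face:
  fixes P Q :: "(real^'n \<Rightarrow> real) \<Rightarrow> real^'n \<Rightarrow> 'b::euclidean_space"
  assumes F: "F \<in> faces T" and "cont_lin (face_set F) V P" "cont_lin (face_set F) V Q"
  shows "bilin V (\<lambda>u v. ip_face F (P u) (Q v))"
  unfolding ip_face_def
  by (rule bilin_integral[OF V_closed]) (rule lin_op_face[OF face_facts(1,2)[OF F]]; fact)+

lemma bilin_lap_form: "bilin V (lap_form T)"
  unfolding lap_form_def[abs_def] ip_elem_def
  by (intro bilin_sum bilin_integral V_closed lin_op_laplacian)

lemma bilin_J_form: "bilin V (J_form D T \<mu> \<eta>)"
  unfolding J_form_def[abs_def]
  by (intro bilin_add bilin_sum bilin_scale bilin_face cont_lin_jump_val cont_lin_jump_tgrad cont_lin_jump_nderiv)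
    (simp_all add: faces_def)

lemma bilin_B_star: "bilin V (B_star D T)"
proof -
  have i: "F \<in> faces T" if "F \<in> ifaces T" for F using that by (simp add: faces_def)
  have b: "F \<in> faces T" if "F \<in> bfaces T" for F using that by (simp add: faces_def)
  have 1: "bilin V (\<lambda>u v. ip_face F (tdivgrad_avg D F u) (jump_nderiv D F v))" if "F \<in> ifaces T" for F
    by (rule bilin_face[OF i[OF that] cont_lin_tdivgrad_avg[OF that] cont_lin_jump_nderiv[OF i[OF that]]])
  have 2: "bilin V (\<lambda>u v. ip_face F (tgrad_avg_nderiv D F u) (jump_tgrad D F v))" if "F \<in> faces T" for F
    by (rule bilin_face[OF that cont_lin_tgrad_avg_nderiv[OF that] cont_lin_jump_tgrad[OF that]])
  have 3: "bilin V (\<lambda>u v. ip_face F (\<lambda>x. mean_curv D F x * jump_nderiv D F u x) (jump_nderiv D F v))"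
    if "F \<in> bfaces T" for F
    using cont_lin_scaleR[OF cont_lin_jump_nderiv[OF b[OF that]] normal_field_continuous(4)[OF b[OF that]]]
    by (intro bilin_face b that cont_lin_jump_nderiv) simp
  have J: "cont_lin (face_set F) V (\<lambda>u x. jac (nF D F) x *v jump_tgrad D F u x)" if "F \<in> bfaces T" for F
  proof (rule cont_lin_apply[OF cont_lin_jump_tgrad[OF b[OF that]]])
    show "linear ((*v) (jac (nF D F) x))" for x by simp
    show "continuous_on (face_set F) (\<lambda>x. jac (nF D F) x *v q x)" if "continuous_on (face_set F) q" for q
      unfolding matrix_vector_mult_def
      by (intro continuous_on_vec_lambda continuous_on_sum continuous_on_mult continuous_on_component that
        normal_field_continuous(3) b[OF \<open>F \<in> bfaces T\<close>])
  qed
  have 4: "bilin V (\<lambda>u v. ip_face F (jump_tgrad D F u) (\<lambda>x. jac (nF D F) x *v jump_tgrad D F v x))"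
    if "F \<in> bfaces T" for F
    by (intro bilin_face b that cont_lin_jump_tgrad J)
  have 5: "bilin V (\<lambda>u v. ip_face F (jump_nderiv D F u) (\<lambda>x. nF D F x \<bullet> (jac (nF D F) x *v jump_tgrad D F v x)))"
    if "F \<in> bfaces T" for F
    using cont_lin_inner[OF J[OF that] normal_field_continuous(1)[OF b[OF that]]]
    by (intro bilin_face b that cont_lin_jump_nderiv) (simp add: inner_commute)
  have 0: "bilin V (\<lambda>u v. ip_elem K (hess u) (hess v))" if "K \<in> elems T" for K
    unfolding ip_elem_def by (intro bilin_integral V_closed lin_op_hess that)
  show ?thesis
    unfolding B_star_def[abs_def]
    by (intro bilin_add bilin_diff bilin_sum 0 1 2 3 4 5 bilin_swap[OF 1] bilin_swap[OF 2])
qed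

lemma bilin_B_theta: "bilin V (B_theta D T \<mu> \<eta> \<theta>)"
  unfolding B_theta_def[abs_def]
  by (intro bilin_add bilin_scale bilin_B_star bilin_lap_form bilin_J_form)

end


section \<open>Definiteness of the norm\<close>

lemma inner_mat_1: "(mat 1 :: real^'n^'n) \<bullet> M = trace M"
proof -
  have "(\<Sum>j\<in>UNIV. (mat 1 :: real^'n^'n) $ i $ j * M $ i $ j) = M $ i $ i" for i
    by (simp add: mat_def if_distrib[of "\<lambda>t. t * _"] cong: if_cong)
  then show ?thesis by (simp add: inner_vec_def trace_def)
qed

lemma norm_mat_1: "(norm (mat 1 :: real^'n^'n))\<^sup>2 = real CARD('n)"
proof -
  have "(norm (mat 1 :: real^'n^'n))\<^sup>2 = trace (mat 1 :: real^'n^'n)"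
    unfolding power2_norm_eq_inner by (rule inner_mat_1)
  then show ?thesis by (simp add: trace_def mat_def)
qed

lemma trace_power2_le: "(trace (M :: real^'n^'n))\<^sup>2 \<le> real CARD('n) * (norm M)\<^sup>2"
  using Cauchy_Schwarz_ineq[of "mat 1" M] by (simp add: inner_mat_1 norm_mat_1 power2_norm_eq_inner[symmetric])

lemma cordes_pointwise:
  fixes A M :: "real^'n^'n"
  assumes tr: "trace A \<noteq> 0" and \<epsilon>: "0 < \<epsilon>" and C: "(norm A)\<^sup>2 / (trace A)\<^sup>2 \<le> 1 / (real CARD('n) - 1 + \<epsilon>)"
  shows "(trace A / (norm A)\<^sup>2 * (A \<bullet> M) - trace M)\<^sup>2 \<le> (1 - \<epsilon>) * (norm M)\<^sup>2"
proof -
  let ?g = "trace A / (norm A)\<^sup>2" and ?n = "real CARD('n)"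
  have n1: "?n \<ge> 1" using zero_less_card_finite[where 'a='n] by linarith
  then have d: "0 < ?n - 1 + \<epsilon>" using \<epsilon> by linarith
  have t2: "0 < (trace A)\<^sup>2" using tr by simp
  then have "0 < ?n * (norm A)\<^sup>2" using trace_power2_le[of A] by linarith
  then have a2: "0 < (norm A)\<^sup>2" by (simp add: zero_less_mult_iff)
  have "(norm A)\<^sup>2 * (?n - 1 + \<epsilon>) \<le> (trace A)\<^sup>2"
    using C d t2 by (simp add: divide_le_eq le_divide_eq)
  then have ratio: "?n - 1 + \<epsilon> \<le> (trace A)\<^sup>2 / (norm A)\<^sup>2" using a2 by (simp add: le_divide_eq mult.commute)
  have "(norm (?g *\<^sub>R A - mat 1))\<^sup>2 = ?g\<^sup>2 * (norm A)\<^sup>2 - 2 * ?g * trace A + ?n"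
  proof -
    define J where "J = (mat 1 :: real^'n^'n)"
    have "(norm (?g *\<^sub>R A - J))\<^sup>2 = ?g\<^sup>2 * (norm A)\<^sup>2 - 2 * ?g * (J \<bullet> A) + (norm J)\<^sup>2"
      unfolding power2_norm_eq_inner
      by (simp only: inner_diff_left inner_diff_right inner_scaleR_left inner_scaleR_right inner_commute[of A J]
        power2_eq_square) (simp add: algebra_simps)
    then show ?thesis unfolding J_def inner_mat_1 norm_mat_1 .
  qed
  also have "\<dots> = ?n - (trace A)\<^sup>2 / (norm A)\<^sup>2"
    using a2 by (simp add: power2_eq_square)
  also have "\<dots> \<le> 1 - \<epsilon>" using ratio by linarith
  finally have nn: "(norm (?g *\<^sub>R A - mat 1))\<^sup>2 \<le> 1 - \<epsilon>" .
  have "(?g * (A \<bullet> M) - trace M)\<^sup>2 = ((?g *\<^sub>R A - mat 1) \<bullet> M)\<^sup>2" by (simp add: inner_diff_left inner_mat_1)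
  also have "\<dots> \<le> (norm (?g *\<^sub>R A - mat 1))\<^sup>2 * (norm M)\<^sup>2"
    using Cauchy_Schwarz_ineq[of "?g *\<^sub>R A - mat 1" M] by (simp add: power2_norm_eq_inner)
  also have "\<dots> \<le> (1 - \<epsilon>) * (norm M)\<^sup>2" using nn by (rule mult_right_mono) simp
  finally show ?thesis .
qed

lemma elliptic_trace:
  fixes A :: "real^'n^'n"
  assumes "0 < c" and ell: "\<And>z. c * (norm z)\<^sup>2 \<le> z \<bullet> (A *v z)"
  shows "c \<le> trace A" "\<bar>trace A / (norm A)\<^sup>2\<bar> \<le> real CARD('n) / c"
proof -
  have Aii: "c \<le> A $ i $ i" for i
    using ell[of "axis i 1"] by (simp add: inner_axis' matrix_vector_mult_basis column_def)
  obtain i :: 'n where True by simp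
  have "A $ i $ i \<le> trace A" unfolding trace_def
    by (rule member_le_sum) (use Aii assms(1) in \<open>auto intro: order_trans[OF less_imp_le]\<close>)
  then show ct: "c \<le> trace A" using Aii[of i] by linarith
  have "0 < (trace A)\<^sup>2" using ct assms(1) by simp
  then have "0 < real CARD('n) * (norm A)\<^sup>2" using trace_power2_le[of A] by linarith
  then have a2: "0 < (norm A)\<^sup>2" by (simp add: zero_less_mult_iff)
  have "c * trace A \<le> (trace A)\<^sup>2"
    unfolding power2_eq_square using ct assms(1) by (intro mult_right_mono) auto
  also have "\<dots> \<le> real CARD('n) * (norm A)\<^sup>2" by (rule trace_power2_le)
  finally have "trace A / (norm A)\<^sup>2 \<le> real CARD('n) / c"
    using a2 assms(1) by (simp add: divide_le_eq le_divide_eq mult.commute)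
  then show "\<bar>trace A / (norm A)\<^sup>2\<bar> \<le> real CARD('n) / c" using ct assms(1) by simp
qed

lemma AE_lebesgue_on_subset:
  assumes "AE x in lebesgue_on \<Omega>. P x" "K \<subseteq> \<Omega>" "K \<in> sets lebesgue" "\<Omega> \<in> sets lebesgue"
  shows "AE x in lebesgue_on K. P x"
proof -
  have "AE x in lebesgue. x \<in> \<Omega> \<longrightarrow> P x" using assms by (simp add: AE_restrict_space_iff)
  then have "AE x in lebesgue. x \<in> K \<longrightarrow> P x" by eventually_elim (use assms(2) in auto)
  then show ?thesis using assms by (simp add: AE_restrict_space_iff)
qed

lemma continuous_AE_zero_open:
  fixes g :: "real^'n \<Rightarrow> 'b::real_normed_vector"
  assumes K: "open K" and c: "continuous_on K g" and ae: "AE x in lebesgue_on K. g x = 0" and x: "x \<in> K"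
  shows "g x = 0"
proof -
  let ?S = "{x \<in> K. g x \<noteq> 0}"
  have "?S = K \<inter> g -` (- {0})" by auto
  then have S: "open ?S" using continuous_open_preimage[OF c K open_Compl[OF closed_singleton[of 0]]] by simp
  have "AE x in lebesgue. x \<in> K \<longrightarrow> g x = 0" using ae K by (simp add: AE_restrict_space_iff)
  then have "AE x in lebesgue. x \<notin> ?S" by eventually_elim auto
  then have "?S \<in> null_sets lebesgue" using S by (subst AE_iff_null_sets) auto
  then have "negligible ?S" by (simp add: negligible_iff_null_sets)
  then have "?S = {}" using open_not_negligible[OF S] by blast
  then show ?thesis using x by blast
qed

lemma young_optimize:
  fixes x y c L :: real
  assumes "0 \<le> x" "0 \<le> y" "0 \<le> c" and L: "\<And>s. 0 < s \<Longrightarrow> L \<le> c * (s / 2 * x\<^sup>2 + y\<^sup>2 / (2 * s))"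
  shows "L \<le> c * (x * y)"
proof -
  have key: "L \<le> c * (x * y) + e * (c * (x + y))" if e: "0 < e" for e
  proof -
    define s where "s = (y + e) / (x + e)"
    have pos: "0 < x + e" "0 < y + e" "0 < s" using e assms by (auto simp: s_def)
    have "s / 2 * x\<^sup>2 = (y + e) * x / 2 * (x / (x + e))"
      using pos by (simp add: s_def power2_eq_square field_simps)
    also have "\<dots> \<le> (y + e) * x / 2 * 1" using pos assms e by (intro mult_left_mono) auto
    finally have 1: "s / 2 * x\<^sup>2 \<le> (y + e) * x / 2" by simp
    have "y\<^sup>2 / (2 * s) = y * (x + e) / 2 * (y / (y + e))"
      using pos by (simp add: s_def power2_eq_square field_simps)
    also have "\<dots> \<le> y * (x + e) / 2 * 1" using pos assms e by (intro mult_left_mono) auto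
    finally have 2: "y\<^sup>2 / (2 * s) \<le> y * (x + e) / 2" by simp
    have "L \<le> c * (s / 2 * x\<^sup>2 + y\<^sup>2 / (2 * s))" by (rule L[OF pos(3)])
    also have "\<dots> \<le> c * ((y + e) * x / 2 + y * (x + e) / 2)" using 1 2 assms by (intro mult_left_mono add_mono) auto
    also have "\<dots> = c * (x * y) + e * (c * (x + y)) / 2" by (simp add: field_simps)
    also have "\<dots> \<le> c * (x * y) + e * (c * (x + y))"
    proof -
      have "0 \<le> e * (c * (x + y))" using assms e by simp
      then show ?thesis by linarith
    qed
    finally show ?thesis .
  qed
  show ?thesis
  proof (rule field_le_epsilon)
    fix \<delta> :: real assume \<delta>: "0 < \<delta>"
    let ?k = "c * (x + y)"
    have k: "0 \<le> ?k" using assms by simp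
    have "\<delta> / (?k + 1) * ?k \<le> \<delta>" using \<delta> k by (simp add: field_simps)
    then show "L \<le> c * (x * y) + \<delta>" using key[of "\<delta> / (?k + 1)"] \<delta> k by simp
  qed
qed

lemma AE_surf_exists:
  assumes ae: "AE x in restrict_space (surf_measure :: (real^'n::finite) measure) S. P x"
    and pos: "emeasure (surf_measure :: (real^'n) measure) S > 0" and S: "S \<in> sets borel"
  shows "\<exists>x\<in>S. P x"
proof (rule ccontr)
  assume no: "\<not> ?thesis"
  have "AE x in restrict_space (surf_measure :: (real^'n) measure) S. False"
    using ae AE_space by eventually_elim (use no in \<open>auto simp: space_restrict_space\<close>)
  then have "AE x in (surf_measure :: (real^'n) measure). x \<notin> S"
    using S by (subst (asm) AE_restrict_space_iff) auto
  then have "S \<in> null_sets (surf_measure :: (real^'n) measure)"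
    using S by (subst AE_iff_null_sets) auto
  then show False using pos by (simp add: null_sets_def)
qed

lemma ip_face_nonneg: "0 \<le> ip_face F g g"
  by (simp add: ip_face_def)

lemma ip_elem_nonneg: "0 \<le> ip_elem K g g"
  by (simp add: ip_elem_def)

lemma H2_broken_sq_nonneg: "0 \<le> H2_broken_sq T v"
  unfolding H2_broken_sq_def by (intro sum_nonneg ip_elem_nonneg)

lemma curv_sq_nonneg: "0 \<le> curv_sq D T v"
  unfolding curv_sq_def by (intro sum_nonneg ip_face_nonneg)

lemma J_form_nonneg:
  assumes "\<And>F. F \<in> faces T \<Longrightarrow> 0 \<le> \<mu> F" "\<And>F. F \<in> faces T \<Longrightarrow> 0 \<le> \<eta> F"
  shows "0 \<le> J_form D T \<mu> \<eta> v v"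
  unfolding J_form_def using assms
  by (intro add_nonneg_nonneg sum_nonneg mult_nonneg_nonneg ip_face_nonneg) (auto simp: faces_def)

context dg_mesh
begin

lemma elem_subset: "K \<in> elems T \<Longrightarrow> K \<subseteq> region D"
  using mesh by (simp add: exact_mesh_def)

lemma region_facts: "open (region D)" "bounded (region D)" "region D \<noteq> {}" "region D \<in> lmeasurable"
proof -
  have "lipschitz_domain (region D)" using domain by (simp add: piecewise_C2_convex_domain_def)
  then show "open (region D)" "bounded (region D)" "region D \<noteq> {}" "region D \<in> lmeasurable"
    using lipschitz_domain_lmeasurable by (auto simp: lipschitz_domain_def)
qed

lemma finite_elems: "finite (elems T)" and disjoint_elems: "disjoint (elems T)"
  using mesh by (simp_all add: exact_mesh_def)

lemma face_size_pos:
  assumes F: "F \<in> faces T"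
  shows "0 < face_size T F"
proof -
  have pos: "0 < elem_size T K" if K: "K \<in> elems T" "K \<noteq> {}" for K
  proof -
    let ?B = "aff_mat T K" and ?R = "refel T"
    note R = exact_mesh_refel[OF mesh]
    have inv: "invertible ?B" and img: "K = elem_map T K ` ?R" using mesh K(1) by (auto simp: exact_mesh_def)
    have "?R \<noteq> {}"
    proof
      assume "?R = {}"
      then have "K = {}" by (subst img) simp
      then show False using K(2) by simp
    qed
    then obtain x where x: "x \<in> ?R" by blast
    then obtain e where e: "0 < e" "ball x e \<subseteq> ?R" using R(1) open_contains_ball by blast
    define y where "y = x + (e / 2) *\<^sub>R axis undefined 1"
    have "dist x y = e / 2" using e(1) by (simp add: y_def dist_norm)
    then have y: "y \<in> ?R" "y \<noteq> x" using e by (auto simp: mem_ball)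
    have "?B *v x \<noteq> ?B *v y"
    proof
      assume "?B *v x = ?B *v y"
      then have "matrix_inv ?B *v (?B *v x) = matrix_inv ?B *v (?B *v y)" by simp
      then show False using y(2) by (simp add: invertible_mult_matrix_inv[OF inv])
    qed
    then have "0 < dist (?B *v x) (?B *v y)" by simp
    also have "\<dots> \<le> elem_size T K"
      unfolding elem_size_def
    proof (rule diameter_bounded_bound)
      show "bounded ((*v) ?B ` ?R)"
        by (intro bounded_linear_image R(3)) (simp add: linear_conv_bounded_linear[symmetric])
    qed (use x y in auto)
    finally show ?thesis .
  qed
  have "face_set F \<noteq> {}" using face_facts(3)[OF F] by force
  then have side: "0 < elem_size T K" if "K \<in> sides F" for K
    using face_facts(4)[OF F that] by (intro pos) auto
  show ?thesis using side by (cases F) auto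
qed

lemma ip_face_zero:
  fixes Q :: "(real^'n \<Rightarrow> real) \<Rightarrow> real^'n \<Rightarrow> 'b::euclidean_space"
  assumes F: "F \<in> faces T" and Q: "cont_lin (face_set F) V Q" and v: "v \<in> V" and 0: "ip_face F (Q v) (Q v) = 0"
  shows "AE x in restrict_space surf_measure (face_set F). Q v x = 0"
proof -
  note l = lin_op_face[OF face_facts(1,2)[OF F] Q]
  have "AE x in restrict_space surf_measure (face_set F). Q v x \<bullet> Q v x = 0"
    using 0 integral_nonneg_eq_0_iff_AE[OF lin_op_integrable[OF l l v v]] by (simp add: ip_face_def)
  then show ?thesis by simp
qed

lemma affine_on_elem:
  assumes v: "v \<in> V" and K: "K \<in> elems T" and 0: "ip_elem K (hess v) (hess v) = 0"
  obtains a b where "\<And>x. x \<in> K \<Longrightarrow> v x = a \<bullet> x + b" "\<And>x. x \<in> closure K \<Longrightarrow> tr K v x = a \<bullet> x + b"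
    "\<And>x. x \<in> closure K \<Longrightarrow> tr K (grad v) x = a"
proof -
  note E = elem[OF K] and C2 = V_C2[OF v K] and l = lin_op_hess[OF K]
  have "AE x in lebesgue_on K. hess v x \<bullet> hess v x = 0"
    using 0 integral_nonneg_eq_0_iff_AE[OF lin_op_integrable[OF l l v v]] by (simp add: ip_elem_def)
  then have ae: "AE x in lebesgue_on K. hess v x = 0" by simp
  have h: "hess v x = 0" if "x \<in> K" for x
    by (rule continuous_AE_zero_open[OF E(1) C0_ext_continuous_on[OF C2_ext_D(5)[OF C2]] ae that])
  have g0: "grad (\<lambda>y. grad v y $ j) x = 0" if "x \<in> K" for x j
  proof -
    have "grad (\<lambda>y. grad v y $ j) x $ i = hess v x $ i $ j" for i by (simp add: hess_def jac_def)
    then show ?thesis using h[OF that] by (simp add: vec_eq_iff)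
  qed
  obtain a b where ab: "\<And>x. x \<in> K \<Longrightarrow> grad v x = a" "\<And>x. x \<in> K \<Longrightarrow> v x = a \<bullet> x + b"
  proof (cases "K = {}")
    case False
    then obtain z where z: "z \<in> K" by blast
    have ga: "grad v x = grad v z" if x: "x \<in> K" for x
    proof -
      have "grad v x $ j = grad v z $ j" for j
      proof (rule has_derivative_zero_unique_connected[OF E(1,2) _ x z])
        fix y assume "y \<in> K"
        then show "((\<lambda>y. grad v y $ j) has_derivative (\<lambda>h. 0)) (at y)"
          using has_derivative_grad[OF C2_ext_D(8)[OF C2 \<open>y \<in> K\<close>, of j]] g0 by simp
      qed
      then show ?thesis by (simp add: vec_eq_iff)
    qed
    have "v x - grad v z \<bullet> x = v z - grad v z \<bullet> z" if x: "x \<in> K" for x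
    proof (rule has_derivative_zero_unique_connected[OF E(1,2) _ x z])
      fix y assume y: "y \<in> K"
      have "((\<lambda>y. v y - grad v z \<bullet> y) has_derivative (\<lambda>h. grad v y \<bullet> h - grad v z \<bullet> h)) (at y)"
        by (intro has_derivative_diff has_derivative_grad C2_ext_D(7)[OF C2 y] has_derivative_inner_right has_derivative_ident)
      then show "((\<lambda>y. v y - grad v z \<bullet> y) has_derivative (\<lambda>h. 0)) (at y)" by (simp add: ga[OF y])
    qed
    then have "v x = grad v z \<bullet> x + (v z - grad v z \<bullet> z)" if "x \<in> K" for x using that by (simp add: algebra_simps)
    then show ?thesis using ga that by blast
  qed (use that in blast)
  have "tr K v x = a \<bullet> x + b" if "x \<in> closure K" for x
  proof (rule tr_eqI[OF E(1) that])
    have "((\<lambda>x. a \<bullet> x + b) \<longlongrightarrow> a \<bullet> x + b) (at x within K)" by (intro tendsto_intros)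
    then show "(v \<longlongrightarrow> a \<bullet> x + b) (at x within K)"
      by (rule Lim_transform_within[of _ _ _ _ 1]) (use ab(2) in auto)
  qed
  moreover have "tr K (grad v) x = a" if "x \<in> closure K" for x
  proof (rule tr_eqI[OF E(1) that])
    have "((\<lambda>x. a) \<longlongrightarrow> a) (at x within K)" by (intro tendsto_intros)
    then show "(grad v \<longlongrightarrow> a) (at x within K)"
      by (rule Lim_transform_within[of _ _ _ _ 1]) (use ab(1) in auto)
  qed
  ultimately show ?thesis using ab(2) that by blast
qed

text \<open>Along almost every line parallel to a coordinate axis the traversed elements only meet in faces of
  positive measure, so a piecewise affine function without jumps is the same affine function on all
  of them.  Vanishing at both exit points from the domain, it has zero slope in that direction.\<close>

lemma piecewise_affine_zero:
  assumes match: "\<And>K K'. K \<in> elems T \<Longrightarrow> K' \<in> elems T \<Longrightarrow>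
      emeasure surf_measure (closure K \<inter> closure K') > 0 \<Longrightarrow> a K = a K' \<and> b K = b K'"
    and N: "hausdorff_outer (CARD('n) - 1) N = 0"
    and bdry: "\<And>K z. K \<in> elems T \<Longrightarrow> z \<in> frontier K \<inter> frontier (region D) - N \<Longrightarrow> a K \<bullet> z + b K = 0"
    and K0: "K0 \<in> elems T" "K0 \<noteq> {}"
  shows "a K0 = 0 \<and> b K0 = (0::real)"
proof -
  note om = outer_measure_space_hausdorff_outer[of "CARD('n) - 1", where 'a="real^'n"]
  let ?pairs = "{(K, K') \<in> elems T \<times> elems T. emeasure (surf_measure :: (real^'n) measure) (closure K \<inter> closure K') = 0}"
  define N' where "N' = N \<union> (\<Union>(K, K')\<in>?pairs. closure K \<inter> closure K')"
  have P0: "hausdorff_outer (CARD('n) - 1) (\<Union>(K, K')\<in>?pairs. closure K \<inter> closure K') = 0"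
  proof -
    have "(\<Union>(K, K')\<in>?pairs. closure K \<inter> closure K') \<in> null_sets (surf_measure :: (real^'n) measure)"
    proof (rule null_sets_UN')
      have "finite ?pairs" using finite_elems by (auto intro: finite_subset[of _ "elems T \<times> elems T"])
      then show "countable ?pairs" by (rule countable_finite)
    qed (auto simp: null_sets_def)
    from null_setsD1[OF this] null_setsD2[OF this] show ?thesis
      by (simp add: emeasure_hausdorff_measure)
  qed
  have N': "hausdorff_outer (CARD('n) - 1) N' = 0"
  proof -
    have "hausdorff_outer (CARD('n) - 1) N' \<le> (\<Sum>i. hausdorff_outer (CARD('n) - 1)
        (binaryset N (\<Union>(K, K')\<in>?pairs. closure K \<inter> closure K') i))"
      unfolding N'_def UN_binaryset_eq[symmetric] by (rule outer_measure_space_UN_le[OF om])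
    also have "\<dots> = 0"
      using N P0 om by (subst suminf_binaryset_eq) (auto simp: outer_measure_space_def positive_def)
    finally show ?thesis by simp
  qed
  have match': "a K = a K' \<and> b K = b K'" if "K \<in> elems T" "K' \<in> elems T" "z \<in> closure K" "z \<in> closure K'" "z \<notin> N'" for K K' z
  proof -
    have "emeasure (surf_measure :: (real^'n) measure) (closure K \<inter> closure K') \<noteq> 0"
      using that by (auto simp: N'_def)
    then show ?thesis using match[OF that(1,2)] by (simp add: zero_less_iff_neq_zero)
  qed
  have step: "a K0 $ i = 0 \<and> (\<exists>z. a K0 \<bullet> z + b K0 = 0)" for i
  proof -
    let ?e = "axis i 1 :: real^'n"
    have "\<not> negligible K0" using open_not_negligible[OF elem(1)[OF K0(1)] K0(2)] .
    moreover have "negligible {x. \<exists>t. x + t *\<^sub>R ?e \<in> N'}"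
      using null_sets_axis_lines[OF N'] by (simp add: negligible_iff_null_sets)
    ultimately have "\<not> K0 \<subseteq> {x. \<exists>t. x + t *\<^sub>R ?e \<in> N'}" using negligible_subset by blast
    then obtain x where x: "x \<in> K0" "\<And>t. x + t *\<^sub>R ?e \<notin> N'" by blast
    have xO: "x \<in> interior (region D)" using x(1) elem_subset[OF K0(1)] region_facts(1) by (auto simp: interior_open)
    have e0: "?e \<noteq> 0" by (simp add: axis_eq_0_iff)
    obtain d1 where d1: "0 < d1" "x + d1 *\<^sub>R ?e \<in> frontier (region D)"
      "\<And>t. 0 \<le> t \<Longrightarrow> t < d1 \<Longrightarrow> x + t *\<^sub>R ?e \<in> interior (region D)"
      using ray_to_frontier[OF region_facts(2) xO e0] by blast
    have e0': "- ?e \<noteq> 0" using e0 by simp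
    obtain d2 where d2: "0 < d2" "x + d2 *\<^sub>R (- ?e) \<in> frontier (region D)"
      "\<And>t. 0 \<le> t \<Longrightarrow> t < d2 \<Longrightarrow> x + t *\<^sub>R (- ?e) \<in> interior (region D)"
      using ray_to_frontier[OF region_facts(2) xO e0'] by blast
    let ?l = "\<lambda>t. x + t *\<^sub>R ?e"
    have inO: "?l t \<in> closure (region D)" if t: "t \<in> {- d2..d1}" for t
    proof -
      have sub: "interior (region D) \<subseteq> closure (region D)"
        using interior_subset closure_subset by (rule subset_trans)
      have "t = d1 \<or> t = - d2 \<or> (0 \<le> t \<and> t < d1) \<or> (t < 0 \<and> - d2 < t)" using t by auto
      then consider (1) "t = d1" | (2) "t = - d2" | (3) "0 \<le> t" "t < d1" | (4) "t < 0" "- d2 < t" by argo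
      then show ?thesis
      proof cases
        case 1
        show ?thesis using d1(2) unfolding 1 frontier_def by (rule DiffD1)
      next
        case 2
        have "x + d2 *\<^sub>R (- ?e) = ?l t" unfolding 2 by simp
        then show ?thesis using d2(2) unfolding frontier_def by simp
      next
        case 3
        show ?thesis by (rule subsetD[OF sub d1(3)[OF 3]])
      next
        case 4
        have "x + (- t) *\<^sub>R (- ?e) \<in> interior (region D)" by (rule d2(3)) (use 4 in auto)
        then have "?l t \<in> interior (region D)" by simp
        then show ?thesis by (rule subsetD[OF sub])
      qed
    qed
    have cover: "\<exists>K\<in>elems T. ?l t \<in> closure K" if "t \<in> {- d2..d1}" for t
    proof -
      have "(\<Union>K\<in>elems T. closure K) = closure (region D)" using mesh by (simp add: exact_mesh_def)
      then show ?thesis using inO[OF that] by blast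
    qed
    define E where "E = {K \<in> elems T. a K = a K0 \<and> b K = b K0}"
    define I where "I X = {- d2..d1} \<inter> ?l -` (\<Union>K\<in>X. closure K)" for X
    have clI: "closed (I X)" if "X \<subseteq> elems T" for X
      unfolding I_def
    proof (rule continuous_closed_preimage)
      show "continuous_on {- d2..d1} ?l" by (intro continuous_intros)
      show "closed (\<Union>K\<in>X. closure K)" using finite_subset[OF that finite_elems] by (intro closed_UN) auto
    qed auto
    have "I (elems T - E) = {}"
    proof (rule ccontr)
      assume ne: "I (elems T - E) \<noteq> {}"
      have "\<not> connected {- d2..d1}"
        unfolding connected_closed not_not
      proof (intro exI conjI)
        show "closed (I E)" "closed (I (elems T - E))" by (rule clI, auto simp: E_def)+
        show "{- d2..d1} \<subseteq> I E \<union> I (elems T - E)"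
        proof
          fix t assume t: "t \<in> {- d2..d1}"
          then obtain K where "K \<in> elems T" "?l t \<in> closure K" using cover by blast
          then show "t \<in> I E \<union> I (elems T - E)" using t unfolding I_def by (cases "K \<in> E") blast+
        qed
        have "0 \<in> I E" using x(1) closure_subset[of K0] d1(1) d2(1) K0(1) by (auto simp: I_def E_def)
        then have "0 \<in> I E \<inter> {- d2..d1}" using d1(1) d2(1) by simp
        then show "I E \<inter> {- d2..d1} \<noteq> {}" by blast
        show "I (elems T - E) \<inter> {- d2..d1} \<noteq> {}" using ne by (auto simp: I_def)
        show "I E \<inter> I (elems T - E) \<inter> {- d2..d1} = {}"
        proof (rule ccontr)
          assume "I E \<inter> I (elems T - E) \<inter> {- d2..d1} \<noteq> {}"
          then obtain t where "t \<in> I E" "t \<in> I (elems T - E)" by blast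
          then obtain K K' where t: "K \<in> E" "?l t \<in> closure K" "K' \<in> elems T" "K' \<notin> E" "?l t \<in> closure K'"
            unfolding I_def by auto
          then have "K \<in> elems T" "a K = a K0" "b K = b K0" by (auto simp: E_def)
          then show False using match'[OF _ t(3,2,5) x(2)] t(3,4) by (simp add: E_def)
        qed
      qed
      then show False by simp
    qed
    have same: "a K = a K0 \<and> b K = b K0" if "K \<in> elems T" "?l t \<in> closure K" "t \<in> {- d2..d1}" for K t
    proof (rule ccontr)
      assume "\<not> ?thesis"
      then have "K \<in> elems T - E" using that(1) by (simp add: E_def)
      then have "t \<in> I (elems T - E)" unfolding I_def by (intro IntI vimageI2 UN_I[of K] that)
      then show False using \<open>I (elems T - E) = {}\<close> by simp
    qed
    have exit: "a K0 \<bullet> ?l t + b K0 = 0" if t: "t \<in> {- d2..d1}" "?l t \<in> frontier (region D)" for t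
    proof -
      obtain K where K: "K \<in> elems T" "?l t \<in> closure K" using cover[OF t(1)] by blast
      have "?l t \<notin> region D" using t(2) region_facts(1) by (simp add: frontier_def interior_open)
      then have "?l t \<notin> K" using elem_subset[OF K(1)] by blast
      then have "?l t \<in> frontier K" using K elem(1)[OF K(1)] by (simp add: frontier_def interior_open)
      moreover have "?l t \<notin> N" using x(2)[of t] by (simp add: N'_def)
      ultimately have "a K \<bullet> ?l t + b K = 0" using bdry[OF K(1)] t(2) by blast
      then show ?thesis using same[OF K t(1)] by simp
    qed
    have 1: "a K0 \<bullet> ?l d1 + b K0 = 0" using exit[of d1] d1 d2 by simp
    have 2: "a K0 \<bullet> ?l (- d2) + b K0 = 0" using exit[of "- d2"] d1 d2 by simp
    have "(d1 + d2) * (a K0 \<bullet> ?e) = 0" using 1 2 by (simp add: inner_add_right algebra_simps)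
    then have "a K0 \<bullet> ?e = 0" using d1(1) d2(1) by simp
    then show ?thesis using 1 by (auto simp: inner_axis)
  qed
  have "a K0 = 0" using step by (simp add: vec_eq_iff)
  moreover have "\<exists>z. a K0 \<bullet> z + b K0 = 0" using step by blast
  ultimately show ?thesis by simp
qed

lemma norm_definite:
  assumes v: "v \<in> V" and H: "H2_broken_sq T v = 0" and J: "J_form D T \<mu> \<eta> v v = 0"
    and \<mu>: "\<And>F. F \<in> faces T \<Longrightarrow> 0 < \<mu> F" and \<eta>: "\<And>F. F \<in> faces T \<Longrightarrow> 0 < \<eta> F"
  shows "v = (\<lambda>x. 0)"
proof -
  have "ip_elem K (hess v) (hess v) = 0" if "K \<in> elems T" for K
    using H that sum_nonneg_eq_0_iff[OF finite_elems, of "\<lambda>K. ip_elem K (hess v) (hess v)"]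
    by (simp add: H2_broken_sq_def ip_elem_nonneg)
  then have "\<exists>ab. (\<forall>x\<in>K. v x = fst ab \<bullet> x + snd ab) \<and> (\<forall>x\<in>closure K. tr K v x = fst ab \<bullet> x + snd ab) \<and>
      (\<forall>x\<in>closure K. tr K (grad v) x = fst ab)" if "K \<in> elems T" for K
    using affine_on_elem[OF v that] that by (metis fst_conv snd_conv)
  then obtain ab where ab: "\<And>K. K \<in> elems T \<Longrightarrow> (\<forall>x\<in>K. v x = fst (ab K) \<bullet> x + snd (ab K)) \<and>
      (\<forall>x\<in>closure K. tr K v x = fst (ab K) \<bullet> x + snd (ab K)) \<and> (\<forall>x\<in>closure K. tr K (grad v) x = fst (ab K))"
    by metis
  define a where "a K = fst (ab K)" for K
  define b where "b K = snd (ab K)" for K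
  have va: "v x = a K \<bullet> x + b K" if "K \<in> elems T" "x \<in> K" for K x using ab that by (simp add: a_def b_def)
  have trv: "tr K v x = a K \<bullet> x + b K" "tr K (grad v) x = a K" if "K \<in> elems T" "x \<in> closure K" for K x
    using ab that by (simp_all add: a_def b_def)
  have \<mu>0: "0 \<le> \<mu> F * ip_face F (jump_tgrad D F v) (jump_tgrad D F v)"
    "0 \<le> \<eta> F * ip_face F (jump_val F v) (jump_val F v)"
    "0 \<le> \<mu> F * ip_face F (jump_nderiv D F v) (jump_nderiv D F v)" if "F \<in> faces T" for F
    using \<mu>[OF that] \<eta>[OF that] by (simp_all add: ip_face_nonneg)
  have i: "F \<in> faces T" if "F \<in> ifaces T" for F using that by (simp add: faces_def)
  let ?s1 = "\<Sum>F\<in>faces T. \<mu> F * ip_face F (jump_tgrad D F v) (jump_tgrad D F v)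
                  + \<eta> F * ip_face F (jump_val F v) (jump_val F v)"
  let ?s2 = "\<Sum>F\<in>ifaces T. \<mu> F * ip_face F (jump_nderiv D F v) (jump_nderiv D F v)"
  have s1: "0 \<le> ?s1" by (intro sum_nonneg add_nonneg_nonneg \<mu>0)
  have s2: "0 \<le> ?s2" by (intro sum_nonneg \<mu>0 i)
  have s0: "?s1 = 0" "?s2 = 0" using J s1 s2 by (simp_all add: J_form_def)
  have z1: "ip_face F (jump_tgrad D F v) (jump_tgrad D F v) = 0" "ip_face F (jump_val F v) (jump_val F v) = 0"
    if F: "F \<in> faces T" for F
  proof -
    have "\<mu> F * ip_face F (jump_tgrad D F v) (jump_tgrad D F v) + \<eta> F * ip_face F (jump_val F v) (jump_val F v) = 0"
      using s0(1) F sum_nonneg_eq_0_iff[OF finite_faces, of "\<lambda>F. \<mu> F * ip_face F (jump_tgrad D F v) (jump_tgrad D F v)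
                  + \<eta> F * ip_face F (jump_val F v) (jump_val F v)"] \<mu>0 by (simp add: add_nonneg_nonneg)
    then have "\<mu> F * ip_face F (jump_tgrad D F v) (jump_tgrad D F v) = 0"
      "\<eta> F * ip_face F (jump_val F v) (jump_val F v) = 0" using \<mu>0[OF F] by linarith+
    then show "ip_face F (jump_tgrad D F v) (jump_tgrad D F v) = 0" "ip_face F (jump_val F v) (jump_val F v) = 0"
      using \<mu>[OF F] \<eta>[OF F] by simp_all
  qed
  have z2: "ip_face F (jump_nderiv D F v) (jump_nderiv D F v) = 0" if F: "F \<in> ifaces T" for F
  proof -
    have "\<mu> F * ip_face F (jump_nderiv D F v) (jump_nderiv D F v) = 0"
      using s0(2) F sum_nonneg_eq_0_iff[OF finite_ifaces, of "\<lambda>F. \<mu> F * ip_face F (jump_nderiv D F v) (jump_nderiv D F v)"]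
        \<mu>0(3)[OF i] by simp
    then show ?thesis using \<mu>[OF i[OF F]] by simp
  qed
  have glue: "a K = a K' \<and> b K = b K'" if F: "IFace K K' \<in> ifaces T" for K K'
  proof -
    let ?F = "IFace K K'" let ?S = "face_set ?F"
    note FF = i[OF F] and side = face_facts(4)[OF i[OF F]]
    have KK: "K \<in> elems T" "K' \<in> elems T" "?S \<subseteq> closure K" "?S \<subseteq> closure K'" using side[of K] side[of K'] by auto
    have "AE x in restrict_space surf_measure ?S. jump_tgrad D ?F v x = 0 \<and> jump_val ?F v x = 0 \<and> jump_nderiv D ?F v x = 0"
      using ip_face_zero[OF FF cont_lin_jump_tgrad[OF FF] v z1(1)[OF FF]]
        ip_face_zero[OF FF cont_lin_jump_val[OF FF] v z1(2)[OF FF]]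
        ip_face_zero[OF FF cont_lin_jump_nderiv[OF FF] v z2[OF F]] by eventually_elim blast
    moreover have "?S \<in> sets borel" by simp
    ultimately obtain x where x: "x \<in> ?S" "jump_tgrad D ?F v x = 0" "jump_val ?F v x = 0" "jump_nderiv D ?F v x = 0"
      using AE_surf_exists[OF _ face_facts(3)[OF FF]] by blast
    have xc: "x \<in> closure K" "x \<in> closure K'" using x(1) by auto
    define n where "n = nF D ?F x"
    have n1: "norm n = 1" using normal_field[OF FF] x(1) unfolding n_def by metis
    have "a K - (a K \<bullet> n) *\<^sub>R n - (a K' - (a K' \<bullet> n) *\<^sub>R n) = 0"
      using x(2) by (simp add: jump_tgrad_def n_def[symmetric] tan_grad_eq[OF n1] trv KK xc del: nF.simps)
    moreover have "a K \<bullet> n = a K' \<bullet> n"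
      using x(4) by (simp add: jump_nderiv_def n_def[symmetric] trv KK xc del: nF.simps)
    ultimately have "a K = a K'" by simp
    moreover have "b K = b K'" using x(3) \<open>a K = a K'\<close> by (simp add: jump_val_def trv KK xc)
    ultimately show ?thesis by simp
  qed
  have match: "a K = a K' \<and> b K = b K'"
    if K: "K \<in> elems T" "K' \<in> elems T" and pos: "emeasure surf_measure (closure K \<inter> closure K') > 0" for K K'
  proof (cases "K = K'")
    case False
    have "interior_faces_of T" using mesh by (simp add: exact_mesh_def)
    then have "(IFace K K' \<in> ifaces T) \<noteq> (IFace K' K \<in> ifaces T)"
      using K pos False unfolding interior_faces_of_def by blast
    then show ?thesis using glue[of K K'] glue[of K' K] by auto
  qed simp
  define N1 where "N1 K = frontier K \<inter> frontier (region D) - \<Union>{S. BFace K S \<in> bfaces T}" for K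
  define N2 where "N2 F = {z \<in> face_set F. jump_val F v z \<noteq> 0}" for F
  have bf: "F \<in> faces T" if "F \<in> bfaces T" for F using that by (simp add: faces_def)
  have bfo: "boundary_faces_of (region D) T" using mesh by (simp add: exact_mesh_def)
  have finb: "finite (bfaces T)" using bfo by (simp add: boundary_faces_of_def)
  have "N1 K \<in> null_sets (surf_measure :: (real^'n) measure)" if K: "K \<in> elems T" for K
  proof -
    have "finite {S. BFace K S \<in> bfaces T}"
      by (rule finite_imageD[of "BFace K"]) (auto intro: finite_subset[OF _ finb] inj_onI)
    moreover have "closed S" if "BFace K S \<in> bfaces T" for S using bface_cases[OF that] by blast
    ultimately have "closed (\<Union>{S. BFace K S \<in> bfaces T})" by (intro closed_Union) auto
    then have "N1 K \<in> sets borel" by (simp add: N1_def borel_closed)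
    moreover have "emeasure surf_measure (N1 K) = 0" using bfo K by (simp add: boundary_faces_of_def N1_def)
    ultimately show ?thesis by (simp add: null_sets_def)
  qed
  then have n1: "(\<Union>K\<in>elems T. N1 K) \<in> null_sets (surf_measure :: (real^'n) measure)"
    using finite_elems by (intro null_sets_UN' countable_finite) auto
  have "N2 F \<in> null_sets (surf_measure :: (real^'n) measure)" if F: "F \<in> bfaces T" for F
  proof -
    note FF = bf[OF F]
    have c: "continuous_on (face_set F) (jump_val F v)" using cont_lin_jump_val[OF FF] v by (simp add: cont_lin_def)
    have S: "closed (face_set F)" using face_facts(1)[OF FF] by (rule compact_imp_closed)
    have "N2 F = face_set F - face_set F \<inter> jump_val F v -` {0}" by (auto simp: N2_def)
    moreover have "closed (face_set F \<inter> jump_val F v -` {0})" by (rule continuous_closed_preimage[OF c S]) simp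
    ultimately have m: "N2 F \<in> sets borel" using S by (simp add: borel_closed)
    have "AE x in surf_measure. x \<in> face_set F \<longrightarrow> jump_val F v x = 0"
      using ip_face_zero[OF FF cont_lin_jump_val[OF FF] v z1(2)[OF FF]] S
      by (subst (asm) AE_restrict_space_iff) (auto simp: borel_closed)
    then have "AE x in surf_measure. x \<notin> N2 F" by eventually_elim (auto simp: N2_def)
    then show ?thesis using m by (subst AE_iff_null_sets) simp_all
  qed
  then have n2: "(\<Union>F\<in>bfaces T. N2 F) \<in> null_sets (surf_measure :: (real^'n) measure)"
    using finb by (intro null_sets_UN' countable_finite) auto
  define N where "N = (\<Union>K\<in>elems T. N1 K) \<union> (\<Union>F\<in>bfaces T. N2 F)"
  have Nn: "N \<in> null_sets (surf_measure :: (real^'n) measure)" unfolding N_def by (rule null_sets.Un[OF n1 n2])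
  then have N: "hausdorff_outer (CARD('n) - 1) N = 0"
    using emeasure_hausdorff_measure[of N "CARD('n) - 1"] by (simp add: null_sets_def)
  have bdry: "a K \<bullet> z + b K = 0" if K: "K \<in> elems T" and z: "z \<in> frontier K \<inter> frontier (region D) - N" for K z
  proof -
    have "z \<notin> N1 K" using z K by (auto simp: N_def)
    then obtain S where S: "BFace K S \<in> bfaces T" "z \<in> S" using z by (auto simp: N1_def)
    then have "z \<notin> N2 (BFace K S)" using z by (auto simp: N_def)
    then have "jump_val (BFace K S) v z = 0" using S(2) by (simp add: N2_def)
    then show ?thesis using trv(1)[OF K, of z] z by (simp add: jump_val_def frontier_def)
  qed
  have "v x = 0" if "K \<in> elems T" "x \<in> K" for K x
  proof -
    have "a K = 0 \<and> b K = 0"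
      by (rule piecewise_affine_zero[OF match N bdry that(1)]) (use that(2) in auto)
    then show ?thesis using va[OF that] by simp
  qed
  moreover have "v x = 0" if "x \<notin> \<Union> (elems T)" for x using v that by (simp add: dg_space_def)
  ultimately show ?thesis by (intro ext) blast
qed

end


section \<open>Coercivity and well-posedness\<close>

locale cordes_problem = dg_mesh D T k p \<alpha>
  for D :: "'n::finite piecewise_domain" and T :: "'n mesh" and k :: degree_kind and p :: nat and \<alpha> :: real +
  fixes A :: "real^'n \<Rightarrow> real^'n^'n" and f :: "real^'n \<Rightarrow> real" and \<epsilon> :: real
  assumes Linf: "Linf_matrix (region D) A" and elliptic: "uniformly_elliptic (region D) A"
    and \<epsilon>: "0 < \<epsilon>" "\<epsilon> \<le> 1" and cordes: "cordes (region D) \<epsilon> A" and f: "L2_fun (region D) f"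
begin

abbreviation \<gamma> :: "real^'n \<Rightarrow> real" where "\<gamma> \<equiv> gamma_coeff A"

abbreviation G :: real where "G \<equiv> Linf_norm_on (region D) \<gamma>"

abbreviation load :: "(real^'n \<Rightarrow> real) \<Rightarrow> real" where
  "load v \<equiv> \<Sum>K\<in>elems T. ip_elem K (\<lambda>x. \<gamma> x * f x) (laplacian v)"

lemma elem_lmeasurable: "K \<in> elems T \<Longrightarrow> K \<in> lmeasurable"
  by (rule lmeasurable_open[OF elem(3,1)])

lemma AE_on_elem:
  assumes "AE x in lebesgue_on (region D). P x" "K \<in> elems T"
  shows "AE x in lebesgue_on K. P x"
  by (rule AE_lebesgue_on_subset[OF assms(1) elem_subset[OF assms(2)]])
    (use elem_lmeasurable[OF assms(2)] region_facts(4) in auto)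

lemma \<gamma>_measurable: "\<gamma> \<in> borel_measurable (lebesgue_on (region D))"
proof -
  have A: "A \<in> borel_measurable (lebesgue_on (region D))" using Linf by (simp add: Linf_matrix_def)
  have "(\<lambda>x. mat 1 \<bullet> A x) \<in> borel_measurable (lebesgue_on (region D))"
    by (intro borel_measurable_inner borel_measurable_const A)
  moreover have "(\<lambda>x. (norm (A x))\<^sup>2) \<in> borel_measurable (lebesgue_on (region D))"
    by (intro borel_measurable_power measurable_compose[OF A borel_measurable_norm])
  ultimately have "(\<lambda>x. (mat 1 \<bullet> A x) / (norm (A x))\<^sup>2) \<in> borel_measurable (lebesgue_on (region D))"
    by (rule borel_measurable_divide)
  then show ?thesis unfolding gamma_coeff_def[abs_def] inner_mat_1 .
qed

lemma coefficient_bounds: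
  obtains c C where "0 < c" "AE x in lebesgue_on (region D). c \<le> trace (A x) \<and> \<bar>\<gamma> x\<bar> \<le> real CARD('n) / c"
    "AE x in lebesgue_on (region D). norm (A x) \<le> C"
proof -
  obtain c C where c: "0 < c" "AE x in lebesgue_on (region D).
     \<forall>z. c * (norm z)\<^sup>2 \<le> z \<bullet> (A x *v z) \<and> z \<bullet> (A x *v z) \<le> C * (norm z)\<^sup>2"
    using elliptic unfolding uniformly_elliptic_def by blast
  obtain C' where C': "AE x in lebesgue_on (region D). norm (A x) \<le> C'"
    using Linf unfolding Linf_matrix_def by blast
  have "AE x in lebesgue_on (region D). c \<le> trace (A x) \<and> \<bar>\<gamma> x\<bar> \<le> real CARD('n) / c"
    using c(2)
  proof eventually_elim
    case (elim x)
    then have e: "\<And>z. c * (norm z)\<^sup>2 \<le> z \<bullet> (A x *v z)" by blast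
    show ?case unfolding gamma_coeff_def using elliptic_trace[OF c(1) e] by blast
  qed
  then show ?thesis by (rule that[OF c(1) _ C'])
qed

lemma \<gamma>_le_G: "AE x in lebesgue_on (region D). \<bar>\<gamma> x\<bar> \<le> G"
proof -
  let ?M = "lebesgue_on (region D)" and ?g = "\<lambda>x. ereal \<bar>\<gamma> x\<bar>"
  obtain c where c: "AE x in ?M. c \<le> trace (A x) \<and> \<bar>\<gamma> x\<bar> \<le> real CARD('n) / c"
    by (rule coefficient_bounds) blast
  have "?g \<in> borel_measurable ?M" using \<gamma>_measurable by measurable
  moreover have "AE x in ?M. ?g x \<le> ereal (real CARD('n) / c)" using c by eventually_elim simp
  ultimately have up: "esssup ?M ?g \<le> ereal (real CARD('n) / c)" by (rule esssup_I)
  show ?thesis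
    using esssup_AE[of ?g ?M]
  proof eventually_elim
    case (elim x)
    show ?case using elim up unfolding Linf_norm_on_def by (cases "esssup ?M ?g") auto
  qed
qed

lemma G_nonneg: "0 \<le> G"
proof (rule ccontr)
  assume "\<not> 0 \<le> G"
  then have "AE x in lebesgue_on (region D). False"
    by (intro eventually_mono[OF \<gamma>_le_G]) linarith
  then have "AE x in lebesgue. x \<notin> region D" using region_facts(4) by (subst (asm) AE_restrict_space_iff) auto
  then have "region D \<in> null_sets lebesgue" using region_facts(4) by (subst AE_iff_null_sets) auto
  then show False using open_not_negligible[OF region_facts(1,3)] by (simp add: negligible_iff_null_sets)
qed

lemma cordes_AE:
  "AE x in lebesgue_on (region D). \<forall>M. (\<gamma> x * (A x \<bullet> M) - trace M)\<^sup>2 \<le> (1 - \<epsilon>) * (norm M)\<^sup>2"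
proof -
  obtain c where c: "0 < c" "AE x in lebesgue_on (region D). c \<le> trace (A x) \<and> \<bar>\<gamma> x\<bar> \<le> real CARD('n) / c"
    by (rule coefficient_bounds) blast
  have "AE x in lebesgue_on (region D). (norm (A x))\<^sup>2 / (trace (A x))\<^sup>2 \<le> 1 / (real CARD('n) - 1 + \<epsilon>)"
    using cordes by (simp add: cordes_def)
  with c(2) show ?thesis
  proof eventually_elim
    case (elim x)
    have "trace (A x) \<noteq> 0" using elim(1) c(1) by auto
    then show ?case unfolding gamma_coeff_def using cordes_pointwise[OF _ \<epsilon>(1) elim(2)] by blast
  qed
qed

lemma lin_op_nondivergence:
  assumes K: "K \<in> elems T"
  shows "lin_op (lebesgue_on K) V (\<lambda>u x. \<gamma> x * (A x \<bullet> hess u x))"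
proof -
  note l = lin_op_hess[OF K]
  obtain C where C: "AE x in lebesgue_on (region D). norm (A x) \<le> C"
    by (rule coefficient_bounds) blast
  have A: "A \<in> borel_measurable (lebesgue_on (region D))" using Linf by (simp add: Linf_matrix_def)
  have m: "\<gamma> \<in> borel_measurable (lebesgue_on K)" "A \<in> borel_measurable (lebesgue_on K)"
    by (rule measurable_restrict_mono[OF _ elem_subset[OF K]], rule \<gamma>_measurable A)+
  have "(\<lambda>x. \<gamma> x * (A x \<bullet> hess u x)) \<in> borel_measurable (lebesgue_on K) \<and>
      (\<exists>C. AE x in lebesgue_on K. norm (\<gamma> x * (A x \<bullet> hess u x)) \<le> C)" if u: "u \<in> V" for u
  proof
    have mh: "hess u \<in> borel_measurable (lebesgue_on K)" using l u unfolding lin_op_def by blast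
    show "(\<lambda>x. \<gamma> x * (A x \<bullet> hess u x)) \<in> borel_measurable (lebesgue_on K)"
      by (intro borel_measurable_times borel_measurable_inner m mh)
    obtain B where B: "AE x in lebesgue_on K. norm (hess u x) \<le> B" using l u unfolding lin_op_def by blast
    have "AE x in lebesgue_on K. norm (\<gamma> x * (A x \<bullet> hess u x)) \<le> G * (C * B)"
      using AE_on_elem[OF \<gamma>_le_G K] AE_on_elem[OF C K] B
    proof eventually_elim
      case (elim x)
      have "\<bar>A x \<bullet> hess u x\<bar> \<le> norm (A x) * norm (hess u x)" by (rule Cauchy_Schwarz_ineq2)
      also have "\<dots> \<le> C * B"
        by (rule mult_mono[OF elim(2,3) order_trans[OF norm_ge_zero elim(2)] norm_ge_zero])
      finally have "\<bar>\<gamma> x\<bar> * \<bar>A x \<bullet> hess u x\<bar> \<le> G * (C * B)"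
        by (rule mult_mono[OF elim(1) _ G_nonneg abs_ge_zero])
      then show ?case by (simp add: abs_mult)
    qed
    then show "\<exists>C. AE x in lebesgue_on K. norm (\<gamma> x * (A x \<bullet> hess u x)) \<le> C" ..
  qed
  moreover have "AE x in lebesgue_on K. \<gamma> x * (A x \<bullet> hess (\<lambda>y. a * u y + b * v y) x)
      = a *\<^sub>R (\<gamma> x * (A x \<bullet> hess u x)) + b *\<^sub>R (\<gamma> x * (A x \<bullet> hess v x))" if "u \<in> V" "v \<in> V" for u v a b
  proof -
    have "AE x in lebesgue_on K. hess (\<lambda>y. a * u y + b * v y) x = a *\<^sub>R hess u x + b *\<^sub>R hess v x"
      using l that unfolding lin_op_def by blast
    then show ?thesis by eventually_elim (simp add: inner_add_right algebra_simps)
  qed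
  moreover have "finite_measure (lebesgue_on K)" using l unfolding lin_op_def by blast
  ultimately show ?thesis unfolding lin_op_def by blast
qed

lemma bilin_A_form: "bilin V (A_form D T \<mu> \<eta> A)"
  unfolding A_form_def[abs_def] ip_elem_def
  by (intro bilin_diff bilin_add bilin_sum bilin_integral V_closed lin_op_nondivergence lin_op_laplacian
    bilin_B_theta bilin_lap_form)

lemma nondivergence_lower_bound:
  assumes v: "v \<in> V" and K: "K \<in> elems T"
  shows "ip_elem K (\<lambda>x. \<gamma> x * (A x \<bullet> hess v x)) (laplacian v) - ip_elem K (laplacian v) (laplacian v)
    \<ge> - ((1 - \<epsilon>) / 2) * ip_elem K (hess v) (hess v) - 1 / 2 * ip_elem K (laplacian v) (laplacian v)"
proof -
  let ?M = "lebesgue_on K"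
  note h = lin_op_hess[OF K] and l = lin_op_laplacian[OF K] and nd = lin_op_nondivergence[OF K]
  have i: "integrable ?M (\<lambda>x. hess v x \<bullet> hess v x)" "integrable ?M (\<lambda>x. laplacian v x \<bullet> laplacian v x)"
    "integrable ?M (\<lambda>x. (\<gamma> x * (A x \<bullet> hess v x)) \<bullet> laplacian v x)"
    by (rule lin_op_integrable[OF h h v v], rule lin_op_integrable[OF l l v v], rule lin_op_integrable[OF nd l v v])
  have "- ((1 - \<epsilon>) / 2) * ip_elem K (hess v) (hess v) - 1 / 2 * ip_elem K (laplacian v) (laplacian v)
      = (\<integral>x. - ((1 - \<epsilon>) / 2) * (hess v x \<bullet> hess v x) - 1 / 2 * (laplacian v x \<bullet> laplacian v x) \<partial>?M)"
    unfolding ip_elem_def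
    by (subst Bochner_Integration.integral_diff) (use i in \<open>simp_all only: integral_mult_right_zero integrable_mult_right\<close>)
  also have "\<dots> \<le> (\<integral>x. (\<gamma> x * (A x \<bullet> hess v x)) \<bullet> laplacian v x - laplacian v x \<bullet> laplacian v x \<partial>?M)"
  proof (rule integral_mono_AE)
    show "integrable ?M (\<lambda>x. - ((1 - \<epsilon>) / 2) * (hess v x \<bullet> hess v x) - 1 / 2 * (laplacian v x \<bullet> laplacian v x))"
      by (intro Bochner_Integration.integrable_diff integrable_mult_right i)
    show "integrable ?M (\<lambda>x. (\<gamma> x * (A x \<bullet> hess v x)) \<bullet> laplacian v x - laplacian v x \<bullet> laplacian v x)"
      by (intro Bochner_Integration.integrable_diff i)
    show "AE x in ?M. - ((1 - \<epsilon>) / 2) * (hess v x \<bullet> hess v x) - 1 / 2 * (laplacian v x \<bullet> laplacian v x)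
        \<le> (\<gamma> x * (A x \<bullet> hess v x)) \<bullet> laplacian v x - laplacian v x \<bullet> laplacian v x"
      using AE_on_elem[OF cordes_AE K]
    proof eventually_elim
      case (elim x)
      let ?q = "\<gamma> x * (A x \<bullet> hess v x)" and ?l = "laplacian v x"
      have "(?q - ?l)\<^sup>2 \<le> (1 - \<epsilon>) * (hess v x \<bullet> hess v x)"
        using elim by (simp only: laplacian_def power2_norm_eq_inner[symmetric])
      moreover have "0 \<le> (?q - ?l + ?l)\<^sup>2" by simp
      moreover have "(?q - ?l + ?l)\<^sup>2 = (?q - ?l)\<^sup>2 + 2 * (?q * ?l - ?l * ?l) + ?l * ?l"
        by (simp add: power2_eq_square algebra_simps)
      ultimately have "0 \<le> (1 - \<epsilon>) * (hess v x \<bullet> hess v x) + 2 * (?q * ?l - ?l * ?l) + ?l * ?l" by linarith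
      then show ?case by simp
    qed
  qed
  also have "\<dots> = ip_elem K (\<lambda>x. \<gamma> x * (A x \<bullet> hess v x)) (laplacian v) - ip_elem K (laplacian v) (laplacian v)"
    unfolding ip_elem_def by (rule Bochner_Integration.integral_diff[OF i(3,2)])
  finally show ?thesis .
qed

text \<open>Young's inequality is used with equal weights, so that the term in the Laplacian is absorbed by
  \<open>B\<^sub>1\<^sub>/\<^sub>2\<close>; what remains is controlled by the stability estimate for \<open>\<theta> = 1\<close>.\<close>

lemma coercivity:
  assumes v: "v \<in> V" and \<kappa>: "1 < \<kappa>" and J: "0 \<le> J_form D T \<mu> \<eta> v v"
    and stab: "\<kappa> * B_theta D T \<mu> \<eta> 1 v v
      \<ge> H2_broken_sq T v + 1 / 2 * J_form D T \<mu> \<eta> v v + 1 / 2 * curv_sq D T v"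
  shows "(1 - \<kappa> * (1 - \<epsilon>)) * (norm_h1 D T \<mu> \<eta> \<kappa> v)\<^sup>2 \<le> 2 * \<kappa> * A_form D T \<mu> \<eta> A v v"
proof -
  let ?H = "H2_broken_sq T v" and ?J = "J_form D T \<mu> \<eta> v v" and ?C = "curv_sq D T v" and ?a = "1 - \<kappa> * (1 - \<epsilon>)"
  let ?N = "\<Sum>K\<in>elems T. ip_elem K (\<lambda>x. \<gamma> x * (A x \<bullet> hess v x)) (laplacian v)"
  have "(\<Sum>K\<in>elems T. - ((1 - \<epsilon>) / 2) * ip_elem K (hess v) (hess v) - 1 / 2 * ip_elem K (laplacian v) (laplacian v))
      \<le> (\<Sum>K\<in>elems T. ip_elem K (\<lambda>x. \<gamma> x * (A x \<bullet> hess v x)) (laplacian v) - ip_elem K (laplacian v) (laplacian v))"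
    by (intro sum_mono nondivergence_lower_bound v)
  then have "- ((1 - \<epsilon>) / 2) * ?H - 1 / 2 * lap_form T v v \<le> ?N - lap_form T v v"
    unfolding H2_broken_sq_def lap_form_def by (simp only: sum_subtractf sum_distrib_left)
  moreover have "- ((1 - \<epsilon>) / 2) * ?H = - (1 / 2 * ((1 - \<epsilon>) * ?H))" by simp
  ultimately have "- (1 / 2 * ((1 - \<epsilon>) * ?H)) - 1 / 2 * lap_form T v v \<le> ?N - lap_form T v v" by simp
  then have "A_form D T \<mu> \<eta> A v v \<ge> - (1 / 2 * ((1 - \<epsilon>) * ?H)) + 1 / 2 * B_star D T v v + ?J"
    unfolding A_form_def B_theta_def by simp
  then have "2 * A_form D T \<mu> \<eta> A v v \<ge> - ((1 - \<epsilon>) * ?H) + B_star D T v v + 2 * ?J" by linarith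
  then have "\<kappa> * (2 * A_form D T \<mu> \<eta> A v v) \<ge> \<kappa> * (- ((1 - \<epsilon>) * ?H) + B_star D T v v + 2 * ?J)"
    using \<kappa> by (intro mult_left_mono) simp_all
  moreover have "\<kappa> * (B_star D T v v + ?J) \<ge> ?H + 1 / 2 * ?J + 1 / 2 * ?C"
    using stab by (simp add: B_theta_def)
  ultimately have A: "2 * \<kappa> * A_form D T \<mu> \<eta> A v v \<ge> ?a * ?H + 1 / 2 * ?C + (\<kappa> + 1 / 2) * ?J"
    by (simp add: algebra_simps)
  have H: "0 \<le> ?H" and C: "0 \<le> ?C" by (rule H2_broken_sq_nonneg, rule curv_sq_nonneg)
  have a1: "?a \<le> 1" using \<kappa> \<epsilon> by simp
  have "(norm_h1 D T \<mu> \<eta> \<kappa> v)\<^sup>2 = ?H + 1 / 2 * ?C + \<kappa> / 2 * ?J"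
    unfolding norm_h1_def using H C J \<kappa> by (intro real_sqrt_pow2) simp
  then have "?a * (norm_h1 D T \<mu> \<eta> \<kappa> v)\<^sup>2 = ?a * ?H + ?a * (1 / 2 * ?C + \<kappa> / 2 * ?J)"
    by (simp add: algebra_simps)
  also have "?a * (1 / 2 * ?C + \<kappa> / 2 * ?J) \<le> 1 * (1 / 2 * ?C + \<kappa> / 2 * ?J)"
    using a1 C J \<kappa> by (intro mult_right_mono) auto
  also have "\<kappa> / 2 * ?J \<le> (\<kappa> + 1 / 2) * ?J" using J \<kappa> by (intro mult_right_mono) auto
  finally show ?thesis using A by simp
qed

lemma f_integrable_on_elem:
  assumes K: "K \<in> elems T"
  shows "f \<in> borel_measurable (lebesgue_on K)" "integrable (lebesgue_on K) (\<lambda>x. (f x)\<^sup>2)" "integrable (lebesgue_on K) f"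
proof -
  show m: "f \<in> borel_measurable (lebesgue_on K)"
    by (rule measurable_restrict_mono[OF _ elem_subset[OF K]]) (use f in \<open>simp add: L2_fun_def\<close>)
  have sK: "K \<in> sets lebesgue" using elem_lmeasurable[OF K] by auto
  have s\<Omega>: "region D \<in> sets lebesgue" using region_facts(4) by auto
  have "integrable lebesgue (\<lambda>x. indicator (region D) x *\<^sub>R (f x)\<^sup>2)"
    using f s\<Omega> by (simp add: L2_fun_def integrable_restrict_space)
  from integrable_mult_indicator[OF sK this]
  have "integrable lebesgue (\<lambda>x. indicator K x *\<^sub>R indicator (region D) x *\<^sub>R (f x)\<^sup>2)" .
  moreover have "(\<lambda>x. indicator K x *\<^sub>R indicator (region D) x *\<^sub>R (f x)\<^sup>2) = (\<lambda>x. indicator K x *\<^sub>R (f x)\<^sup>2)"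
    using elem_subset[OF K] by (intro ext) (auto simp: indicator_def)
  ultimately have "integrable lebesgue (\<lambda>x. indicator K x *\<^sub>R (f x)\<^sup>2)" by (simp only:)
  then show i: "integrable (lebesgue_on K) (\<lambda>x. (f x)\<^sup>2)" using sK by (subst integrable_restrict_space) simp_all
  have fin: "finite_measure (lebesgue_on K)" by (rule finite_measure_lebesgue_on[OF elem_lmeasurable[OF K]])
  show "integrable (lebesgue_on K) f"
  proof (rule Bochner_Integration.integrable_bound)
    show "integrable (lebesgue_on K) (\<lambda>x. 1 + (f x)\<^sup>2)"
      by (intro Bochner_Integration.integrable_add finite_measure.integrable_const[OF fin] i)
    show "AE x in lebesgue_on K. norm (f x) \<le> norm (1 + (f x)\<^sup>2)"
    proof (rule AE_I2)
      fix x
      have "0 \<le> (1 - \<bar>f x\<bar>)\<^sup>2" by simp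
      then have "2 * \<bar>f x\<bar> \<le> 1 + (f x)\<^sup>2" by (simp add: power2_diff)
      moreover have "\<bar>1 + (f x)\<^sup>2\<bar> = 1 + (f x)\<^sup>2" by (rule abs_of_nonneg) simp
      ultimately show "norm (f x) \<le> norm (1 + (f x)\<^sup>2)" unfolding real_norm_def by linarith
    qed
  qed (rule m)
qed

lemma load_integrable:
  assumes K: "K \<in> elems T" and v: "v \<in> V"
  shows "integrable (lebesgue_on K) (\<lambda>x. (\<gamma> x * f x) * laplacian v x)"
proof -
  note fi = f_integrable_on_elem[OF K]
  have l: "laplacian v \<in> borel_measurable (lebesgue_on K)" "\<exists>C. AE x in lebesgue_on K. norm (laplacian v x) \<le> C"
    using lin_op_laplacian[OF K] v unfolding lin_op_def by blast+
  obtain C where C: "AE x in lebesgue_on K. norm (laplacian v x) \<le> C" using l(2) by blast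
  have m\<gamma>: "\<gamma> \<in> borel_measurable (lebesgue_on K)" by (rule measurable_restrict_mono[OF \<gamma>_measurable elem_subset[OF K]])
  show ?thesis
  proof (rule Bochner_Integration.integrable_bound)
    show "integrable (lebesgue_on K) (\<lambda>x. (G * C) * f x)" by (intro integrable_mult_right fi)
    show "(\<lambda>x. (\<gamma> x * f x) * laplacian v x) \<in> borel_measurable (lebesgue_on K)"
      by (intro borel_measurable_times m\<gamma> fi l)
    show "AE x in lebesgue_on K. norm ((\<gamma> x * f x) * laplacian v x) \<le> norm ((G * C) * f x)"
      using AE_on_elem[OF \<gamma>_le_G K] C
    proof eventually_elim
      case (elim x)
      have C0: "0 \<le> C" using elim(2) by (rule order_trans[OF norm_ge_zero])
      have "\<bar>\<gamma> x\<bar> * \<bar>laplacian v x\<bar> \<le> G * C" using elim C0 G_nonneg by (intro mult_mono) auto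
      then have "(\<bar>\<gamma> x\<bar> * \<bar>laplacian v x\<bar>) * \<bar>f x\<bar> \<le> (G * C) * \<bar>f x\<bar>" by (rule mult_right_mono) simp
      then show ?case unfolding real_norm_def abs_mult abs_of_nonneg[OF G_nonneg] abs_of_nonneg[OF C0] by argo
    qed
  qed
qed

lemma lin_functional_load: "lin_functional V load"
  unfolding lin_functional_def
proof (intro ballI allI)
  fix u v a b assume u: "u \<in> V" and v: "v \<in> V"
  have "ip_elem K (\<lambda>x. \<gamma> x * f x) (laplacian (\<lambda>x. a * u x + b * v x))
      = a * ip_elem K (\<lambda>x. \<gamma> x * f x) (laplacian u) + b * ip_elem K (\<lambda>x. \<gamma> x * f x) (laplacian v)"
    if K: "K \<in> elems T" for K
  proof -
    note i = load_integrable[OF K u] load_integrable[OF K v] load_integrable[OF K lincomb_closedD[OF V_closed u v]]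
    have "AE x in lebesgue_on K. laplacian (\<lambda>y. a * u y + b * v y) x = a *\<^sub>R laplacian u x + b *\<^sub>R laplacian v x"
      using lin_op_laplacian[OF K] u v unfolding lin_op_def by blast
    then have ae: "AE x in lebesgue_on K. (\<gamma> x * f x) * laplacian (\<lambda>y. a * u y + b * v y) x
        = a * ((\<gamma> x * f x) * laplacian u x) + b * ((\<gamma> x * f x) * laplacian v x)"
      by eventually_elim (simp add: algebra_simps)
    have "(\<integral>x. (\<gamma> x * f x) * laplacian (\<lambda>y. a * u y + b * v y) x \<partial>lebesgue_on K)
        = (\<integral>x. a * ((\<gamma> x * f x) * laplacian u x) + b * ((\<gamma> x * f x) * laplacian v x) \<partial>lebesgue_on K)"
    proof (rule integral_cong_AE[OF _ _ ae])
      show "(\<lambda>x. (\<gamma> x * f x) * laplacian (\<lambda>y. a * u y + b * v y) x) \<in> borel_measurable (lebesgue_on K)"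
        by (rule borel_measurable_integrable[OF i(3)])
      show "(\<lambda>x. a * ((\<gamma> x * f x) * laplacian u x) + b * ((\<gamma> x * f x) * laplacian v x)) \<in> borel_measurable (lebesgue_on K)"
        by (intro borel_measurable_add borel_measurable_times borel_measurable_const
          borel_measurable_integrable[OF i(1)] borel_measurable_integrable[OF i(2)])
    qed
    also have "\<dots> = a * (\<integral>x. (\<gamma> x * f x) * laplacian u x \<partial>lebesgue_on K)
        + b * (\<integral>x. (\<gamma> x * f x) * laplacian v x \<partial>lebesgue_on K)"
      using i by simp
    finally show ?thesis by (simp add: ip_elem_def)
  qed
  then show "load (\<lambda>x. a * u x + b * v x) = a * load u + b * load v"
    by (simp add: sum.distrib sum_distrib_left)
qed

lemma L2_norm_elems: "(\<Sum>K\<in>elems T. \<integral>x. (f x)\<^sup>2 \<partial>lebesgue_on K) \<le> (L2_norm_on (region D) f)\<^sup>2"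
proof -
  have s: "K \<in> sets lebesgue" if "K \<in> elems T" for K using elem_lmeasurable[OF that] by auto
  have s\<Omega>: "region D \<in> sets lebesgue" using region_facts(4) by auto
  have i: "integrable lebesgue (\<lambda>x. indicator K x *\<^sub>R (f x)\<^sup>2)" if "K \<in> elems T" for K
    using f_integrable_on_elem(2)[OF that] s[OF that] by (simp add: integrable_restrict_space)
  have i\<Omega>: "integrable lebesgue (\<lambda>x. indicator (region D) x *\<^sub>R (f x)\<^sup>2)"
    using f s\<Omega> by (simp add: L2_fun_def integrable_restrict_space)
  have "(\<Sum>K\<in>elems T. \<integral>x. (f x)\<^sup>2 \<partial>lebesgue_on K) = (\<Sum>K\<in>elems T. \<integral>x. indicator K x *\<^sub>R (f x)\<^sup>2 \<partial>lebesgue)"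
    by (intro sum.cong refl integral_restrict_space) (use s in auto)
  also have "\<dots> = (\<integral>x. (\<Sum>K\<in>elems T. indicator K x *\<^sub>R (f x)\<^sup>2) \<partial>lebesgue)"
    by (rule Bochner_Integration.integral_sum[symmetric]) (rule i)
  also have "\<dots> \<le> (\<integral>x. indicator (region D) x *\<^sub>R (f x)\<^sup>2 \<partial>lebesgue)"
  proof (rule integral_mono[OF _ i\<Omega>])
    show "integrable lebesgue (\<lambda>x. \<Sum>K\<in>elems T. indicator K x *\<^sub>R (f x)\<^sup>2)"
      by (rule Bochner_Integration.integrable_sum) (rule i)
    fix x
    have "disjoint_family_on (\<lambda>K. K) (elems T)"
      using disjoint_elems by (auto simp: disjoint_family_on_def disjoint_def)
    then have "(\<Sum>K\<in>elems T. indicator K x) = (indicator (\<Union>K\<in>elems T. K) x :: real)"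
      by (rule indicator_UN_disjoint[OF finite_elems, symmetric])
    then have "(\<Sum>K\<in>elems T. indicator K x *\<^sub>R (f x)\<^sup>2) = indicator (\<Union>K\<in>elems T. K) x *\<^sub>R (f x)\<^sup>2"
      by (simp only: scaleR_sum_left[symmetric])
    also have "\<dots> \<le> indicator (region D) x *\<^sub>R (f x)\<^sup>2"
      using elem_subset by (auto simp: indicator_def)
    finally show "(\<Sum>K\<in>elems T. indicator K x *\<^sub>R (f x)\<^sup>2) \<le> indicator (region D) x *\<^sub>R (f x)\<^sup>2" .
  qed
  also have "\<dots> = (\<integral>x. (f x)\<^sup>2 \<partial>lebesgue_on (region D))"
    by (rule integral_restrict_space[symmetric]) (use s\<Omega> in auto)
  also have "\<dots> = (L2_norm_on (region D) f)\<^sup>2"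
    unfolding L2_norm_on_def by (rule real_sqrt_pow2[symmetric]) simp
  finally show ?thesis .
qed

lemma load_bound:
  assumes v: "v \<in> V"
  shows "load v \<le> G * sqrt (real CARD('n)) * (L2_norm_on (region D) f * sqrt (H2_broken_sq T v))"
proof (rule young_optimize)
  show "0 \<le> L2_norm_on (region D) f" by (simp add: L2_norm_on_def)
  show "0 \<le> sqrt (H2_broken_sq T v)" by (simp add: H2_broken_sq_nonneg)
  show c0: "0 \<le> G * sqrt (real CARD('n))" using G_nonneg by simp
  fix s :: real assume s: "0 < s"
  let ?c = "G * sqrt (real CARD('n))"
  have "ip_elem K (\<lambda>x. \<gamma> x * f x) (laplacian v)
      \<le> ?c * (s / 2 * (\<integral>x. (f x)\<^sup>2 \<partial>lebesgue_on K) + ip_elem K (hess v) (hess v) / (2 * s))" if K: "K \<in> elems T" for K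
  proof -
    let ?M = "lebesgue_on K"
    note f2 = f_integrable_on_elem(2)[OF K]
    note h2 = lin_op_integrable[OF lin_op_hess[OF K] lin_op_hess[OF K] v v]
    have "ip_elem K (\<lambda>x. \<gamma> x * f x) (laplacian v)
        \<le> (\<integral>x. ?c * (s / 2) * (f x)\<^sup>2 + ?c * (1 / (2 * s)) * (hess v x \<bullet> hess v x) \<partial>?M)"
      unfolding ip_elem_def inner_real_def
    proof (rule integral_mono_AE[OF load_integrable[OF K v]])
      show "integrable ?M (\<lambda>x. ?c * (s / 2) * (f x)\<^sup>2 + ?c * (1 / (2 * s)) * (hess v x \<bullet> hess v x))"
        by (intro Bochner_Integration.integrable_add integrable_mult_right f2 h2)
      show "AE x in ?M. (\<gamma> x * f x) * laplacian v x
          \<le> ?c * (s / 2) * (f x)\<^sup>2 + ?c * (1 / (2 * s)) * (hess v x \<bullet> hess v x)"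
        using AE_on_elem[OF \<gamma>_le_G K]
      proof eventually_elim
        case (elim x)
        let ?h = "norm (hess v x)"
        have "\<bar>laplacian v x\<bar> \<le> sqrt (real CARD('n)) * ?h"
          using real_sqrt_le_mono[OF trace_power2_le[of "hess v x"]]
          by (simp add: laplacian_def real_sqrt_mult)
        then have "\<bar>\<gamma> x\<bar> * \<bar>laplacian v x\<bar> \<le> G * (sqrt (real CARD('n)) * ?h)"
          using elim G_nonneg by (intro mult_mono) auto
        then have "(\<bar>\<gamma> x\<bar> * \<bar>laplacian v x\<bar>) * \<bar>f x\<bar> \<le> (G * (sqrt (real CARD('n)) * ?h)) * \<bar>f x\<bar>"
          by (rule mult_right_mono) simp
        then have "(\<gamma> x * f x) * laplacian v x \<le> ?c * (\<bar>f x\<bar> * ?h)"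
          using abs_ge_self[of "(\<gamma> x * f x) * laplacian v x"] by (simp add: abs_mult ac_simps)
        also have "\<dots> \<le> ?c * (s / 2 * (f x)\<^sup>2 + 1 / (2 * s) * (hess v x \<bullet> hess v x))"
        proof (rule mult_left_mono[OF _ c0])
          have "0 \<le> (s * \<bar>f x\<bar> - ?h)\<^sup>2" by simp
          then have "2 * s * (\<bar>f x\<bar> * ?h) \<le> s * s * (f x)\<^sup>2 + ?h\<^sup>2"
            by (simp add: power2_diff power_mult_distrib power2_eq_square algebra_simps)
          then have "\<bar>f x\<bar> * ?h \<le> (s * s * (f x)\<^sup>2 + ?h\<^sup>2) / (2 * s)"
            using s by (simp add: le_divide_eq mult.commute mult.left_commute)
          also have "\<dots> = s / 2 * (f x)\<^sup>2 + 1 / (2 * s) * ?h\<^sup>2" using s by (simp add: field_simps)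
          finally show "\<bar>f x\<bar> * ?h \<le> s / 2 * (f x)\<^sup>2 + 1 / (2 * s) * (hess v x \<bullet> hess v x)"
            by (simp only: power2_norm_eq_inner)
        qed
        finally show ?case by (simp only: distrib_left mult.assoc)
      qed
    qed
    also have "\<dots> = ?c * (s / 2) * (\<integral>x. (f x)\<^sup>2 \<partial>?M) + ?c * (1 / (2 * s)) * (\<integral>x. hess v x \<bullet> hess v x \<partial>?M)"
      by (subst Bochner_Integration.integral_add)
        (use f2 h2 in \<open>simp_all only: integral_mult_right_zero integrable_mult_right\<close>)
    also have "\<dots> = ?c * (s / 2 * (\<integral>x. (f x)\<^sup>2 \<partial>?M) + ip_elem K (hess v) (hess v) / (2 * s))"
      by (simp add: ip_elem_def algebra_simps)
    finally show ?thesis .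
  qed
  then have "load v \<le> (\<Sum>K\<in>elems T. ?c * (s / 2 * (\<integral>x. (f x)\<^sup>2 \<partial>lebesgue_on K) + ip_elem K (hess v) (hess v) / (2 * s)))"
    by (rule sum_mono)
  also have "\<dots> = ?c * (s / 2 * (\<Sum>K\<in>elems T. \<integral>x. (f x)\<^sup>2 \<partial>lebesgue_on K) + H2_broken_sq T v / (2 * s))"
    unfolding H2_broken_sq_def by (simp only: sum_distrib_left[symmetric] sum.distrib sum_divide_distrib[symmetric])
  also have "\<dots> \<le> ?c * (s / 2 * (L2_norm_on (region D) f)\<^sup>2 + (sqrt (H2_broken_sq T v))\<^sup>2 / (2 * s))"
    using L2_norm_elems s c0 by (intro mult_left_mono add_mono) (simp_all add: H2_broken_sq_nonneg)
  finally show "load v \<le> ?c * (s / 2 * (L2_norm_on (region D) f)\<^sup>2 + (sqrt (H2_broken_sq T v))\<^sup>2 / (2 * s))" .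
qed

lemma V_nonempty: "V \<noteq> {}"
proof -
  have "(\<lambda>x. 0) \<in> V"
    unfolding dg_space_def
  proof (intro CollectI conjI ballI)
    show "L2_fun (region D) (\<lambda>x. 0)" by (simp add: L2_fun_def)
    show "\<exists>\<rho>\<in>poly_space k p. \<forall>x\<in>K. 0 = \<rho> (inv_into (refel T) (elem_map T K) x)" for K
    proof
      show "(\<lambda>x. \<Sum>m\<in>exponents k p. 0 * (\<Prod>i\<in>UNIV. x $ i ^ m i)) \<in> poly_space k p"
        unfolding poly_space_def by (intro CollectI exI[of _ "\<lambda>m. 0"] refl)
    qed simp
  qed simp
  then show ?thesis by blast
qed

lemma well_posed:
  assumes "1 < \<kappa>" and small: "0 < 1 - \<kappa> * (1 - \<epsilon>)"
    and \<mu>: "\<And>F. F \<in> faces T \<Longrightarrow> 0 < \<mu> F" and \<eta>: "\<And>F. F \<in> faces T \<Longrightarrow> 0 < \<eta> F"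
    and coer: "\<And>v. v \<in> V \<Longrightarrow> (1 - \<kappa> * (1 - \<epsilon>)) * (norm_h1 D T \<mu> \<eta> \<kappa> v)\<^sup>2 \<le> 2 * \<kappa> * A_form D T \<mu> \<eta> A v v"
  shows "\<exists>!u. u \<in> V \<and> (\<forall>v\<in>V. A_form D T \<mu> \<eta> A u v = load v)"
proof (rule lax_milgram_finite[OF V_closed bilin_A_form _ _ _ V_nonempty lin_functional_load])
  fix v assume v: "v \<in> V" "v \<noteq> (\<lambda>x. 0)"
  show "0 < A_form D T \<mu> \<eta> A v v"
  proof (rule ccontr)
    assume "\<not> 0 < A_form D T \<mu> \<eta> A v v"
    then have "2 * \<kappa> * A_form D T \<mu> \<eta> A v v \<le> 0" using assms(1) by (simp add: mult_le_0_iff)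
    then have "(1 - \<kappa> * (1 - \<epsilon>)) * (norm_h1 D T \<mu> \<eta> \<kappa> v)\<^sup>2 \<le> 0" using coer[OF v(1)] by linarith
    then have n0: "(norm_h1 D T \<mu> \<eta> \<kappa> v)\<^sup>2 \<le> 0" using small by (simp only: mult_le_0_iff) auto
    have J: "0 \<le> J_form D T \<mu> \<eta> v v" by (rule J_form_nonneg) (use \<mu> \<eta> in \<open>auto intro: less_imp_le\<close>)
    have H: "0 \<le> H2_broken_sq T v" and C: "0 \<le> curv_sq D T v" by (rule H2_broken_sq_nonneg, rule curv_sq_nonneg)
    have kJ: "0 \<le> \<kappa> / 2 * J_form D T \<mu> \<eta> v v" using J assms(1) by simp
    have "(norm_h1 D T \<mu> \<eta> \<kappa> v)\<^sup>2 = H2_broken_sq T v + 1 / 2 * curv_sq D T v + \<kappa> / 2 * J_form D T \<mu> \<eta> v v"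
      unfolding norm_h1_def using H C kJ by (intro real_sqrt_pow2) simp
    then have "H2_broken_sq T v = 0" "\<kappa> / 2 * J_form D T \<mu> \<eta> v v = 0" using n0 H C kJ by linarith+
    then have "v = (\<lambda>x. 0)" using norm_definite[OF v(1) _ _ \<mu> \<eta>] assms(1) by simp
    then show False using v(2) by simp
  qed
next
  show "finite (elems T \<times> exponents k p)" using finite_elems finite_exponents by (rule finite_cartesian_product)
  show "dg_basis T i \<in> V" if "i \<in> elems T \<times> exponents k p" for i
    by (rule dg_basis_mem[OF mesh region_facts(4) that])
  show "\<exists>c. v = (\<lambda>x. \<Sum>i\<in>elems T \<times> exponents k p. c i * dg_basis T i x)" if "v \<in> V" for v
    by (rule dg_space_span[OF mesh that])
qed

lemma solution_bound:
  assumes \<kappa>: "1 < \<kappa>" and small: "0 < 1 - \<kappa> * (1 - \<epsilon>)" and J: "0 \<le> J_form D T \<mu> \<eta> u u"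
    and coer: "(1 - \<kappa> * (1 - \<epsilon>)) * (norm_h1 D T \<mu> \<eta> \<kappa> u)\<^sup>2 \<le> 2 * \<kappa> * A_form D T \<mu> \<eta> A u u"
    and u: "u \<in> V" "A_form D T \<mu> \<eta> A u u = load u"
  shows "norm_h1 D T \<mu> \<eta> \<kappa> u \<le> 2 * \<kappa> * sqrt (real CARD('n)) * G / (1 - \<kappa> * (1 - \<epsilon>)) * L2_norm_on (region D) f"
proof -
  let ?N = "norm_h1 D T \<mu> \<eta> \<kappa> u" and ?a = "1 - \<kappa> * (1 - \<epsilon>)" and ?f = "L2_norm_on (region D) f"
  have kJ: "0 \<le> \<kappa> / 2 * J_form D T \<mu> \<eta> u u" using J \<kappa> by simp
  have C: "0 \<le> curv_sq D T u" by (rule curv_sq_nonneg)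
  have HN: "sqrt (H2_broken_sq T u) \<le> ?N" unfolding norm_h1_def using kJ C by (intro real_sqrt_le_mono) simp
  have N0: "0 \<le> ?N" unfolding norm_h1_def using kJ C H2_broken_sq_nonneg[of T u] by simp
  have f0: "0 \<le> ?f" by (simp add: L2_norm_on_def)
  have "?a * ?N\<^sup>2 \<le> 2 * \<kappa> * load u" using coer u(2) by simp
  also have "\<dots> \<le> 2 * \<kappa> * (G * sqrt (real CARD('n)) * (?f * sqrt (H2_broken_sq T u)))"
    using load_bound[OF u(1)] \<kappa> by (intro mult_left_mono) auto
  also have "\<dots> \<le> 2 * \<kappa> * (G * sqrt (real CARD('n)) * (?f * ?N))"
    using HN f0 \<kappa> G_nonneg by (intro mult_left_mono mult_nonneg_nonneg) auto
  finally have le: "(?a * ?N) * ?N \<le> (2 * \<kappa> * sqrt (real CARD('n)) * G * ?f) * ?N"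
    by (simp add: power2_eq_square ac_simps)
  have "?a * ?N \<le> 2 * \<kappa> * sqrt (real CARD('n)) * G * ?f"
  proof (cases "?N = 0")
    case True
    then show ?thesis using f0 \<kappa> G_nonneg by simp
  next
    case False
    then have "0 < ?N" using N0 by simp
    then show ?thesis using le by (rule mult_right_le_imp_le[rotated])
  qed
  then show ?thesis using small by (simp add: le_divide_eq mult.commute)
qed

end

theorem theorem3p3:
  fixes D :: "'n::finite piecewise_domain"
    and T :: "'i \<Rightarrow> 'n mesh"
    and A :: "real^'n \<Rightarrow> real^'n^'n"
    and f :: "real^'n \<Rightarrow> real"
    and k :: degree_kind and p :: nat
    and \<alpha> \<epsilon> \<kappa> \<sigma> c_stab c_H :: real
    and \<mu> \<eta> :: "'i \<Rightarrow> 'n face \<Rightarrow> real"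
  assumes "0 < \<alpha>" "\<alpha> < 1"
    and "piecewise_C2_convex_domain \<alpha> D"
    and "curvature_dichotomy D"
    and "\<forall>i. exact_mesh (region D) (T i)"
    and "shape_regular T"
    and "mesh_cond_M1 T" "mesh_cond_M2 T" "mesh_cond_M3 D T"
    and "Linf_matrix (region D) A"
    and "uniformly_elliptic (region D) A"
    and "0 < \<epsilon>" "\<epsilon> \<le> 1"
    and "cordes (region D) \<epsilon> A"
    and "L2_fun (region D) f"
    and "2 \<le> p"
    and "1 < \<kappa>" "\<epsilon> < 1 \<longrightarrow> \<kappa> < inverse (1 - \<epsilon>)"
    and "0 < c_stab" "1 \<le> \<sigma>"
    and "\<forall>i. \<forall>F\<in>faces (T i). \<mu> i F = \<sigma> * (c_stab * (1 / face_size (T i) F) + c_H)"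
    and "\<forall>i. \<forall>F\<in>faces (T i). 0 < \<mu> i F"
    and "\<forall>i. \<forall>F\<in>faces (T i). \<eta> i F \<ge> \<sigma> / face_size (T i) F ^ 3"
    and "\<forall>i. \<forall>v\<in>dg_space (region D) (T i) k p. \<forall>\<theta>. 0 < \<theta> \<and> \<theta> \<le> 1 \<longrightarrow>
           \<kappa> * B_theta D (T i) (\<mu> i) (\<eta> i) \<theta> v v
             \<ge> \<theta> * H2_broken_sq (T i) v + (1 - \<theta>) * lap_form (T i) v v
                + (1/2) * J_form D (T i) (\<mu> i) (\<eta> i) v v + (\<theta> / 2) * curv_sq D (T i) v"
  shows "\<forall>i.
      (\<forall>v\<in>dg_space (region D) (T i) k p.
         (norm_h1 D (T i) (\<mu> i) (\<eta> i) \<kappa> v)\<^sup>2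
           \<le> 2 * \<kappa> / (1 - \<kappa> * (1 - \<epsilon>)) * A_form D (T i) (\<mu> i) (\<eta> i) A v v)
    \<and> (\<exists>!u. u \<in> dg_space (region D) (T i) k p \<and>
         (\<forall>v\<in>dg_space (region D) (T i) k p.
            A_form D (T i) (\<mu> i) (\<eta> i) A u v
              = (\<Sum>K\<in>elems (T i). ip_elem K (\<lambda>x. gamma_coeff A x * f x) (laplacian v))))
    \<and> (\<forall>u\<in>dg_space (region D) (T i) k p.
         (\<forall>v\<in>dg_space (region D) (T i) k p.
            A_form D (T i) (\<mu> i) (\<eta> i) A u v
              = (\<Sum>K\<in>elems (T i). ip_elem K (\<lambda>x. gamma_coeff A x * f x) (laplacian v)))
         \<longrightarrow>
         norm_h1 D (T i) (\<mu> i) (\<eta> i) \<kappa> u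
           \<le> 2 * \<kappa> * sqrt (real CARD('n)) * Linf_norm_on (region D) (gamma_coeff A)
               / (1 - \<kappa> * (1 - \<epsilon>)) * L2_norm_on (region D) f
         \<and> (\<kappa>\<^sup>2 * (1 - \<epsilon>) < 1 \<longrightarrow>
         norm_h1 D (T i) (\<mu> i) (\<eta> i) \<kappa> u
           \<le> 2 * \<kappa> * sqrt (real CARD('n)) * Linf_norm_on (region D) (gamma_coeff A)
               / (1 - \<kappa>\<^sup>2 * (1 - \<epsilon>)) * L2_norm_on (region D) f))"
proof
  fix i
  note stab = assms(24)
  interpret cordes_problem D "T i" k p \<alpha> A f \<epsilon>
  proof
    show "piecewise_C2_convex_domain \<alpha> D" by fact
    show "exact_mesh (region D) (T i)" using assms(5) by blast
    show "\<exists>n\<in>{1..num_pieces D}. face_set F \<subseteq> closure (piece D n)" if "F \<in> bfaces (T i)" for F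
      using assms(9) that unfolding mesh_cond_M3_def by blast
  qed fact+
  have small: "0 < 1 - \<kappa> * (1 - \<epsilon>)"
  proof (cases "\<epsilon> < 1")
    case True
    then have "\<kappa> < inverse (1 - \<epsilon>)" using assms(18) by simp
    then show ?thesis using True by (simp add: field_simps)
  qed (use \<open>\<epsilon> \<le> 1\<close> in simp)
  have \<mu>: "0 < \<mu> i F" if "F \<in> faces (T i)" for F using assms(22) that by blast
  have \<eta>: "0 < \<eta> i F" if "F \<in> faces (T i)" for F
  proof -
    have "0 < \<sigma> / face_size (T i) F ^ 3" using face_size_pos[OF that] \<open>1 \<le> \<sigma>\<close> by simp
    moreover have "\<sigma> / face_size (T i) F ^ 3 \<le> \<eta> i F" using assms(23) that by blast
    ultimately show ?thesis by linarith
  qed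
  have J: "0 \<le> J_form D (T i) (\<mu> i) (\<eta> i) v v" for v
    by (rule J_form_nonneg) (use \<mu> \<eta> in \<open>auto intro: less_imp_le\<close>)
  have coer: "(1 - \<kappa> * (1 - \<epsilon>)) * (norm_h1 D (T i) (\<mu> i) (\<eta> i) \<kappa> v)\<^sup>2 \<le> 2 * \<kappa> * A_form D (T i) (\<mu> i) (\<eta> i) A v v"
    if v: "v \<in> V" for v
  proof (rule coercivity[OF v \<open>1 < \<kappa>\<close> J])
    have "0 < (1::real) \<and> (1::real) \<le> 1" by simp
    from stab[THEN spec, of i, THEN bspec, OF v, THEN spec, THEN mp, OF this]
    show "H2_broken_sq (T i) v + 1 / 2 * J_form D (T i) (\<mu> i) (\<eta> i) v v + 1 / 2 * curv_sq D (T i) v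
        \<le> \<kappa> * B_theta D (T i) (\<mu> i) (\<eta> i) 1 v v" by simp
  qed
  have bound: "norm_h1 D (T i) (\<mu> i) (\<eta> i) \<kappa> u
      \<le> 2 * \<kappa> * sqrt (real CARD('n)) * G / (1 - \<kappa> * (1 - \<epsilon>)) * L2_norm_on (region D) f"
    if u: "u \<in> V" "\<forall>v\<in>V. A_form D (T i) (\<mu> i) (\<eta> i) A u v = load v" for u
    by (rule solution_bound[OF \<open>1 < \<kappa>\<close> small J coer[OF u(1)] u(1)]) (use u in blast)
  have bound': "norm_h1 D (T i) (\<mu> i) (\<eta> i) \<kappa> u
      \<le> 2 * \<kappa> * sqrt (real CARD('n)) * G / (1 - \<kappa>\<^sup>2 * (1 - \<epsilon>)) * L2_norm_on (region D) f"
    if u: "u \<in> V" "\<forall>v\<in>V. A_form D (T i) (\<mu> i) (\<eta> i) A u v = load v" and s2: "\<kappa>\<^sup>2 * (1 - \<epsilon>) < 1" for u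
  proof -
    have "\<kappa> * (1 - \<epsilon>) \<le> \<kappa>\<^sup>2 * (1 - \<epsilon>)"
      using \<open>1 < \<kappa>\<close> \<open>\<epsilon> \<le> 1\<close> by (intro mult_right_mono) (auto simp: power2_eq_square)
    then have "2 * \<kappa> * sqrt (real CARD('n)) * G / (1 - \<kappa> * (1 - \<epsilon>)) \<le> 2 * \<kappa> * sqrt (real CARD('n)) * G / (1 - \<kappa>\<^sup>2 * (1 - \<epsilon>))"
      using s2 G_nonneg \<open>1 < \<kappa>\<close> small by (intro divide_left_mono mult_pos_pos mult_nonneg_nonneg) auto
    then have "2 * \<kappa> * sqrt (real CARD('n)) * G / (1 - \<kappa> * (1 - \<epsilon>)) * L2_norm_on (region D) f
        \<le> 2 * \<kappa> * sqrt (real CARD('n)) * G / (1 - \<kappa>\<^sup>2 * (1 - \<epsilon>)) * L2_norm_on (region D) f"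
      by (rule mult_right_mono) (simp add: L2_norm_on_def)
    then show ?thesis using bound[OF u] by linarith
  qed
  have first: "(norm_h1 D (T i) (\<mu> i) (\<eta> i) \<kappa> v)\<^sup>2
      \<le> 2 * \<kappa> / (1 - \<kappa> * (1 - \<epsilon>)) * A_form D (T i) (\<mu> i) (\<eta> i) A v v" if "v \<in> V" for v
    using coer[OF that] small by (simp add: le_divide_eq mult.commute)
  show "(\<forall>v\<in>V. (norm_h1 D (T i) (\<mu> i) (\<eta> i) \<kappa> v)\<^sup>2
           \<le> 2 * \<kappa> / (1 - \<kappa> * (1 - \<epsilon>)) * A_form D (T i) (\<mu> i) (\<eta> i) A v v)
    \<and> (\<exists>!u. u \<in> V \<and> (\<forall>v\<in>V. A_form D (T i) (\<mu> i) (\<eta> i) A u v = load v))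
    \<and> (\<forall>u\<in>V. (\<forall>v\<in>V. A_form D (T i) (\<mu> i) (\<eta> i) A u v = load v) \<longrightarrow>
         norm_h1 D (T i) (\<mu> i) (\<eta> i) \<kappa> u
           \<le> 2 * \<kappa> * sqrt (real CARD('n)) * G / (1 - \<kappa> * (1 - \<epsilon>)) * L2_norm_on (region D) f
         \<and> (\<kappa>\<^sup>2 * (1 - \<epsilon>) < 1 \<longrightarrow> norm_h1 D (T i) (\<mu> i) (\<eta> i) \<kappa> u
           \<le> 2 * \<kappa> * sqrt (real CARD('n)) * G / (1 - \<kappa>\<^sup>2 * (1 - \<epsilon>)) * L2_norm_on (region D) f))"
    by (intro conjI ballI impI first well_posed[OF \<open>1 < \<kappa>\<close> small \<mu> \<eta> coer] bound bound') blast+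
qed

end
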